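(* Let $p$ be a prime, let $\mathcal{A}$ be a finite Abelian group with $|\mathcal{A}|=p^2$, and let $(\mathcal{A}^{\mathbb{N}},F)$ be an affine invertible one-sided cellular automaton in Class (A). Let $\mu$ be an $(F,\sigma)$-invariant Borel probability measure on $\mathcal{A}^{\mathbb{N}}$. Assume that: 1. $\mu$ is ergodic for the $\mathbb{Z}\times\mathbb{N}$-action $(F,\sigma)$; 2. $\mathcal{I}_\mu(F)=\mathcal{I}_\mu(F^{p(p-1)(p^2-1)})$; 3. the measure entropy $h_\mu(\sigma)$ is positive. Then $\mu=\lambda_{\mathcal{A}^{\mathbb{N}}}$, the uniform Bernoulli measure on $\mathcal{A}^{\mathbb{N}}$.
   Context: $\mathcal{A}^{\mathbb{N}}$ has the product topology and product group structure, and $\sigma(x)_i=x_{i+1}$ is the one-sided shift. A one-sided cellular automaton (CA) is a continuous map $F:\mathcal{A}^{\mathbb{N}}\to\mathcal{A}^{\mathbb{N}}$ commuting with $\sigma$. "$r(F)=1$" means that $F$ is given by a local rule $\overline{F}:\mathcal{A}^2\to\mathcal{A}$, $F(x)_m=\overline{F}(x_mx_{m+1})$. $F$ is affine if $F=G+c$ where $G$ is a CA that is a group endomorphism and $c\in\mathcal{A}^{\mathbb{N}}$ is $\sigma$-invariant. For $F$ with $r(F)=1$, let $\mathcal{R}_F$ be the equivalence relation on $\mathcal{A}$: $a\,\mathcal{R}_F\,b$ iff $\overline{F}(\cdot\,a)=\overline{F}(\cdot\,b)$ as functions $\mathcal{A}\to\mathcal{A}$. Let $\mathcal{P}_{\mathcal{R}_F}$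 be the induced partition of $\mathcal{A}$, $C_{\mathcal{R}_F}(a)$ the class of $a$, and $\pi_F(a)=\overline{F}(aa)$. Class (A) consists of the invertible one-sided CA $F$ with $r(F)=r(F^{-1})=1$ such that (1) $|C\cap\pi_F(C')|\le 1$ for all $C,C'\in\mathcal{P}_{\mathcal{R}_F}$, and (2) for all $a\in\mathcal{A}$, $\mathrm{Im}(\overline{F}(a\,\cdot))=\pi_F(C_{\mathcal{R}_F}(a))$. (By Boyle–Maass, these are exactly the invertible CA with $r(F)=r(F^{-1})=1$ that are expansive and for which the map induced by $\sigma$ on the column subshift $\{(F^i(x)_0)_{i\in\mathbb{Z}}:x\in\mathcal{A}^{\mathbb{N}}\}$ has radius 1.) A measure $\mu$ is $(F,\sigma)$-invariant if $\mu(F^{-1}B)=\mu(\sigma^{-1}B)=\mu(B)$ for all Borel $B$. $\mathcal{I}_\mu(F^n)=\{B\text{ Borel}:\mu(F^{-n}(B)\triangle B)=0\}$. $h_\mu(\sigma)$ is the Kolmogorov–Sinai entropy. $\lambda_{\mathcal{A}^{\mathbb{N}}}$ gives each cylinder set fixing $n$ coordinates the mass $|\mathcal{A}|^{-n}$. *)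

theory Defs
  imports
    "HOL-Probability.Probability"
    "HOL-Computational_Algebra.Primes"
    "HOL-Library.Function_Algebras"
begin

text \<open>
  A finite alphabet is a type of sort \<open>{finite, discrete_topology}\<close>, so that the type
  \<open>nat \<Rightarrow> 'a\<close> of one-sided sequences carries the product of the discrete topologies; if the
  alphabet is moreover of sort \<open>ab_group_add\<close>, the group operations on \<open>nat \<Rightarrow> 'a\<close> are the
  coordinatewise ones of \<^theory>\<open>HOL-Library.Function_Algebras\<close>.
\<close>

section \<open>One-sided cellular automata\<close>

definition shift_map :: "(nat \<Rightarrow> 'a) \<Rightarrow> (nat \<Rightarrow> 'a)" where
  "shift_map x = (\<lambda>i. x (Suc i))"

definition one_sided_CA ::
  "((nat \<Rightarrow> 'a::{finite,discrete_topology}) \<Rightarrow> (nat \<Rightarrow> 'a)) \<Rightarrow> bool" where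
  "one_sided_CA F \<longleftrightarrow> continuous_on UNIV F \<and> F \<circ> shift_map = shift_map \<circ> F"

definition invertible_CA ::
  "((nat \<Rightarrow> 'a::{finite,discrete_topology}) \<Rightarrow> (nat \<Rightarrow> 'a)) \<Rightarrow> bool" where
  "invertible_CA F \<longleftrightarrow> one_sided_CA F \<and> bij F \<and> one_sided_CA (inv F)"

definition affine_CA ::
  "((nat \<Rightarrow> 'a::{finite,discrete_topology,ab_group_add}) \<Rightarrow> (nat \<Rightarrow> 'a)) \<Rightarrow> bool" where
  "affine_CA F \<longleftrightarrow>
     (\<exists>G c. one_sided_CA G \<and> (\<forall>x y. G (x + y) = G x + G y) \<and>
            shift_map c = c \<and> F = (\<lambda>x. G x + c))"

definition is_local_rule :: "('a \<Rightarrow> 'a \<Rightarrow> 'a) \<Rightarrow> ((nat \<Rightarrow> 'a) \<Rightarrow> (nat \<Rightarrow> 'a)) \<Rightarrow> bool" where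
  "is_local_rule f F \<longleftrightarrow> (\<forall>x m. F x m = f (x m) (x (Suc m)))"

definition has_radius_1 :: "((nat \<Rightarrow> 'a) \<Rightarrow> (nat \<Rightarrow> 'a)) \<Rightarrow> bool" where
  "has_radius_1 F \<longleftrightarrow> (\<exists>f. is_local_rule f F)"

lemma is_local_rule_unique:
  fixes f g :: "'a \<Rightarrow> 'a \<Rightarrow> 'a"
  assumes "is_local_rule f F" "is_local_rule g F"
  shows "f = g"
proof (intro ext)
  fix a b :: 'a
  let ?x = "\<lambda>i::nat. if i = 0 then a else b"
  have "f (?x 0) (?x (Suc 0)) = g (?x 0) (?x (Suc 0))"
    using assms[unfolded is_local_rule_def, THEN spec[where x = ?x], THEN spec[where x = 0]]
    by (rule trans[OF sym])
  then show "f a b = g a b" by simp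
qed

text \<open>The relation, the partition and the map \<open>\<pi>\<close> attached to a local rule \<open>f\<close>.\<close>

definition rule_rel :: "('a \<Rightarrow> 'a \<Rightarrow> 'a) \<Rightarrow> ('a \<times> 'a) set" where
  "rule_rel f = {(a, b). (\<lambda>c. f c a) = (\<lambda>c. f c b)}"

definition rule_partition :: "('a \<Rightarrow> 'a \<Rightarrow> 'a) \<Rightarrow> 'a set set" where
  "rule_partition f = UNIV // rule_rel f"

definition rule_class :: "('a \<Rightarrow> 'a \<Rightarrow> 'a) \<Rightarrow> 'a \<Rightarrow> 'a set" where
  "rule_class f a = rule_rel f `` {a}"

definition rule_pi :: "('a \<Rightarrow> 'a \<Rightarrow> 'a) \<Rightarrow> 'a \<Rightarrow> 'a" where
  "rule_pi f a = f a a"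

lemma equiv_rule_rel: "equiv UNIV (rule_rel f)"
  by (auto simp: equiv_def refl_on_def sym_def trans_def rule_rel_def)

text \<open>By \<open>is_local_rule_unique\<close>, the existential quantifier over \<open>f\<close> just names the local rule of \<open>F\<close>.\<close>

definition class_A ::
  "((nat \<Rightarrow> 'a::{finite,discrete_topology}) \<Rightarrow> (nat \<Rightarrow> 'a)) \<Rightarrow> bool" where
  "class_A F \<longleftrightarrow>
     invertible_CA F \<and> has_radius_1 (inv F) \<and>
     (\<exists>f. is_local_rule f F \<and>
          (\<forall>C\<in>rule_partition f. \<forall>C'\<in>rule_partition f. card (C \<inter> rule_pi f ` C') \<le> 1) \<and>
          (\<forall>a. range (f a) = rule_pi f ` rule_class f a))"

section \<open>Invariance and ergodicity\<close>

definition invariant_measure :: "'b measure \<Rightarrow> ('b \<Rightarrow> 'b) \<Rightarrow> bool" where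
  "invariant_measure M T \<longleftrightarrow> (\<forall>B\<in>sets M. emeasure M (T -` B \<inter> space M) = emeasure M B)"

definition invariant_sets :: "'b measure \<Rightarrow> ('b \<Rightarrow> 'b) \<Rightarrow> 'b set set" where
  "invariant_sets M T = {B \<in> sets M. emeasure M (sym_diff (T -` B \<inter> space M) B) = 0}"

definition ergodic_action :: "'b measure \<Rightarrow> ('i \<Rightarrow> 'b \<Rightarrow> 'b) \<Rightarrow> bool" where
  "ergodic_action M T \<longleftrightarrow>
     (\<forall>B. (\<forall>i. B \<in> invariant_sets M (T i)) \<longrightarrow> emeasure M B = 0 \<or> emeasure M B = 1)"

definition int_iter :: "('b \<Rightarrow> 'b) \<Rightarrow> int \<Rightarrow> 'b \<Rightarrow> 'b" where
  "int_iter F k = (if k \<ge> 0 then F ^^ nat k else inv F ^^ nat (- k))"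

text \<open>The action of \<open>\<int> \<times> \<nat>\<close> generated by a bijection \<open>F\<close> and a map \<open>S\<close> commuting with it.\<close>

definition ZN_action :: "('b \<Rightarrow> 'b) \<Rightarrow> ('b \<Rightarrow> 'b) \<Rightarrow> int \<times> nat \<Rightarrow> 'b \<Rightarrow> 'b" where
  "ZN_action F S = (\<lambda>(k, n). int_iter F k \<circ> S ^^ n)"

section \<open>Kolmogorov--Sinai entropy\<close>

definition finite_partition :: "'b measure \<Rightarrow> 'b set set \<Rightarrow> bool" where
  "finite_partition M P \<longleftrightarrow> finite P \<and> P \<subseteq> sets M \<and> partition_on (space M) P"

text \<open>The convention \<open>0 ln 0 = 0\<close> is automatic, because \<open>ln 0 = 0\<close> in HOL.\<close>

definition partition_entropy :: "'b measure \<Rightarrow> 'b set set \<Rightarrow> real" where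
  "partition_entropy M P = - (\<Sum>A\<in>P. measure M A * ln (measure M A))"

text \<open>
  The join of the partitions \<open>T\<^sup>-\<^sup>i P\<close> for \<open>i < n\<close>. It may contain the empty set, which
  contributes nothing to the entropy.
\<close>

definition iterated_join :: "'b measure \<Rightarrow> ('b \<Rightarrow> 'b) \<Rightarrow> 'b set set \<Rightarrow> nat \<Rightarrow> 'b set set" where
  "iterated_join M T P n =
     (\<lambda>A. {x \<in> space M. \<forall>i<n. (T ^^ i) x \<in> A i}) ` ({..<n} \<rightarrow>\<^sub>E P)"

text \<open>For a \<open>T\<close>-invariant probability measure the limit below exists by subadditivity.\<close>

definition KS_entropy_partition :: "'b measure \<Rightarrow> ('b \<Rightarrow> 'b) \<Rightarrow> 'b set set \<Rightarrow> real" where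
  "KS_entropy_partition M T P =
     lim (\<lambda>n. partition_entropy M (iterated_join M T P n) / real n)"

definition KS_entropy :: "'b measure \<Rightarrow> ('b \<Rightarrow> 'b) \<Rightarrow> ereal" where
  "KS_entropy M T = (SUP P\<in>{P. finite_partition M P}. ereal (KS_entropy_partition M T P))"

section \<open>The uniform Bernoulli measure\<close>

definition uniform_bernoulli :: "(nat \<Rightarrow> 'a::finite) measure" where
  "uniform_bernoulli = (\<Pi>\<^sub>M i\<in>UNIV. uniform_count_measure UNIV)"

lemma emeasure_uniform_bernoulli_cylinder:
  fixes w :: "nat \<Rightarrow> 'a::finite"
  assumes "finite J"
  shows "emeasure uniform_bernoulli {x. \<forall>i\<in>J. x i = w i} = ennreal ((1 / CARD('a)) ^ card J)"
proof -
  interpret P: product_prob_space "\<lambda>_::nat. uniform_count_measure (UNIV :: 'a set)" UNIV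
    by (intro product_prob_spaceI prob_space_uniform_count_measure) auto
  have single: "emeasure (uniform_count_measure (UNIV :: 'a set)) {a} = ennreal (1 / CARD('a))" for a
    by (simp add: emeasure_uniform_count_measure)
  have "emeasure uniform_bernoulli {x. \<forall>i\<in>J. x i = w i} =
      (\<Prod>i\<in>J. emeasure (uniform_count_measure (UNIV :: 'a set)) {w i})"
    using P.emeasure_PiM_Collect[of J "\<lambda>i. {w i}"] assms
    by (simp add: uniform_bernoulli_def space_PiM sets_uniform_count_measure
        space_uniform_count_measure)
  also have "\<dots> = ennreal ((1 / CARD('a)) ^ card J)"
    by (simp only: single prod_constant) (simp add: ennreal_power)
  finally show ?thesis .
qed

lemma sets_uniform_bernoulli:
  "sets (uniform_bernoulli :: (nat \<Rightarrow> 'a::{finite,discrete_topology}) measure) = sets borel"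
proof
  let ?B = "uniform_bernoulli :: (nat \<Rightarrow> 'a) measure"
  have cyl: "{x. x i \<in> A} \<in> sets (borel :: (nat \<Rightarrow> 'a) measure)" for i A
  proof -
    have "open ((\<lambda>x :: nat \<Rightarrow> 'a. x i) -` A)"
    proof (rule open_vimage)
      show "open A" by (rule discrete_topology_class.open_discrete)
      show "continuous_on UNIV (\<lambda>x :: nat \<Rightarrow> 'a. x i)"
        by (rule continuous_on_product_coordinates)
    qed
    then show ?thesis by (auto simp: vimage_def)
  qed
  show "sets ?B \<subseteq> sets borel"
    unfolding uniform_bernoulli_def sets_PiM_single
    by (intro sets.sigma_sets_subset') (auto simp: cyl space_uniform_count_measure)
  have meas: "{x. \<forall>i<n. x i = w i} \<in> sets ?B" for n and w :: "nat \<Rightarrow> 'a"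
  proof -
    have "prod_emb UNIV (\<lambda>_. uniform_count_measure (UNIV::'a set)) {..<n} (\<Pi>\<^sub>E i\<in>{..<n}. {w i}) \<in> sets ?B"
      unfolding uniform_bernoulli_def
      by (rule sets_PiM_I) (auto simp: sets_uniform_count_measure)
    also have "prod_emb UNIV (\<lambda>_. uniform_count_measure (UNIV::'a set)) {..<n} (\<Pi>\<^sub>E i\<in>{..<n}. {w i})
        = {x. \<forall>i<n. x i = w i}"
      by (auto simp: prod_emb_def PiE_def space_uniform_count_measure restrict_def Pi_def extensional_def)
    finally show ?thesis .
  qed
  have op: "U \<in> sets ?B" if "open U" for U :: "(nat \<Rightarrow> 'a) set"
  proof -
    define cyls where "cyls = range (\<lambda>xs :: 'a list. {x. \<forall>i<length xs. x i = xs ! i})"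
    have cyls_sets: "cyls \<subseteq> sets ?B"
      using meas[of "length xs" "\<lambda>i. xs ! i" for xs] by (auto simp: cyls_def)
    have "\<exists>C\<in>cyls. x \<in> C \<and> C \<subseteq> U" if "x \<in> U" for x
    proof -
      have "openin (product_topology (\<lambda>_. euclidean) UNIV) U"
        using \<open>open U\<close> by (simp add: open_fun_def)
      from product_topology_open_contains_basis[OF this \<open>x \<in> U\<close>]
      obtain X where X: "x \<in> (\<Pi>\<^sub>E i\<in>UNIV. X i)" "finite {i. X i \<noteq> UNIV}" "(\<Pi>\<^sub>E i\<in>UNIV. X i) \<subseteq> U"
        by auto
      then obtain n where n: "\<And>i. X i \<noteq> UNIV \<Longrightarrow> i < n"
        unfolding finite_nat_set_iff_bounded by auto
      let ?C = "{y. \<forall>i<length (map x [0..<n]). y i = map x [0..<n] ! i}"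
      have "?C \<subseteq> (\<Pi>\<^sub>E i\<in>UNIV. X i)"
      proof
        fix y assume y: "y \<in> ?C"
        have "y i \<in> X i" for i
        proof (cases "i < n")
          case True
          then have "y i = x i" using y by simp
          then show ?thesis using X(1) by (auto simp: PiE_iff)
        next
          case False
          then have "X i = UNIV" using n by blast
          then show ?thesis by simp
        qed
        then show "y \<in> (\<Pi>\<^sub>E i\<in>UNIV. X i)" by (simp add: PiE_iff)
      qed
      then have "?C \<subseteq> U" using X(3) by blast
      moreover have "x \<in> ?C" by simp
      moreover have "?C \<in> cyls" unfolding cyls_def by blast
      ultimately show ?thesis by (intro bexI[of _ ?C] conjI)
    qed
    then have "U \<subseteq> \<Union>{C \<in> cyls. C \<subseteq> U}"
      by (intro subsetI) (simp add: Bex_def conj_ac)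
    then have "U = \<Union>{C \<in> cyls. C \<subseteq> U}"
      by (intro equalityI) auto
    moreover have "\<Union>{C \<in> cyls. C \<subseteq> U} \<in> sets ?B"
    proof (rule sets.countable_Union)
      have "countable cyls" unfolding cyls_def by (intro countable_image) simp
      then show "countable {C \<in> cyls. C \<subseteq> U}" by (rule countable_subset[rotated]) auto
    qed (use cyls_sets in auto)
    ultimately show ?thesis by simp
  qed
  have sp: "space ?B = UNIV"
    by (simp add: uniform_bernoulli_def space_PiM space_uniform_count_measure)
  show "sets borel \<subseteq> sets ?B"
    using sets.sigma_sets_subset[of "{U. open U}" ?B] op sp by (auto simp: sets_borel)
qed

end

theory Submission
  imports Defs "HOL-Real_Asymp.Real_Asymp"
begin

text \<open>
  Write \<open>F x = G x + c\<close> with \<open>(G x)\<^sub>m = \<alpha> x\<^sub>m + \<beta> x\<^sub>m\<^sub>+\<^sub>1\<close>. Class (A) forces \<open>L = Im \<beta> = \<alpha> (Ker \<beta>)\<close> to be a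
  complement of \<open>Ker \<beta>\<close>, so \<open>x\<close> is coded by its column \<open>z\<^sub>i = (F\<^sup>i x)\<^sub>0 mod L\<close> and the first \<open>n\<close>
  coordinates carry exactly the information of a window of length \<open>2 n\<close> of \<open>z\<close>.

  An \<open>F\<close>-invariant set is mod \<open>\<mu>\<close> of the form \<open>\<sigma>\<^sup>-\<^sup>m C\<close>: by the coding, \<open>h\<^sub>\<mu>(\<sigma>) = 2 h\<^sub>\<mu>(F)\<close>, also
  relative to the \<open>\<sigma>\<close>-itinerary of the set, which therefore has zero entropy. Let \<open>\<phi>\<^sub>d(x)\<close> be the
  conditional probability of \<open>x + d\<close> given \<open>\<sigma>\<^sup>m x\<close>, where \<open>d\<close> is supported below \<open>m\<close>. Then
  \<open>\<phi>\<^sub>G\<^sub>d(F x) = \<phi>\<^sub>d(x)\<close>, and \<open>G\<close> acts on such \<open>d\<close> with order dividing \<open>p (p - 1) (p\<^sup>2 - 1)\<close> times a power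
  of \<open>p\<close>; hence \<open>\<phi>\<^sub>d\<close> is \<open>F\<close>-invariant, so it is constant on the fibres of \<open>\<sigma>\<^sup>m\<close>. Consequently
  the conditional measure is uniform on a coset of a \<open>G\<close>-stable finite group. Positive entropy and
  ergodicity make this group grow to infinity with \<open>m\<close>, and a large \<open>G\<close>-stable group of finitely
  supported sequences projects onto all words, by the coding of columns.
\<close>

section \<open>Entropy of finite-valued functions\<close>


text \<open>Two obstacles shape the argument. First, for a fixed d the function
  \<open>\<phi>\<close> is a priori only periodic along F-orbits, with the period of d under G. The
  alphabet is the sum of two groups of order p, hence a plane over F_p, and p (p - 1) (p^2 - 1) is
  the order of its automorphism group GL_2(F_p). Each further coordinate multiplies the period by at
  most p, and because p divides the exponent in hypothesis 2, that hypothesis passes from the power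
  N to every N p^j. Second, an F-invariant set need not be \<sigma>-invariant, so joint ergodicity
  says nothing about the level sets of \<open>\<phi>\<close>. Entropy takes its place: such a level
  set is determined by \<sigma>^m x, which does not distinguish x from x + d, so
  \<open>\<phi>\<close> agrees at all points of a fibre that carry mass, and this makes the support
  of the conditional measure closed under addition. Ergodicity serves recurrence instead: positive
  entropy yields points whose first letter is not determined by the rest, and orbits return to them
  infinitely often, each return enlarging the support group.\<close>

locale full_prob_space = prob_space M for M :: "'b measure" +
  assumes space_UNIV [simp]: "space M = UNIV"
begin

text \<open>Entropy is taken as the mean of the information function. It depends on the fibres of X
  alone, so values of any type are allowed, and entropy inequalities reduce to almost sure ones
  between logarithms.\<close>

definition atom_prob :: "('b \<Rightarrow> 'c) \<Rightarrow> 'b \<Rightarrow> real" where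
  "atom_prob X \<omega> = prob {\<omega>'. X \<omega>' = X \<omega>}"

definition ent :: "('b \<Rightarrow> 'c) \<Rightarrow> real" where
  "ent X = expectation (\<lambda>\<omega>. - ln (atom_prob X \<omega>))"

lemma simple_atom_sets [measurable]:
  assumes "simple_function M X"
  shows "{\<omega>. X \<omega> = v} \<in> sets M"
proof -
  have "X -` {v} \<inter> space M \<in> sets M" by (rule simple_functionD(2)[OF assms])
  then show ?thesis by (simp add: vimage_def)
qed

lemma simple_pred_sets:
  assumes "simple_function M X"
  shows "{\<omega>. Q (X \<omega>)} \<in> sets M"
proof -
  have "X -` Collect Q \<inter> space M \<in> sets M" by (rule simple_functionD(2)[OF assms])
  then show ?thesis by (simp add: vimage_def)
qed

lemma simple_atom_prob:
  assumes "simple_function M X"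
  shows "simple_function M (\<lambda>\<omega>. h (atom_prob X \<omega>))"
  using simple_function_compose1[OF assms, of "\<lambda>v. h (prob {\<omega>'. X \<omega>' = v})"]
  by (simp add: atom_prob_def)

lemma integrable_simple:
  fixes X :: "'b \<Rightarrow> real"
  assumes "simple_function M X"
  shows "integrable M X"
proof -
  have fin: "finite (range X)" using simple_functionD(1)[OF assms] by simp
  have "\<bar>X x\<bar> \<le> Max (abs ` range X)" for x
    using fin by (intro Max_ge) auto
  then show ?thesis
    using borel_measurable_simple_function[OF assms]
    by (intro integrable_const_bound[where B = "Max (abs ` range X)"]) auto
qed

lemma expectation_simple:
  assumes "simple_function M X"
  shows "expectation (\<lambda>\<omega>. (g (X \<omega>) :: real)) = (\<Sum>v\<in>range X. prob {\<omega>. X \<omega> = v} * g v)"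
proof -
  have fin: "finite (range X)" using simple_functionD(1)[OF assms] by simp
  have eq: "g (X \<omega>) = (\<Sum>v\<in>range X. g v * indicator {\<omega>. X \<omega> = v} \<omega>)" for \<omega>
    using fin by (simp add: indicator_def sum.delta' if_distrib cong: if_cong)
  have int: "integrable M (\<lambda>\<omega>. g v * indicat_real {\<omega>. X \<omega> = v} \<omega>)" for v
    using integrable_real_indicator[OF simple_atom_sets[OF assms, of v]]
    by (simp add: emeasure_eq_measure)
  have "expectation (\<lambda>\<omega>. g (X \<omega>)) = expectation (\<lambda>\<omega>. \<Sum>v\<in>range X. g v * indicator {\<omega>. X \<omega> = v} \<omega>)"
    by (rule Bochner_Integration.integral_cong[OF refl eq])
  also have "\<dots> = (\<Sum>v\<in>range X. expectation (\<lambda>\<omega>. g v * indicator {\<omega>. X \<omega> = v} \<omega>))"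
    by (rule Bochner_Integration.integral_sum[OF int])
  also have "\<dots> = (\<Sum>v\<in>range X. prob {\<omega>. X \<omega> = v} * g v)"
    by (intro sum.cong refl) simp
  finally show ?thesis .
qed

text \<open>Since \<open>ln 0 = 0\<close> in HOL, identities between logarithms can fail on null
  atoms; there are finitely many of these, so almost every point avoids them.\<close>

lemma atom_prob_pos:
  assumes "simple_function M X"
  shows "AE \<omega> in M. 0 < atom_prob X \<omega>"
proof -
  have fin: "finite (range X)" using simple_functionD(1)[OF assms] by simp
  have "AE \<omega> in M. \<forall>v\<in>range X. prob {\<omega>. X \<omega> = v} = 0 \<longrightarrow> X \<omega> \<noteq> v"
  proof (rule AE_finite_allI[OF fin])
    fix v
    show "AE \<omega> in M. prob {\<omega>. X \<omega> = v} = 0 \<longrightarrow> X \<omega> \<noteq> v"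
    proof (cases "prob {\<omega>. X \<omega> = v} = 0")
      case True
      then show ?thesis
        using prob_eq_0[OF simple_atom_sets[OF assms, of v]] by simp
    qed simp
  qed
  then show ?thesis
    by eventually_elim (auto simp: atom_prob_def zero_less_measure_iff)
qed

lemma ent_sum:
  assumes "simple_function M X"
  shows "ent X = - (\<Sum>v\<in>range X. prob {\<omega>. X \<omega> = v} * ln (prob {\<omega>. X \<omega> = v}))"
  using expectation_simple[OF assms, of "\<lambda>v. - ln (prob {\<omega>. X \<omega> = v})"]
  by (simp add: ent_def atom_prob_def sum_negf)

lemma ent_cong_fibres:
  assumes "\<And>\<omega> \<omega>'. X \<omega> = X \<omega>' \<longleftrightarrow> Y \<omega> = Y \<omega>'"
  shows "ent X = ent Y"
  by (simp add: ent_def atom_prob_def assms)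

lemma ent_cong_AE:
  assumes X: "simple_function M X" and Y: "simple_function M Y" and ae: "AE \<omega> in M. X \<omega> = Y \<omega>"
  shows "ent X = ent Y"
proof -
  have "prob {\<omega>. X \<omega> = v} = prob {\<omega>. Y \<omega> = v}" for v
    using ae by (intro finite_measure_eq_AE) (auto simp: simple_atom_sets X Y)
  then have "AE \<omega> in M. - ln (atom_prob X \<omega>) = - ln (atom_prob Y \<omega>)"
    using ae by (auto simp: atom_prob_def)
  then show ?thesis unfolding ent_def
    using borel_measurable_simple_function[OF simple_atom_prob[OF X, of "\<lambda>p. - ln p"]]
      borel_measurable_simple_function[OF simple_atom_prob[OF Y, of "\<lambda>p. - ln p"]]
    by (intro integral_cong_AE) auto
qed

lemma ent_const: "ent (\<lambda>_. c) = 0"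
  by (simp add: ent_def atom_prob_def prob_space[unfolded space_UNIV])

lemma atom_prob_mono:
  assumes X: "simple_function M X" and g: "\<And>\<omega> \<omega>'. Y \<omega> = Y \<omega>' \<Longrightarrow> X \<omega> = X \<omega>'"
  shows "atom_prob Y \<omega> \<le> atom_prob X \<omega>"
  unfolding atom_prob_def
  by (intro finite_measure_mono) (auto simp: simple_atom_sets[OF X] dest: g)

lemma ent_mono:
  assumes X: "simple_function M X" and Y: "simple_function M Y"
    and g: "\<And>\<omega> \<omega>'. Y \<omega> = Y \<omega>' \<Longrightarrow> X \<omega> = X \<omega>'"
  shows "ent X \<le> ent Y"
  unfolding ent_def
proof (rule integral_mono_AE)
  show "integrable M (\<lambda>\<omega>. - ln (atom_prob X \<omega>))" "integrable M (\<lambda>\<omega>. - ln (atom_prob Y \<omega>))"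
    using integrable_simple[OF simple_atom_prob[OF X, of "\<lambda>p. - ln p"]]
      integrable_simple[OF simple_atom_prob[OF Y, of "\<lambda>p. - ln p"]] by simp_all
  show "AE \<omega> in M. - ln (atom_prob X \<omega>) \<le> - ln (atom_prob Y \<omega>)"
    using atom_prob_pos[OF X] atom_prob_pos[OF Y]
  proof eventually_elim
    case (elim \<omega>)
    have "atom_prob Y \<omega> \<le> atom_prob X \<omega>"
      by (rule atom_prob_mono[OF X]) (rule g)
    then show ?case using elim by simp
  qed
qed

text \<open>Nonnegativity of the conditional mutual information I(X; Y | Z). With q the ratio of the
  conditionally independent law to the true joint law, \<open>ln q \<le> q - 1\<close> reduces it to
  E q \<le> 1.\<close>

lemma ent_submodular:
  assumes X: "simple_function M X" and Y: "simple_function M Y" and Z: "simple_function M Z"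
  shows "ent (\<lambda>\<omega>. (X \<omega>, Y \<omega>, Z \<omega>)) + ent Z \<le> ent (\<lambda>\<omega>. (X \<omega>, Z \<omega>)) + ent (\<lambda>\<omega>. (Y \<omega>, Z \<omega>))"
proof -
  define W where "W = (\<lambda>\<omega>. (X \<omega>, Y \<omega>, Z \<omega>))"
  note XZ = simple_function_Pair[OF X Z] and YZ = simple_function_Pair[OF Y Z]
  have W: "simple_function M W" unfolding W_def by (intro simple_function_Pair X Y Z)
  have finX: "finite (range X)" "finite (range Y)" "finite (range Z)" "finite (range W)"
    using simple_functionD(1)[OF X] simple_functionD(1)[OF Y] simple_functionD(1)[OF Z]
      simple_functionD(1)[OF W] by simp_all
  define pz where "pz z = prob {\<omega>. Z \<omega> = z}" for z
  define pxz where "pxz x z = prob {\<omega>. X \<omega> = x \<and> Z \<omega> = z}" for x z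
  define pyz where "pyz y z = prob {\<omega>. Y \<omega> = y \<and> Z \<omega> = z}" for y z
  define pw where "pw w = prob {\<omega>. W \<omega> = w}" for w
  have ap: "atom_prob Z \<omega> = pz (Z \<omega>)" "atom_prob (\<lambda>\<omega>. (X \<omega>, Z \<omega>)) \<omega> = pxz (X \<omega>) (Z \<omega>)"
    "atom_prob (\<lambda>\<omega>. (Y \<omega>, Z \<omega>)) \<omega> = pyz (Y \<omega>) (Z \<omega>)" "atom_prob W \<omega> = pw (W \<omega>)" for \<omega>
    by (simp_all add: atom_prob_def pz_def pxz_def pyz_def pw_def)
  have margX: "(\<Sum>x\<in>range X. pxz x z) = pz z" for z
  proof -
    have "pz z = prob (\<Union>x\<in>range X. {\<omega>. X \<omega> = x \<and> Z \<omega> = z})"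
      unfolding pz_def by (intro arg_cong[where f = prob]) auto
    also have "\<dots> = (\<Sum>x\<in>range X. pxz x z)" unfolding pxz_def
      using simple_pred_sets[OF XZ, of "\<lambda>v. v = (x, z)" for x] finX
      by (intro finite_measure_finite_Union) (auto simp: disjoint_family_on_def)
    finally show ?thesis by simp
  qed
  have margY: "(\<Sum>y\<in>range Y. pyz y z) = pz z" for z
  proof -
    have "pz z = prob (\<Union>y\<in>range Y. {\<omega>. Y \<omega> = y \<and> Z \<omega> = z})"
      unfolding pz_def by (intro arg_cong[where f = prob]) auto
    also have "\<dots> = (\<Sum>y\<in>range Y. pyz y z)" unfolding pyz_def
      using simple_pred_sets[OF YZ, of "\<lambda>v. v = (y, z)" for y] finX
      by (intro finite_measure_finite_Union) (auto simp: disjoint_family_on_def)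
    finally show ?thesis by simp
  qed
  have margZ: "(\<Sum>z\<in>range Z. pz z) = 1"
    using expectation_simple[OF Z, of "\<lambda>_. 1"] by (simp add: pz_def prob_space[unfolded space_UNIV])
  define q where "q \<omega> = pxz (X \<omega>) (Z \<omega>) * pyz (Y \<omega>) (Z \<omega>) / (pw (W \<omega>) * pz (Z \<omega>))" for \<omega>
  define q' where "q' = (\<lambda>(x, y, z). pxz x z * pyz y z / (pw (x, y, z) * pz z))"
  have qW: "q = (\<lambda>\<omega>. q' (W \<omega>))" by (simp add: q_def q'_def W_def fun_eq_iff)
  have nn: "0 \<le> pxz x z" "0 \<le> pyz y z" "0 \<le> pz z" "0 \<le> pw w" for x y z w
    by (simp_all add: pxz_def pyz_def pz_def pw_def)
  have "expectation q = (\<Sum>w\<in>range W. pw w * q' w)"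
    unfolding qW pw_def by (rule expectation_simple[OF W])
  \<comment> \<open>Division by zero makes \<open>q'\<close> vanish on null atoms of W, so these
    contribute an inequality instead of an equality.\<close>
  also have "\<dots> \<le> (\<Sum>w\<in>range W. case w of (x, y, z) \<Rightarrow> pxz x z * pyz y z / pz z)"
  proof (intro sum_mono)
    show "pw w * q' w \<le> (case w of (x, y, z) \<Rightarrow> pxz x z * pyz y z / pz z)" for w
    proof (cases w)
      case (fields x y z)
      then show ?thesis using nn(1)[of x z] nn(2)[of y z] nn(3)[of z]
        by (cases "pw w = 0") (simp_all add: q'_def)
    qed
  qed
  also have "\<dots> \<le> (\<Sum>w\<in>range X \<times> range Y \<times> range Z. case w of (x, y, z) \<Rightarrow> pxz x z * pyz y z / pz z)"
  proof (intro sum_mono2)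
    show "finite (range X \<times> range Y \<times> range Z)" using finX by simp
    show "range W \<subseteq> range X \<times> range Y \<times> range Z" by (auto simp: W_def)
    show "0 \<le> (case w of (x, y, z) \<Rightarrow> pxz x z * pyz y z / pz z)" for w
      by (cases w) (simp add: nn)
  qed
  also have "\<dots> = (\<Sum>x\<in>range X. \<Sum>y\<in>range Y. \<Sum>z\<in>range Z. pxz x z * pyz y z / pz z)"
    by (simp add: sum.cartesian_product split_beta')
  also have "\<dots> = (\<Sum>x\<in>range X. \<Sum>z\<in>range Z. \<Sum>y\<in>range Y. pxz x z * pyz y z / pz z)"
    by (intro sum.cong refl sum.swap)
  also have "\<dots> = (\<Sum>z\<in>range Z. \<Sum>x\<in>range X. \<Sum>y\<in>range Y. pxz x z * pyz y z / pz z)"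
    by (rule sum.swap)
  also have "\<dots> = (\<Sum>z\<in>range Z. (\<Sum>x\<in>range X. pxz x z) * (\<Sum>y\<in>range Y. pyz y z) / pz z)"
    by (simp add: sum_product sum_divide_distrib)
  also have "\<dots> = (\<Sum>z\<in>range Z. pz z)"
    by (intro sum.cong) (auto simp: margX margY)
  finally have q1: "expectation q \<le> 1" using margZ by simp
  have sW: "simple_function M q"
    unfolding qW by (rule simple_function_compose1[OF W])
  have I: "integrable M (\<lambda>\<omega>. ln (pz (Z \<omega>)))" "integrable M (\<lambda>\<omega>. ln (pxz (X \<omega>) (Z \<omega>)))"
    "integrable M (\<lambda>\<omega>. ln (pyz (Y \<omega>) (Z \<omega>)))" "integrable M (\<lambda>\<omega>. ln (pw (W \<omega>)))"
    using integrable_simple[OF simple_atom_prob[OF Z, of ln]] integrable_simple[OF simple_atom_prob[OF XZ, of ln]]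
      integrable_simple[OF simple_atom_prob[OF YZ, of ln]] integrable_simple[OF simple_atom_prob[OF W, of ln]]
    by (simp_all add: ap)
  have pos: "AE \<omega> in M. 0 < pz (Z \<omega>) \<and> 0 < pxz (X \<omega>) (Z \<omega>) \<and> 0 < pyz (Y \<omega>) (Z \<omega>) \<and> 0 < pw (W \<omega>)"
    using atom_prob_pos[OF Z] atom_prob_pos[OF XZ] atom_prob_pos[OF YZ] atom_prob_pos[OF W]
    by eventually_elim (simp add: ap)
  have "0 \<le> expectation (\<lambda>\<omega>. 1 - q \<omega>)"
    using q1 integrable_simple[OF sW]
    by (simp add: prob_space[unfolded space_UNIV])
  also have "\<dots> \<le> expectation (\<lambda>\<omega>. ln (pw (W \<omega>)) + ln (pz (Z \<omega>)) - ln (pxz (X \<omega>) (Z \<omega>)) - ln (pyz (Y \<omega>) (Z \<omega>)))"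
  proof (rule integral_mono_AE)
    show "integrable M (\<lambda>\<omega>. 1 - q \<omega>)" using integrable_simple[OF sW] by simp
    show "integrable M (\<lambda>\<omega>. ln (pw (W \<omega>)) + ln (pz (Z \<omega>)) - ln (pxz (X \<omega>) (Z \<omega>)) - ln (pyz (Y \<omega>) (Z \<omega>)))"
      using I by simp
    show "AE \<omega> in M. 1 - q \<omega> \<le> ln (pw (W \<omega>)) + ln (pz (Z \<omega>)) - ln (pxz (X \<omega>) (Z \<omega>)) - ln (pyz (Y \<omega>) (Z \<omega>))"
      using pos
    proof eventually_elim
      case (elim \<omega>)
      then have "0 < q \<omega>" by (simp add: q_def)
      then have "ln (q \<omega>) \<le> q \<omega> - 1" by (rule ln_le_minus_one)
      moreover have "ln (q \<omega>) = ln (pxz (X \<omega>) (Z \<omega>)) + ln (pyz (Y \<omega>) (Z \<omega>)) - (ln (pw (W \<omega>)) + ln (pz (Z \<omega>)))"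
        using elim by (simp add: q_def ln_div ln_mult)
      ultimately show ?case by simp
    qed
  qed
  also have "\<dots> = - ent W - ent Z + ent (\<lambda>\<omega>. (X \<omega>, Z \<omega>)) + ent (\<lambda>\<omega>. (Y \<omega>, Z \<omega>))"
    using I by (simp add: ent_def ap)
  finally show ?thesis by (simp add: W_def)
qed

text \<open>Conditional entropy H(X | Y), written throughout as H(X, Y) - H(Y), drops under a finer
  condition. As Z is a function of Y, the triple in \<open>ent_submodular\<close> has the fibres of
  (X, Y).\<close>

lemma ent_cond_mono:
  assumes X: "simple_function M X" and Y: "simple_function M Y" and Z: "simple_function M Z"
    and g: "\<And>\<omega> \<omega>'. Y \<omega> = Y \<omega>' \<Longrightarrow> Z \<omega> = Z \<omega>'"
  shows "ent (\<lambda>\<omega>. (X \<omega>, Y \<omega>)) - ent Y \<le> ent (\<lambda>\<omega>. (X \<omega>, Z \<omega>)) - ent Z"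
proof -
  have "ent (\<lambda>\<omega>. (X \<omega>, Y \<omega>, Z \<omega>)) = ent (\<lambda>\<omega>. (X \<omega>, Y \<omega>))" "ent (\<lambda>\<omega>. (Y \<omega>, Z \<omega>)) = ent Y"
    by (auto intro!: ent_cong_fibres dest: g)
  then show ?thesis using ent_submodular[OF X Y Z] by simp
qed

end

section \<open>Measure-preserving maps and the entropy of itineraries\<close>

context full_prob_space
begin

definition preserves :: "('b \<Rightarrow> 'b) \<Rightarrow> bool" where
  "preserves T \<longleftrightarrow> T \<in> measurable M M \<and> distr M M T = M"

lemma preserves_vimage_sets:
  assumes "preserves T" "B \<in> sets M"
  shows "T -` B \<in> sets M"
  using measurable_sets[of T M M B] assms by (simp add: preserves_def)

lemma preserves_prob:
  assumes "preserves T" "B \<in> sets M"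
  shows "prob (T -` B) = prob B"
  using measure_distr[of T M M B] assms by (simp add: preserves_def)

lemma preservesI:
  assumes "T \<in> measurable M M" "\<And>B. B \<in> sets M \<Longrightarrow> prob (T -` B) = prob B"
  shows "preserves T"
  unfolding preserves_def
proof (intro conjI assms(1) measure_eqI)
  fix B assume "B \<in> sets (distr M M T)"
  then show "emeasure (distr M M T) B = emeasure M B"
    using assms by (simp add: emeasure_distr emeasure_eq_measure)
qed simp

lemma preserves_AE:
  assumes T: "preserves T" and P: "AE \<omega> in M. P \<omega>"
  shows "AE \<omega> in M. P (T \<omega>)"
proof -
  have "T \<in> measurable M M" and "distr M M T = M" using T by (auto simp: preserves_def)
  then show ?thesis using AE_distrD[of T M M P] P by metis
qed

lemma preserves_comp:
  assumes "preserves T" "preserves U"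
  shows "preserves (T \<circ> U)"
  using assms distr_distr[of T M M U M] by (auto simp: preserves_def)

lemma preserves_id: "preserves id"
  by (simp add: preserves_def id_def distr_id2)

lemma preserves_funpow: "preserves T \<Longrightarrow> preserves (T ^^ n)"
  by (induction n) (auto simp: preserves_id intro: preserves_comp)

lemma simple_function_preserves:
  assumes X: "simple_function M X" and T: "preserves T"
  shows "simple_function M (\<lambda>\<omega>. X (T \<omega>))"
  unfolding simple_function_def
proof (intro conjI ballI)
  show "finite ((\<lambda>\<omega>. X (T \<omega>)) ` space M)"
    by (rule finite_subset[OF _ simple_functionD(1)[OF X]]) auto
  show "(\<lambda>\<omega>. X (T \<omega>)) -` {v} \<inter> space M \<in> sets M" for v
    using preserves_vimage_sets[OF T simple_atom_sets[OF X, of v]] by (simp add: vimage_def)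
qed

lemma ent_comp:
  assumes X: "simple_function M X" and T: "preserves T"
  shows "ent (\<lambda>\<omega>. X (T \<omega>)) = ent X"
proof -
  have eq: "atom_prob (\<lambda>\<omega>. X (T \<omega>)) \<omega> = atom_prob X (T \<omega>)" for \<omega>
    using preserves_prob[OF T simple_atom_sets[OF X, of "X (T \<omega>)"]]
    by (simp add: atom_prob_def vimage_def)
  have "ent X = integral\<^sup>L (distr M M T) (\<lambda>\<omega>. - ln (atom_prob X \<omega>))"
    using T by (simp add: ent_def preserves_def)
  also have "\<dots> = expectation (\<lambda>\<omega>. - ln (atom_prob X (T \<omega>)))"
    using T borel_measurable_simple_function[OF simple_atom_prob[OF X, of "\<lambda>p. - ln p"]]
    by (intro integral_distr) (auto simp: preserves_def)
  finally show ?thesis by (simp add: ent_def eq)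
qed

definition itinerary :: "('b \<Rightarrow> 'b) \<Rightarrow> ('b \<Rightarrow> 'c) \<Rightarrow> nat \<Rightarrow> 'b \<Rightarrow> nat \<Rightarrow> 'c" where
  "itinerary T X n \<omega> = (\<lambda>i\<in>{..<n}. X ((T ^^ i) \<omega>))"

lemma itinerary_eq_iff:
  "itinerary T X n \<omega> = itinerary T X n \<omega>' \<longleftrightarrow> (\<forall>i<n. X ((T ^^ i) \<omega>) = X ((T ^^ i) \<omega>'))"
  by (auto simp: itinerary_def restrict_def fun_eq_iff)

lemma simple_itinerary:
  assumes X: "simple_function M X" and T: "preserves T"
  shows "simple_function M (itinerary T X n)"
  unfolding simple_function_def
proof (intro conjI ballI)
  have "range (itinerary T X n) \<subseteq> {..<n} \<rightarrow>\<^sub>E range X"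
    by (auto simp: itinerary_def PiE_iff extensional_def split: if_splits)
  moreover have "finite ({..<n} \<rightarrow>\<^sub>E range X)"
    using simple_functionD(1)[OF X] by (intro finite_PiE) auto
  ultimately show "finite (itinerary T X n ` space M)"
    using finite_subset by auto
  fix v assume "v \<in> itinerary T X n ` space M"
  then obtain \<omega>0 where v: "v = itinerary T X n \<omega>0" by auto
  have "itinerary T X n -` {v} \<inter> space M = (\<Inter>i\<in>{..<n}. {\<omega>. X ((T ^^ i) \<omega>) = X ((T ^^ i) \<omega>0)}) \<inter> space M"
    by (auto simp: v itinerary_eq_iff)
  also have "\<dots> \<in> sets M"
    using simple_atom_sets[OF simple_function_preserves[OF X preserves_funpow[OF T]]]
    using sets.top[of M] by (cases "n = 0") (auto intro!: sets.Int sets.finite_INT)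
  finally show "itinerary T X n -` {v} \<inter> space M \<in> sets M" .
qed

lemma itinerary_Suc_eq_iff:
  "itinerary T X (Suc n) \<omega> = itinerary T X (Suc n) \<omega>' \<longleftrightarrow>
     X \<omega> = X \<omega>' \<and> itinerary T X n (T \<omega>) = itinerary T X n (T \<omega>')"
  by (auto simp: itinerary_eq_iff less_Suc_eq_0_disj funpow_swap1)

lemma itinerary_Suc_eq_iff':
  "itinerary T X (Suc n) \<omega> = itinerary T X (Suc n) \<omega>' \<longleftrightarrow>
     X ((T ^^ n) \<omega>) = X ((T ^^ n) \<omega>') \<and> itinerary T X n \<omega> = itinerary T X n \<omega>'"
  by (auto simp: itinerary_eq_iff less_Suc_eq)

text \<open>T preserves M and fixes Y, so the n-block may be read one step later: the increment is
  H(X | the n letters after it, Y). In this form the conditions for different n are nested.\<close>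

lemma itinerary_increment:
  assumes X: "simple_function M X" and T: "preserves T" and Y: "simple_function M Y"
    and inv: "AE \<omega> in M. Y (T \<omega>) = Y \<omega>"
  shows "ent (\<lambda>\<omega>. (itinerary T X (Suc n) \<omega>, Y \<omega>)) - ent (\<lambda>\<omega>. (itinerary T X n \<omega>, Y \<omega>)) =
    ent (\<lambda>\<omega>. (X \<omega>, (itinerary T X n (T \<omega>), Y \<omega>))) - ent (\<lambda>\<omega>. (itinerary T X n (T \<omega>), Y \<omega>))"
proof -
  note I = simple_itinerary[OF X T]
  note IT = simple_function_preserves[OF I T]
  note YT = simple_function_preserves[OF Y T]
  have "ent (\<lambda>\<omega>. (itinerary T X n \<omega>, Y \<omega>)) = ent (\<lambda>\<omega>. (itinerary T X n (T \<omega>), Y (T \<omega>)))"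
    using ent_comp[OF simple_function_Pair[OF I Y] T] by simp
  also have "\<dots> = ent (\<lambda>\<omega>. (itinerary T X n (T \<omega>), Y \<omega>))"
    using inv by (intro ent_cong_AE simple_function_Pair IT YT Y) auto
  moreover have "ent (\<lambda>\<omega>. (itinerary T X (Suc n) \<omega>, Y \<omega>)) = ent (\<lambda>\<omega>. (X \<omega>, (itinerary T X n (T \<omega>), Y \<omega>)))"
    by (rule ent_cong_fibres) (simp add: itinerary_Suc_eq_iff)
  ultimately show ?thesis by simp
qed

lemma itinerary_increment_nonneg:
  assumes X: "simple_function M X" and T: "preserves T" and Y: "simple_function M Y"
  shows "ent (\<lambda>\<omega>. (itinerary T X n \<omega>, Y \<omega>)) \<le> ent (\<lambda>\<omega>. (itinerary T X (Suc n) \<omega>, Y \<omega>))"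
  by (rule ent_mono) (auto intro!: simple_function_Pair simple_itinerary X T Y simp: itinerary_Suc_eq_iff')

lemma itinerary_increment_decseq:
  assumes X: "simple_function M X" and T: "preserves T" and Y: "simple_function M Y"
    and inv: "AE \<omega> in M. Y (T \<omega>) = Y \<omega>"
  shows "decseq (\<lambda>n. ent (\<lambda>\<omega>. (itinerary T X (Suc n) \<omega>, Y \<omega>)) - ent (\<lambda>\<omega>. (itinerary T X n \<omega>, Y \<omega>)))"
  unfolding decseq_Suc_iff itinerary_increment[OF X T Y inv]
proof
  fix n
  note IT = simple_function_preserves[OF simple_itinerary[OF X T] T]
  show "ent (\<lambda>\<omega>. (X \<omega>, (itinerary T X (Suc n) (T \<omega>), Y \<omega>))) - ent (\<lambda>\<omega>. (itinerary T X (Suc n) (T \<omega>), Y \<omega>))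
      \<le> ent (\<lambda>\<omega>. (X \<omega>, (itinerary T X n (T \<omega>), Y \<omega>))) - ent (\<lambda>\<omega>. (itinerary T X n (T \<omega>), Y \<omega>))"
    by (rule ent_cond_mono[OF X simple_function_Pair[OF IT Y] simple_function_Pair[OF IT Y]])
       (simp add: itinerary_Suc_eq_iff')
qed

lemma ent_pair_const: "ent (\<lambda>\<omega>. (X \<omega>, c)) = ent X"
  by (rule ent_cong_fibres) simp

lemma itinerary_ent_0: "ent (itinerary T X 0) = 0"
proof -
  have "itinerary T X 0 = (\<lambda>_ _. undefined)" by (simp add: itinerary_def fun_eq_iff)
  then show ?thesis using ent_const by simp
qed

text \<open>h is the limit of the decreasing increments, the entropy rate. Being their infimum, it
  bounds increments and averages from below without error; from above an \<epsilon> and a constant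
  are allowed.\<close>

lemma itinerary_growth:
  assumes X: "simple_function M X" and T: "preserves T"
  obtains h where "\<And>n. h \<le> ent (itinerary T X (Suc n)) - ent (itinerary T X n)"
    "\<And>n. real n * h \<le> ent (itinerary T X n)"
    "\<And>\<epsilon>. 0 < \<epsilon> \<Longrightarrow> \<exists>C. \<forall>n. ent (itinerary T X n) \<le> C + real n * (h + \<epsilon>)"
proof -
  define d where "d n = ent (itinerary T X (Suc n)) - ent (itinerary T X n)" for n
  have dec: "decseq d"
    using itinerary_increment_decseq[OF X T simple_function_const[of M "()"]]
    by (simp add: d_def[abs_def] ent_pair_const)
  have nn: "0 \<le> d n" for n
    using itinerary_increment_nonneg[OF X T simple_function_const[of M "()"], of n]
    by (simp add: d_def ent_pair_const)
  have sum: "ent (itinerary T X n) = sum d {..<n}" for n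
    by (induction n) (simp_all add: itinerary_ent_0 d_def)
  obtain h where h: "d \<longlonglongrightarrow> h" "\<And>n. h \<le> d n"
    using decseq_convergent[OF dec, of 0] nn by blast
  show ?thesis
  proof (rule that[of h])
    show "h \<le> ent (itinerary T X (Suc n)) - ent (itinerary T X n)" for n
      using h(2) by (simp add: d_def)
    fix n
    show "real n * h \<le> ent (itinerary T X n)"
      using sum_mono[of "{..<n}" "\<lambda>_. h" d] h(2) by (simp add: sum)
  next
    fix \<epsilon> :: real assume "0 < \<epsilon>"
    then obtain m where m: "\<And>n. n \<ge> m \<Longrightarrow> d n < h + \<epsilon>"
      using order_tendstoD(2)[OF h(1), of "h + \<epsilon>"] by (auto simp: eventually_sequentially)
    \<comment> \<open>The first two terms cover the n below m, where increments may exceed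
      \<open>h + \<epsilon>\<close>; the absolute value avoids a distinction of signs.\<close>
    have "ent (itinerary T X n) \<le> sum d {..<m} + real m * \<bar>h + \<epsilon>\<bar> + real n * (h + \<epsilon>)" for n
    proof (induction n)
      case 0
      then show ?case using sum_nonneg[of "{..<m}" d] nn by (simp add: itinerary_ent_0)
    next
      case (Suc n)
      show ?case
      proof (cases "n \<ge> m")
        case True
        then show ?thesis using Suc m[OF True] by (simp add: d_def algebra_simps)
      next
        case False
        have "ent (itinerary T X (Suc n)) \<le> sum d {..<m}"
          using False unfolding sum by (intro sum_mono2) (auto simp: nn)
        moreover have "real (Suc n) * \<bar>h + \<epsilon>\<bar> \<le> real m * \<bar>h + \<epsilon>\<bar>"
          using False by (intro mult_right_mono) auto
        moreover have "- (real (Suc n) * (h + \<epsilon>)) \<le> real (Suc n) * \<bar>h + \<epsilon>\<bar>"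
          by (simp add: minus_mult_right del: mult_minus_right)
        ultimately show ?thesis by linarith
      qed
    qed
    then show "\<exists>C. \<forall>n. ent (itinerary T X n) \<le> C + real n * (h + \<epsilon>)" by blast
  qed
qed

text \<open>
  The increments of the right-hand side decrease, and \<open>Y\<close> contributes only a bounded amount, so no
  increment can be below \<open>h\<close>: conditioning on \<open>Y\<close> does not lower the entropy rate.
\<close>

lemma itinerary_invariant_lower_bound:
  assumes X: "simple_function M X" and T: "preserves T" and Y: "simple_function M Y"
    and inv: "AE \<omega> in M. Y (T \<omega>) = Y \<omega>" and h: "\<And>n. real n * h \<le> ent (itinerary T X n)"
  shows "ent Y + real n * h \<le> ent (\<lambda>\<omega>. (itinerary T X n \<omega>, Y \<omega>))"
proof -
  define a where "a n = ent (\<lambda>\<omega>. (itinerary T X n \<omega>, Y \<omega>))" for n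
  define d where "d n = a (Suc n) - a n" for n
  have dec: "decseq d"
    using itinerary_increment_decseq[OF X T Y inv] by (simp add: d_def[abs_def] a_def)
  have sum: "a n = a 0 + sum d {..<n}" for n
    by (induction n) (simp_all add: d_def)
  have a0: "a 0 = ent Y"
    unfolding a_def by (rule ent_cong_fibres) (simp add: itinerary_eq_iff)
  have low: "real n * h \<le> a n" for n
    unfolding a_def
    by (rule order_trans[OF h ent_mono]) (auto intro!: simple_itinerary X T simple_function_Pair Y)
  have "h \<le> d m" for m
  proof (rule ccontr)
    assume "\<not> h \<le> d m"
    then have pos: "h - d m > 0" by simp
    have "real n * h \<le> a m + real n * d m - real m * d m" if "n \<ge> m" for n
    proof -
      have "a n \<le> a m + real (n - m) * d m"
        using that
      proof (induction n rule: dec_induct)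
        case (step n)
        have "d n \<le> d m" using dec step(1) by (simp add: decseq_def)
        then show ?case using step by (simp add: d_def Suc_diff_le algebra_simps)
      qed simp
      then show ?thesis using low[of n] that by (simp add: of_nat_diff algebra_simps)
    qed
    then have bound: "real n * (h - d m) \<le> a m - real m * d m" if "n \<ge> m" for n
      using that by (force simp: algebra_simps)
    obtain n :: nat where n: "a m - real m * d m < real n * (h - d m)"
      using reals_Archimedean3[OF pos] by blast
    have "real n * (h - d m) \<le> real (max n m) * (h - d m)"
      using pos by (intro mult_right_mono) auto
    then show False using bound[of "max n m"] n by simp
  qed
  then have "real n * h \<le> sum d {..<n}"
    using sum_mono[of "{..<n}" "\<lambda>_. h" d] by simp
  then show ?thesis using sum[of n] a0 by (simp add: a_def)
qed

text \<open>Chain rule: the letter of Q at time j costs at most H(Q | X-itinerary of length l),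
  since the X-itinerary is known for l steps from time j on. This is why X is followed up to n +
  l.\<close>

lemma itinerary_upper_bound:
  assumes X: "simple_function M X" and T: "preserves T" and Q: "simple_function M Q"
  shows "ent (\<lambda>\<omega>. (itinerary T Q n \<omega>, itinerary T X (n + l) \<omega>)) \<le>
    ent (itinerary T X (n + l)) + real n * (ent (\<lambda>\<omega>. (Q \<omega>, itinerary T X l \<omega>)) - ent (itinerary T X l))"
proof -
  define e where "e = ent (\<lambda>\<omega>. (Q \<omega>, itinerary T X l \<omega>)) - ent (itinerary T X l)"
  note IX = simple_itinerary[OF X T] and IQ = simple_itinerary[OF Q T]
  have "ent (\<lambda>\<omega>. (itinerary T Q j \<omega>, itinerary T X (n + l) \<omega>)) \<le> ent (itinerary T X (n + l)) + real j * e"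
    if "j \<le> n" for j
    using that
  proof (induction j)
    case 0
    have "ent (\<lambda>\<omega>. (itinerary T Q 0 \<omega>, itinerary T X (n + l) \<omega>)) = ent (itinerary T X (n + l))"
      by (rule ent_cong_fibres) (simp add: itinerary_eq_iff)
    then show ?case by simp
  next
    case (Suc j)
    note Tj = preserves_funpow[OF T, of j]
    note QT = simple_function_preserves[OF Q Tj] and IT = simple_function_preserves[OF IX Tj]
    have "ent (\<lambda>\<omega>. (itinerary T Q (Suc j) \<omega>, itinerary T X (n + l) \<omega>)) - ent (\<lambda>\<omega>. (itinerary T Q j \<omega>, itinerary T X (n + l) \<omega>))
      = ent (\<lambda>\<omega>. (Q ((T ^^ j) \<omega>), (itinerary T Q j \<omega>, itinerary T X (n + l) \<omega>))) - ent (\<lambda>\<omega>. (itinerary T Q j \<omega>, itinerary T X (n + l) \<omega>))"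
      by (subst ent_cong_fibres[where Y = "\<lambda>\<omega>. (Q ((T ^^ j) \<omega>), (itinerary T Q j \<omega>, itinerary T X (n + l) \<omega>))"])
         (auto simp: itinerary_Suc_eq_iff')
    also have "\<dots> \<le> ent (\<lambda>\<omega>. (Q ((T ^^ j) \<omega>), itinerary T X l ((T ^^ j) \<omega>))) - ent (\<lambda>\<omega>. itinerary T X l ((T ^^ j) \<omega>))"
    proof (rule ent_cond_mono[OF QT simple_function_Pair[OF IQ IX] IT])
      fix \<omega> \<omega>' assume "(itinerary T Q j \<omega>, itinerary T X (n + l) \<omega>) = (itinerary T Q j \<omega>', itinerary T X (n + l) \<omega>')"
      then have "X ((T ^^ i) \<omega>) = X ((T ^^ i) \<omega>')" if "i < n + l" for i
        using that by (simp add: itinerary_eq_iff)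
      then show "itinerary T X l ((T ^^ j) \<omega>) = itinerary T X l ((T ^^ j) \<omega>')"
        using Suc.prems by (simp add: itinerary_eq_iff flip: comp_apply[of "T ^^ _" "T ^^ j"] funpow_add)
    qed
    also have "\<dots> = e"
      unfolding e_def using ent_comp[OF simple_function_Pair[OF Q IX] Tj] ent_comp[OF IX Tj] by simp
    finally show ?case using Suc by (simp add: algebra_simps)
  qed
  from this[of n] show ?thesis by (simp add: e_def)
qed

lemma ent_sum_superset:
  assumes X: "simple_function M X" and R: "finite R" "range X \<subseteq> R"
  shows "ent X = - (\<Sum>v\<in>R. prob {\<omega>. X \<omega> = v} * ln (prob {\<omega>. X \<omega> = v}))"
proof -
  have "prob {\<omega>. X \<omega> = v} * ln (prob {\<omega>. X \<omega> = v}) = 0" if "v \<in> R - range X" for v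
  proof -
    have "{\<omega>. X \<omega> = v} = {}" using that by auto
    then show ?thesis by simp
  qed
  then show ?thesis unfolding ent_sum[OF X]
    using R by (simp add: sum.mono_neutral_left[OF R])
qed

text \<open>For c = 0 this is the one-sided limit of x ln x at 0, which agrees with the value
  \<open>0 * ln 0 = 0\<close>.\<close>

lemma tendsto_mult_ln:
  fixes f :: "nat \<Rightarrow> real"
  assumes f: "f \<longlonglongrightarrow> c" and nn: "\<And>n. 0 \<le> f n"
  shows "(\<lambda>n. f n * ln (f n)) \<longlonglongrightarrow> c * ln c"
proof (cases "c = 0")
  case False
  then show ?thesis using f by (intro tendsto_intros) auto
next
  case True
  have "((\<lambda>x::real. x * ln x) \<longlongrightarrow> 0) (at_right 0)" by real_asymp
  then have "((\<lambda>x::real. x * ln x) \<longlongrightarrow> 0) (at 0 within {0..})"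
    by (simp add: at_within_Ici_at_right)
  then have "continuous (at 0 within {0..}) (\<lambda>x::real. x * ln x)"
    by (simp add: continuous_within)
  then have "(\<lambda>n. f n * ln (f n)) \<longlonglongrightarrow> 0 * ln 0"
    using f nn True by (intro continuous_within_tendsto_compose'[where f = "\<lambda>x. x * ln x" and S = "{0..}" and a = 0]) auto
  then show ?thesis using True by simp
qed

text \<open>All values lie in the finite range of X, so both entropies are sums of t ln t over one
  fixed finite index set. The probabilities converge to those of the pair (X, X), for which H(X, X)
  - H(X) = 0.\<close>

lemma cond_ent_approx:
  assumes X: "simple_function M X" and X': "\<And>l. simple_function M (X' l)"
    and R: "\<And>l \<omega>. X' l \<omega> \<in> range X"
    and lim: "(\<lambda>l. prob {\<omega>. X' l \<omega> \<noteq> X \<omega>}) \<longlonglongrightarrow> 0"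
  shows "(\<lambda>l. ent (\<lambda>\<omega>. (X \<omega>, X' l \<omega>)) - ent (X' l)) \<longlonglongrightarrow> 0"
proof -
  define R where "R = range X"
  have fin: "finite R" using simple_functionD(1)[OF X] by (simp add: R_def)
  define p where "p v = prob {\<omega>. X \<omega> = v}" for v
  have S: "simple_function M (\<lambda>\<omega>. (X \<omega>, X' l \<omega>))" for l by (rule simple_function_Pair[OF X X'])
  have Ssets: "{\<omega>. Q (X \<omega>) (X' l \<omega>)} \<in> sets M" for Q l
    using simple_pred_sets[OF S[of l], of "\<lambda>(u, v). Q u v"] by simp
  have close: "(\<lambda>l. prob {\<omega>. Q (X \<omega>) (X' l \<omega>)}) \<longlonglongrightarrow> prob {\<omega>. Q (X \<omega>) (X \<omega>)}" for Q
  proof (rule Lim_transform2)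
    show "(\<lambda>_. prob {\<omega>. Q (X \<omega>) (X \<omega>)}) \<longlonglongrightarrow> prob {\<omega>. Q (X \<omega>) (X \<omega>)}" by simp
    have "norm (prob {\<omega>. Q (X \<omega>) (X \<omega>)} - prob {\<omega>. Q (X \<omega>) (X' l \<omega>)}) \<le> prob {\<omega>. X' l \<omega> \<noteq> X \<omega>}" for l
    proof -
      let ?A = "{\<omega>. Q (X \<omega>) (X \<omega>)}" and ?B = "{\<omega>. Q (X \<omega>) (X' l \<omega>)}" and ?N = "{\<omega>. X' l \<omega> \<noteq> X \<omega>}"
      have s: "?A \<in> sets M" "?B \<in> sets M" "?N \<in> sets M"
        using Ssets[of "\<lambda>u v. Q u u" l] Ssets[of Q l] Ssets[of "\<lambda>u v. v \<noteq> u" l] by simp_all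
      have "prob ?A \<le> prob (?B \<union> ?N)" "prob ?B \<le> prob (?A \<union> ?N)"
        using s by (intro finite_measure_mono; auto)+
      moreover have "prob (?B \<union> ?N) \<le> prob ?B + prob ?N" "prob (?A \<union> ?N) \<le> prob ?A + prob ?N"
        using s by (intro measure_Un_le; auto)+
      ultimately show ?thesis by simp
    qed
    then show "(\<lambda>l. prob {\<omega>. Q (X \<omega>) (X \<omega>)} - prob {\<omega>. Q (X \<omega>) (X' l \<omega>)}) \<longlonglongrightarrow> 0"
      by (intro Lim_null_comparison[OF _ lim]) auto
  qed
  have ent1: "ent (\<lambda>\<omega>. (X \<omega>, X' l \<omega>)) = - (\<Sum>(u, v)\<in>R \<times> R. prob {\<omega>. X \<omega> = u \<and> X' l \<omega> = v} * ln (prob {\<omega>. X \<omega> = u \<and> X' l \<omega> = v}))" for l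
    using ent_sum_superset[OF S[of l], of "R \<times> R"] fin assms(3)
    by (force simp: R_def split_beta prod_eq_iff)
  have ent2: "ent (X' l) = - (\<Sum>v\<in>R. prob {\<omega>. X' l \<omega> = v} * ln (prob {\<omega>. X' l \<omega> = v}))" for l
    using ent_sum_superset[OF X'[of l], of R] fin assms(3) by (force simp: R_def)
  have diag: "(\<Sum>(u, v)\<in>R \<times> R. prob {\<omega>. X \<omega> = u \<and> X \<omega> = v} * ln (prob {\<omega>. X \<omega> = u \<and> X \<omega> = v}))
      = (\<Sum>u\<in>R. prob {\<omega>. X \<omega> = u} * ln (prob {\<omega>. X \<omega> = u}))"
  proof -
    have "(\<Sum>v\<in>R. prob {\<omega>. X \<omega> = u \<and> X \<omega> = v} * ln (prob {\<omega>. X \<omega> = u \<and> X \<omega> = v})) =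
      (\<Sum>v\<in>R. if v = u then p u * ln (p u) else 0)" for u
    proof (intro sum.cong refl)
      fix v
      have "{\<omega>. X \<omega> = u \<and> X \<omega> = v} = (if v = u then {\<omega>. X \<omega> = u} else {})" by auto
      then show "prob {\<omega>. X \<omega> = u \<and> X \<omega> = v} * ln (prob {\<omega>. X \<omega> = u \<and> X \<omega> = v}) = (if v = u then p u * ln (p u) else 0)"
        by (simp add: p_def)
    qed
    then show ?thesis using fin
      by (simp add: sum.cartesian_product[symmetric] p_def)
  qed
  have "(\<lambda>l. ent (\<lambda>\<omega>. (X \<omega>, X' l \<omega>)) - ent (X' l)) \<longlonglongrightarrow>
     - (\<Sum>(u, v)\<in>R \<times> R. prob {\<omega>. X \<omega> = u \<and> X \<omega> = v} * ln (prob {\<omega>. X \<omega> = u \<and> X \<omega> = v}))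
     - - (\<Sum>u\<in>R. prob {\<omega>. X \<omega> = u} * ln (prob {\<omega>. X \<omega> = u}))"
    unfolding ent1 ent2 split_beta
    by (intro tendsto_diff tendsto_minus tendsto_sum tendsto_mult_ln close[of "\<lambda>u v. v = _"] close[of "\<lambda>u v. u = _ \<and> v = _"])
       auto
  then show ?thesis unfolding diag by simp
qed

text \<open>R is the maximum likelihood guess of b from Y. Where it errs, the true value of b has
  conditional probability at most 1/2, so at least ln 2 of information is missing; elsewhere the
  missing information is nonnegative.\<close>

lemma guess_from_cond_ent:
  assumes b: "simple_function M (b :: 'b \<Rightarrow> bool)" and Y: "simple_function M Y"
  obtains R where "ln 2 * prob {\<omega>. b \<omega> \<noteq> (Y \<omega> \<in> R)} \<le> ent (\<lambda>\<omega>. (b \<omega>, Y \<omega>)) - ent Y"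
proof
  define R where "R = {y. prob {\<omega>. \<not> b \<omega> \<and> Y \<omega> = y} \<le> prob {\<omega>. b \<omega> \<and> Y \<omega> = y}}"
  note S = simple_function_Pair[OF b Y]
  have sets: "{\<omega>. Q (b \<omega>) (Y \<omega>)} \<in> sets M" for Q
    using simple_pred_sets[OF S, of "\<lambda>(u, v). Q u v"] by simp
  let ?N = "{\<omega>. b \<omega> \<noteq> (Y \<omega> \<in> R)}"
  have N: "?N \<in> sets M" by (rule sets)
  have "ln 2 * prob ?N = expectation (\<lambda>\<omega>. ln 2 * indicator ?N \<omega>)"
    using N by simp
  also have "\<dots> \<le> expectation (\<lambda>\<omega>. ln (atom_prob Y \<omega>) - ln (atom_prob (\<lambda>\<omega>. (b \<omega>, Y \<omega>)) \<omega>))"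
  proof (rule integral_mono_AE)
    show "integrable M (\<lambda>\<omega>. ln 2 * indicat_real ?N \<omega>)" using N by (simp add: emeasure_eq_measure)
    show "integrable M (\<lambda>\<omega>. ln (atom_prob Y \<omega>) - ln (atom_prob (\<lambda>\<omega>. (b \<omega>, Y \<omega>)) \<omega>))"
      using integrable_simple[OF simple_atom_prob[OF Y, of ln]] integrable_simple[OF simple_atom_prob[OF S, of ln]]
      by simp
    show "AE \<omega> in M. ln 2 * indicator ?N \<omega> \<le> ln (atom_prob Y \<omega>) - ln (atom_prob (\<lambda>\<omega>. (b \<omega>, Y \<omega>)) \<omega>)"
      using atom_prob_pos[OF Y] atom_prob_pos[OF S]
    proof eventually_elim
      case (elim \<omega>)
      have split: "atom_prob Y \<omega> = prob {\<omega>'. b \<omega>' \<and> Y \<omega>' = Y \<omega>} + prob {\<omega>'. \<not> b \<omega>' \<and> Y \<omega>' = Y \<omega>}"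
        unfolding atom_prob_def using sets[of "\<lambda>u v. u \<and> v = Y \<omega>"] sets[of "\<lambda>u v. \<not> u \<and> v = Y \<omega>"]
        by (subst finite_measure_Union[symmetric]) (auto intro!: arg_cong[where f = prob])
      have joint: "atom_prob (\<lambda>\<omega>. (b \<omega>, Y \<omega>)) \<omega> =
          (if b \<omega> then prob {\<omega>'. b \<omega>' \<and> Y \<omega>' = Y \<omega>} else prob {\<omega>'. \<not> b \<omega>' \<and> Y \<omega>' = Y \<omega>})"
        by (simp add: atom_prob_def)
      show ?case
      proof (cases "\<omega> \<in> ?N")
        case True
        then have "2 * atom_prob (\<lambda>\<omega>. (b \<omega>, Y \<omega>)) \<omega> \<le> atom_prob Y \<omega>"
          by (auto simp: joint split R_def)
        then have "ln (2 * atom_prob (\<lambda>\<omega>. (b \<omega>, Y \<omega>)) \<omega>) \<le> ln (atom_prob Y \<omega>)"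
          using elim by (intro ln_mono) auto
        then show ?thesis using True elim by (simp add: ln_mult)
      next
        case False
        have "atom_prob (\<lambda>\<omega>. (b \<omega>, Y \<omega>)) \<omega> \<le> atom_prob Y \<omega>"
          by (simp add: joint split)
        then show ?thesis using False elim by simp
      qed
    qed
  qed
  also have "\<dots> = ent (\<lambda>\<omega>. (b \<omega>, Y \<omega>)) - ent Y"
    using integrable_simple[OF simple_atom_prob[OF Y, of ln]] integrable_simple[OF simple_atom_prob[OF S, of ln]]
    by (simp add: ent_def)
  finally show "ln 2 * prob ?N \<le> ent (\<lambda>\<omega>. (b \<omega>, Y \<omega>)) - ent Y" .
qed

end

section \<open>Finite Abelian groups\<close>

abbreviation add_hom :: "('g::ab_group_add \<Rightarrow> 'h::ab_group_add) \<Rightarrow> bool" where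
  "add_hom \<equiv> Modules.additive"

definition subgrp :: "'g::ab_group_add set \<Rightarrow> bool" where
  "subgrp V \<longleftrightarrow> 0 \<in> V \<and> (\<forall>x\<in>V. \<forall>y\<in>V. x - y \<in> V)"

lemma subgrp_zero: "subgrp V \<Longrightarrow> 0 \<in> V"
  and subgrp_diff: "subgrp V \<Longrightarrow> x \<in> V \<Longrightarrow> y \<in> V \<Longrightarrow> x - y \<in> V"
  by (auto simp: subgrp_def)

lemma subgrp_uminus: "subgrp V \<Longrightarrow> x \<in> V \<Longrightarrow> - x \<in> V"
  using subgrp_diff[of V 0 x] by (simp add: subgrp_zero)

lemma subgrp_add: "subgrp V \<Longrightarrow> x \<in> V \<Longrightarrow> y \<in> V \<Longrightarrow> x + y \<in> V"
  using subgrp_diff[of V x "- y"] by (simp add: subgrp_uminus)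

lemma subgrp_finiteI:
  assumes fin: "finite V" and zero: "0 \<in> V" and add: "\<And>x y. x \<in> V \<Longrightarrow> y \<in> V \<Longrightarrow> x + y \<in> V"
  shows "subgrp V"
proof -
  have "- x \<in> V" if x: "x \<in> V" for x
  proof -
    have "(+) x ` V = V" by (rule endo_inj_surj[OF fin]) (auto simp: add x)
    then obtain y where y: "y \<in> V" "0 = x + y" using zero by (metis imageE)
    then have "y = - x" by (metis minus_unique)
    then show ?thesis using y by simp
  qed
  then show ?thesis using add zero unfolding subgrp_def by (metis add_uminus_conv_diff)
qed

text \<open>Lagrange's theorem: the translates of U inside V are disjoint or equal, and equally
  large.\<close>

lemma card_subgrp_dvd:
  assumes V: "subgrp V" "finite V" and U: "subgrp U" "U \<subseteq> V"
  shows "card U dvd card V"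
proof -
  define C where "C = (\<lambda>v. (+) v ` U) ` V"
  have "\<Union>C = V"
    using U V by (auto simp: C_def intro: subgrp_add) (metis add.right_neutral image_eqI subgrp_zero)
  moreover have "card U dvd card c" if "c \<in> C" for c
    using that by (auto simp: C_def card_image)
  moreover have "c1 \<inter> c2 = {}" if cc: "c1 \<in> C" "c2 \<in> C" "c1 \<noteq> c2" for c1 c2
  proof (rule ccontr)
    assume "c1 \<inter> c2 \<noteq> {}"
    then obtain t where t: "t \<in> c1" "t \<in> c2" by blast
    obtain v w where vw: "c1 = (+) v ` U" "c2 = (+) w ` U" using cc by (auto simp: C_def)
    then obtain a b where c: "c1 = (+) v ` U" "c2 = (+) w ` U" "a \<in> U" "b \<in> U" "v + a = w + b"
      using t by auto
    have "v = w + (b - a)" "w = v + (a - b)" using c(5) by (simp_all add: algebra_simps)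
    moreover have "(+) (x + d) ` U \<subseteq> (+) x ` U" if "d \<in> U" for x d
      using subgrp_add[OF U(1) that] by (auto simp: add.assoc)
    ultimately have "c1 \<subseteq> c2" "c2 \<subseteq> c1"
      unfolding c(1,2) using subgrp_diff[OF U(1)] c(3,4) by metis+
    then show False using cc by blast
  qed
  moreover have "finite (\<Union>C)" using calculation(1) V by simp
  ultimately show ?thesis using dvd_partition[of C "card U"] by auto
qed

lemma card_image_times_kernel:
  fixes \<theta> :: "'g::ab_group_add \<Rightarrow> 'h::ab_group_add"
  assumes V: "subgrp V" "finite V" and \<theta>: "\<And>x y. x \<in> V \<Longrightarrow> y \<in> V \<Longrightarrow> \<theta> (x - y) = \<theta> x - \<theta> y"
  shows "card V = card (\<theta> ` V) * card {v\<in>V. \<theta> v = 0}"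
proof -
  have fib: "card {v\<in>V. \<theta> v = t} = card {v\<in>V. \<theta> v = 0}" if t: "t \<in> \<theta> ` V" for t
  proof -
    obtain u where u: "u \<in> V" "t = \<theta> u" using t by auto
    have "{v\<in>V. \<theta> v = t} = (+) u ` {v\<in>V. \<theta> v = 0}"
    proof (intro equalityI subsetI)
      fix v assume v: "v \<in> {v\<in>V. \<theta> v = t}"
      then have "v - u \<in> {v\<in>V. \<theta> v = 0}" using u \<theta>[of v u] subgrp_diff[OF V(1)] by simp
      then show "v \<in> (+) u ` {v\<in>V. \<theta> v = 0}" by (intro image_eqI[of _ _ "v - u"]) simp_all
    next
      fix v assume "v \<in> (+) u ` {v\<in>V. \<theta> v = 0}"
      then obtain w where w: "v = u + w" "w \<in> V" "\<theta> w = 0" by auto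
      have "\<theta> (u + w - w) = \<theta> (u + w) - \<theta> w" using subgrp_add[OF V(1)] u w by (intro \<theta>) auto
      then show "v \<in> {v\<in>V. \<theta> v = t}" using subgrp_add[OF V(1)] u w by simp
    qed
    then show ?thesis by (simp add: card_image)
  qed
  have "card V = (\<Sum>t\<in>\<theta> ` V. card {v\<in>V. \<theta> v = t})"
    using sum.image_gen[OF V(2), of "\<lambda>_. 1::nat" \<theta>] by simp
  also have "\<dots> = card (\<theta> ` V) * card {v\<in>V. \<theta> v = 0}"
    by (simp add: fib)
  finally show ?thesis .
qed

lemma add_hom_zero: "add_hom f \<Longrightarrow> f 0 = 0"
  and add_hom_diff: "add_hom f \<Longrightarrow> f (x - y) = f x - f y"
  and add_hom_add: "add_hom f \<Longrightarrow> f (x + y) = f x + f y"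
  by (simp_all add: Modules.additive.zero Modules.additive.diff Modules.additive.add)

lemma subgrp_image:
  assumes "add_hom f" "subgrp V"
  shows "subgrp (f ` V)"
  unfolding subgrp_def
proof (intro conjI ballI)
  show "0 \<in> f ` V" using add_hom_zero[OF assms(1)] subgrp_zero[OF assms(2)] by (metis imageI)
  fix x y assume "x \<in> f ` V" "y \<in> f ` V"
  then obtain u v where "u \<in> V" "v \<in> V" "x = f u" "y = f v" by auto
  then show "x - y \<in> f ` V" using subgrp_diff[OF assms(2)] by (metis add_hom_diff[OF assms(1)] imageI)
qed

lemma subgrp_vimage:
  assumes "add_hom f" "subgrp V"
  shows "subgrp (f -` V)"
  using assms by (auto simp: subgrp_def add_hom_zero add_hom_diff)

lemma subgrp_singleton: "subgrp {0}"
  by (simp add: subgrp_def)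

lemma subgrp_UNIV: "subgrp UNIV"
  by (simp add: subgrp_def)

lemma add_hom_funpow:
  fixes f :: "'g::ab_group_add \<Rightarrow> 'g"
  assumes "add_hom f"
  shows "add_hom (f ^^ n)"
proof
  show "(f ^^ n) (x + y) = (f ^^ n) x + (f ^^ n) y" for x y
    by (induction n) (simp_all add: add_hom_add[OF assms])
qed

section \<open>Multiples of an element and orbits of an automorphism\<close>

definition nmult :: "nat \<Rightarrow> 'g::ab_group_add \<Rightarrow> 'g" where
  "nmult k a = (\<Sum>i<k. a)"

lemma nmult_0: "nmult 0 a = 0" and nmult_Suc: "nmult (Suc k) a = nmult k a + a"
  by (simp_all add: nmult_def)

lemma nmult_add: "nmult (j + k) a = nmult j a + nmult k a"
  by (induction k) (simp_all add: nmult_0 nmult_Suc add.assoc)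

lemma nmult_hom: "add_hom f \<Longrightarrow> f (nmult k a) = nmult k (f a)"
  by (induction k) (simp_all add: nmult_0 nmult_Suc add_hom_zero add_hom_add)

lemma nmult_mod:
  assumes "nmult p a = 0"
  shows "nmult (k mod p) a = nmult k a"
proof -
  have "nmult (j * p + i) a = nmult i a" for i j
    by (induction j) (simp_all add: nmult_add assms nmult_0)
  from this[of "k div p" "k mod p"] show ?thesis by simp
qed

lemma nmult_card_eq_0:
  assumes V: "subgrp V" "finite V" and a: "a \<in> V"
  shows "nmult (card V) a = 0"
proof -
  have "(\<lambda>x. x + a) ` V = V"
    by (rule endo_inj_surj[OF V(2)]) (auto intro: inj_onI subgrp_add[OF V(1)] a)
  then have "(\<Sum>x\<in>V. x) = (\<Sum>x\<in>V. x + a)"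
    using sum.reindex[of "\<lambda>x. x + a" V "\<lambda>x. x"] by (simp add: inj_on_def)
  then have "(\<Sum>x\<in>V. a) = 0" by (simp add: sum.distrib)
  moreover have "(\<Sum>x\<in>V. a) = nmult (card V) a"
    using V(2) by (induction V rule: finite_induct) (simp_all add: nmult_0 nmult_Suc add.commute)
  ultimately show ?thesis by simp
qed

lemma funpow_app_add: "(f ^^ i) ((f ^^ j) w) = (f ^^ (i + j)) w"
  by (simp add: funpow_add)

text \<open>The orbits partition \<Omega> into blocks of exactly N points.\<close>

lemma free_cycles_dvd:
  assumes fin: "finite \<Omega>" and f: "f ` \<Omega> \<subseteq> \<Omega>" and N: "0 < N"
    and per: "\<And>w. w \<in> \<Omega> \<Longrightarrow> (f ^^ N) w = w"
    and free: "\<And>w k. w \<in> \<Omega> \<Longrightarrow> 0 < k \<Longrightarrow> k < N \<Longrightarrow> (f ^^ k) w \<noteq> w"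
  shows "N dvd card \<Omega>"
proof -
  define orb where "orb w = (\<lambda>k. (f ^^ k) w) ` {..<N}" for w
  have inv: "(f ^^ k) w \<in> \<Omega>" if "w \<in> \<Omega>" for w k
    using f that by (induction k) auto
  have per': "(f ^^ (j * N + k)) w = (f ^^ k) w" if "w \<in> \<Omega>" for j k w
  proof (induction j)
    case (Suc j)
    have "(f ^^ (Suc j * N + k)) w = (f ^^ (j * N + k)) ((f ^^ N) w)"
      by (simp add: funpow_app_add ac_simps)
    then show ?case using Suc per[OF that] by simp
  qed simp
  have orb: "(f ^^ k) w \<in> orb w" if "w \<in> \<Omega>" for w k
    using per'[OF that, of "k div N" "k mod N"] N by (auto simp: orb_def intro!: image_eqI[of _ _ "k mod N"])
  have orb_sub: "orb ((f ^^ j) w) \<subseteq> orb w" if "w \<in> \<Omega>" for w j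
    using orb[OF that] by (auto simp: orb_def[of "(f ^^ j) w"] simp: funpow_app_add)
  have orb_eq: "orb ((f ^^ j) w) = orb w" if w: "w \<in> \<Omega>" "j < N" for w j
  proof
    have "w = (f ^^ (N - j)) ((f ^^ j) w)"
      using per[OF w(1)] w(2) by (simp add: funpow_app_add)
    then show "orb w \<subseteq> orb ((f ^^ j) w)" using orb_sub[OF inv[OF w(1)], of "N - j" j] by simp
  qed (rule orb_sub[OF w(1)])
  have card: "card (orb w) = N" if w: "w \<in> \<Omega>" for w
  proof -
    have ne: "(f ^^ i) w \<noteq> (f ^^ j) w" if ij: "i < j" "j < N" for i j
    proof
      assume "(f ^^ i) w = (f ^^ j) w"
      moreover have "(f ^^ (j - i)) ((f ^^ i) w) = (f ^^ j) w"
        using ij by (simp add: funpow_app_add)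
      ultimately have "(f ^^ (j - i)) ((f ^^ i) w) = (f ^^ i) w" by simp
      then show False using free[OF inv[OF w, of i], of "j - i"] ij by simp
    qed
    have "inj_on (\<lambda>k. (f ^^ k) w) {..<N}"
    proof (rule inj_onI)
      fix i j assume *: "i \<in> {..<N}" "j \<in> {..<N}" "(f ^^ i) w = (f ^^ j) w"
      then show "i = j" using ne[of i j] ne[of j i] by (cases i j rule: linorder_cases) auto
    qed
    then show ?thesis by (simp add: orb_def card_image)
  qed
  have "\<Union>(orb ` \<Omega>) = \<Omega>"
  proof
    show "\<Union>(orb ` \<Omega>) \<subseteq> \<Omega>" using inv by (auto simp: orb_def)
    show "\<Omega> \<subseteq> \<Union>(orb ` \<Omega>)" using orb[of _ 0] by auto
  qed
  moreover have "c1 \<inter> c2 = {}" if c: "c1 \<in> orb ` \<Omega>" "c2 \<in> orb ` \<Omega>" "c1 \<noteq> c2" for c1 c2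
  proof (rule ccontr)
    assume "c1 \<inter> c2 \<noteq> {}"
    then obtain t where t: "t \<in> c1" "t \<in> c2" by blast
    obtain w1 w2 where w: "w1 \<in> \<Omega>" "w2 \<in> \<Omega>" "c1 = orb w1" "c2 = orb w2" using c by blast
    then obtain i j where *: "i < N" "j < N" "(f ^^ i) w1 = (f ^^ j) w2"
      using t by (auto simp: orb_def)
    then show False using orb_eq[of w1 i] orb_eq[of w2 j] c(3) w * by simp
  qed
  ultimately show ?thesis
    using dvd_partition[of "orb ` \<Omega>" N] card fin by auto
qed

text \<open>
  \<open>p (p - 1) (p\<^sup>2 - 1) = (p\<^sup>2 - 1) (p\<^sup>2 - p)\<close> counts the pairs \<open>(a, b)\<close> with \<open>a \<noteq> 0\<close> and \<open>b\<close> outside the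
  span of \<open>a\<close>; the powers of an automorphism act freely on these pairs.
\<close>

lemma automorphism_power_eq_id:
  fixes \<alpha> :: "'a::{finite,ab_group_add} \<Rightarrow> 'a"
  assumes p: "prime p" and card: "CARD('a) = p ^ 2" and exponent: "\<And>a :: 'a. nmult p a = 0"
    and \<alpha>: "add_hom \<alpha>" "inj \<alpha>"
  shows "\<alpha> ^^ (p * (p - 1) * (p ^ 2 - 1)) = id"
proof -
  have p1: "p > 1" using p by (rule prime_gt_1_nat)
  define spn where "spn a = (\<lambda>k. nmult k a) ` {..<p}" for a :: 'a
  have spn_mem: "nmult k a \<in> spn a" for k a
    using nmult_mod[OF exponent, of k a] p1 by (auto simp: spn_def intro!: image_eqI[of _ _ "k mod p"])
  have spn: "subgrp (spn a)" for a
  proof (rule subgrp_finiteI)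
    show "0 \<in> spn a" using spn_mem[of 0 a] by (simp add: nmult_0)
    fix x y assume "x \<in> spn a" "y \<in> spn a"
    then obtain i j where "x = nmult i a" "y = nmult j a" by (auto simp: spn_def)
    then show "x + y \<in> spn a" using spn_mem[of "i + j" a] by (simp add: nmult_add)
  qed (simp add: spn_def)
  have self: "a \<in> spn a" for a using spn_mem[of 1 a] by (simp add: nmult_def)
  have subgrp_card: "card V = 1 \<or> card V = p \<or> V = UNIV" if "subgrp V" for V :: "'a set"
  proof -
    have "card V dvd p ^ 2" using card_subgrp_dvd[OF subgrp_UNIV _ that] card by simp
    then obtain i where i: "i \<le> 2" "card V = p ^ i" using divides_primepow_nat[OF p] by blast
    then consider "i = 0" | "i = 1" | "i = 2" by linarith
    then show ?thesis
    proof cases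
      case 3
      then have "V = UNIV" using i card by (intro card_subset_eq) auto
      then show ?thesis by simp
    qed (use i in auto)
  qed
  have card_spn: "card (spn a) = p" if a: "a \<noteq> 0" for a
  proof -
    have "card {0, a} \<le> card (spn a)"
      using self[of a] subgrp_zero[OF spn[of a]] by (intro card_mono) auto
    then have "card (spn a) \<noteq> 1" using a by simp
    moreover have "card (spn a) \<le> p" unfolding spn_def by (rule order_trans[OF card_image_le]) auto
    moreover have "p < p ^ 2" using p1 by (simp add: power2_eq_square)
    ultimately show ?thesis using subgrp_card[OF spn[of a]] card by auto
  qed
  define \<Omega> where "\<Omega> = (SIGMA a : - {0 :: 'a}. - spn a)"
  have card_\<Omega>: "card \<Omega> = p * (p - 1) * (p ^ 2 - 1)"
  proof -
    have "card \<Omega> = (\<Sum>a\<in>- {0 :: 'a}. card (- spn a))" unfolding \<Omega>_def by (rule card_SigmaI) auto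
    also have "\<dots> = (\<Sum>a\<in>- {0 :: 'a}. p ^ 2 - p)"
      by (intro sum.cong refl) (simp add: card_Diff_subset Compl_eq_Diff_UNIV card_spn card)
    also have "\<dots> = (p ^ 2 - 1) * (p ^ 2 - p)"
      by (simp add: card_Diff_subset Compl_eq_Diff_UNIV card)
    also have "p ^ 2 - p = p * (p - 1)" by (simp add: power2_eq_square diff_mult_distrib2)
    finally show ?thesis by (simp add: mult.commute)
  qed
  have \<alpha>_pow: "add_hom (\<alpha> ^^ k)" for k by (rule add_hom_funpow[OF \<alpha>(1)])
  have inj_pow: "inj (\<alpha> ^^ k)" for k using inj_fn[OF \<alpha>(2)] .
  have "\<not> inj_on (\<lambda>k. \<alpha> ^^ k) (UNIV :: nat set)"
    using finite_imageD[of "\<lambda>k. \<alpha> ^^ k" UNIV] by auto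
  then obtain i0 j0 :: nat where "i0 \<noteq> j0" "\<alpha> ^^ i0 = \<alpha> ^^ j0"
    unfolding inj_on_def by blast
  then have "min i0 j0 < max i0 j0 \<and> \<alpha> ^^ min i0 j0 = \<alpha> ^^ max i0 j0"
    by (simp add: min_def max_def)
  then obtain i j where ij: "i < j" "\<alpha> ^^ i = \<alpha> ^^ j"
    by blast
  have "\<alpha> ^^ (j - i) = id"
  proof (rule ext, rule injD[OF inj_pow[of i]])
    fix x
    have "(\<alpha> ^^ i) ((\<alpha> ^^ (j - i)) x) = (\<alpha> ^^ j) x"
      using ij(1) by (simp add: funpow_app_add)
    then show "(\<alpha> ^^ i) ((\<alpha> ^^ (j - i)) x) = (\<alpha> ^^ i) (id x)"
      by (simp add: ij(2))
  qed
  then have ex: "\<exists>N. 0 < N \<and> \<alpha> ^^ N = id" using ij by (intro exI[of _ "j - i"]) simp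
  define N where "N = (LEAST N. 0 < N \<and> \<alpha> ^^ N = id)"
  have N: "0 < N" "\<alpha> ^^ N = id" using LeastI_ex[OF ex] by (auto simp: N_def)
  have least: "\<alpha> ^^ k \<noteq> id" if "0 < k" "k < N" for k
    using not_less_Least[of k "\<lambda>N. 0 < N \<and> \<alpha> ^^ N = id"] that by (auto simp: N_def)
  have pow: "(map_prod \<alpha> \<alpha> ^^ k) w = ((\<alpha> ^^ k) (fst w), (\<alpha> ^^ k) (snd w))" for k w
    by (induction k) auto
  have "N dvd card \<Omega>"
  proof (rule free_cycles_dvd[of \<Omega> "map_prod \<alpha> \<alpha>" N])
    show "finite \<Omega>" by simp
    show "map_prod \<alpha> \<alpha> ` \<Omega> \<subseteq> \<Omega>"
    proof -
      have "\<alpha> b \<in> spn (\<alpha> a) \<Longrightarrow> b \<in> spn a" for a b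
        using injD[OF \<alpha>(2)] by (auto simp: spn_def nmult_hom[OF \<alpha>(1), symmetric])
      moreover have "\<alpha> a = 0 \<Longrightarrow> a = 0" for a
        using injD[OF \<alpha>(2), of a 0] by (simp add: add_hom_zero[OF \<alpha>(1)])
      ultimately show ?thesis by (auto simp: \<Omega>_def)
    qed
    show "0 < N" by (rule N)
    show "(map_prod \<alpha> \<alpha> ^^ N) w = w" for w by (simp add: pow N)
    fix w k assume w: "w \<in> \<Omega>" and k: "0 < k" "k < N"
    obtain a b where ab: "w = (a, b)" "a \<noteq> 0" "b \<notin> spn a" using w by (auto simp: \<Omega>_def)
    show "(map_prod \<alpha> \<alpha> ^^ k) w \<noteq> w"
    proof
      assume "(map_prod \<alpha> \<alpha> ^^ k) w = w"
      then have fixed: "(\<alpha> ^^ k) a = a" "(\<alpha> ^^ k) b = b" by (auto simp: pow ab)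
      \<comment> \<open>The fixed points form a subgroup that contains b besides the p elements of
        \<open>spn a\<close>, so by the possible orders it is the whole group, against the
        minimality of N.\<close>
      let ?V = "{x. (\<alpha> ^^ k) x = x}"
      have V: "subgrp ?V" by (auto simp: subgrp_def add_hom_zero[OF \<alpha>_pow] add_hom_diff[OF \<alpha>_pow])
      have "spn a \<subseteq> ?V" by (auto simp: spn_def nmult_hom[OF \<alpha>_pow] fixed)
      then have "spn a \<subset> ?V" using ab fixed by blast
      then have "card (spn a) < card ?V" by (intro psubset_card_mono) auto
      then have "?V = UNIV" using subgrp_card[OF V] card_spn[OF ab(2)] p1 by auto
      then show False using least[OF k] by (auto simp: fun_eq_iff)
    qed
  qed
  then obtain m where "p * (p - 1) * (p ^ 2 - 1) = N * m" by (auto simp: card_\<Omega>)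
  moreover have "\<alpha> ^^ (N * m) = id"
    by (simp add: funpow_mult[symmetric] N)
  ultimately show ?thesis by simp
qed

section \<open>The linear part of the cellular automaton\<close>

definition supp_below :: "nat \<Rightarrow> (nat \<Rightarrow> 'a::zero) set" where
  "supp_below m = {d. \<forall>i\<ge>m. d i = 0}"

text \<open>Padding by zero, unlike \<open>restrict\<close>, keeps words inside the group of
  sequences, so that a word can be added to a sequence.\<close>

definition trunc :: "nat \<Rightarrow> (nat \<Rightarrow> 'a::zero) \<Rightarrow> nat \<Rightarrow> 'a" where
  "trunc m x = (\<lambda>i. if i < m then x i else 0)"

lemma trunc_apply: "trunc m x i = (if i < m then x i else 0)"
  by (simp add: trunc_def)

lemma trunc_supp: "trunc m x \<in> supp_below m"
  by (simp add: trunc_def supp_below_def)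

lemma trunc_id: "d \<in> supp_below m \<Longrightarrow> trunc m d = d"
  by (auto simp: trunc_def supp_below_def fun_eq_iff)

lemma trunc_add: "trunc m (x + y) = trunc m x + trunc m (y :: nat \<Rightarrow> 'a::ab_group_add)"
  by (auto simp: trunc_def fun_eq_iff)

lemma trunc_diff: "trunc m (x - y) = trunc m x - trunc m (y :: nat \<Rightarrow> 'a::ab_group_add)"
  by (auto simp: trunc_def fun_eq_iff)

lemma trunc_eq_iff: "trunc m x = trunc m y \<longleftrightarrow> (\<forall>i<m. x i = y i)"
  by (auto simp: trunc_def fun_eq_iff)

lemma bij_betw_supp_below:
  "bij_betw (\<lambda>d. restrict d {..<m}) (supp_below m :: (nat \<Rightarrow> 'a::zero) set) ({..<m} \<rightarrow>\<^sub>E UNIV)"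
proof (rule bij_betw_byWitness[where f' = "trunc m"])
  show "\<forall>d\<in>supp_below m. trunc m (restrict d {..<m}) = d"
    by (simp add: supp_below_def trunc_def fun_eq_iff)
  show "\<forall>f\<in>{..<m} \<rightarrow>\<^sub>E UNIV. restrict (trunc m f) {..<m} = f"
    by (simp add: trunc_def fun_eq_iff PiE_iff extensional_def)
  show "(\<lambda>d. restrict d {..<m}) ` supp_below m \<subseteq> {..<m} \<rightarrow>\<^sub>E UNIV"
    by (rule image_subsetI) simp
  show "trunc m ` ({..<m} \<rightarrow>\<^sub>E UNIV) \<subseteq> supp_below m"
    by (rule image_subsetI) (rule trunc_supp)
qed

lemma finite_supp_below: "finite (supp_below m :: (nat \<Rightarrow> 'a::{finite,zero}) set)"
  using bij_betw_finite[OF bij_betw_supp_below] by (blast intro: finite_PiE finite)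

lemma card_supp_below: "card (supp_below m :: (nat \<Rightarrow> 'a::{finite,zero}) set) = CARD('a) ^ m"
  using bij_betw_same_card[OF bij_betw_supp_below[where 'a = 'a]] by (simp add: card_PiE)

lemma subgrp_supp_below: "subgrp (supp_below m :: (nat \<Rightarrow> 'a::ab_group_add) set)"
  by (simp add: subgrp_def supp_below_def)

lemma shift_pow: "(shift_map ^^ n) x = (\<lambda>i. x (i + n))"
  by (induction n arbitrary: x) (auto simp: shift_map_def funpow_swap1)

lemma supp_below_iff_shift: "d \<in> supp_below m \<longleftrightarrow> (shift_map ^^ m) d = 0"
  by (auto simp: supp_below_def shift_pow fun_eq_iff) (metis le_add_diff_inverse2)

text \<open>The algebraic content of class (A): \<open>range_\<beta>\<close> comes from condition
  (2), \<open>kernel_disjoint\<close> from condition (1). The rule f' of the inverse gives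
  \<open>G_back\<close> and the measurability of the inverse.\<close>

locale group_CA =
  fixes p :: nat and F :: "(nat \<Rightarrow> 'a::{finite,ab_group_add}) \<Rightarrow> nat \<Rightarrow> 'a"
    and \<alpha> \<beta> :: "'a \<Rightarrow> 'a" and c :: 'a and f' :: "'a \<Rightarrow> 'a \<Rightarrow> 'a"
  assumes prime: "prime p" and card_alphabet: "CARD('a) = p ^ 2"
    and F_rule: "F x m = \<alpha> (x m) + \<beta> (x (Suc m)) + c"
    and bij_F: "bij F" and inv_rule: "inv F x m = f' (x m) (x (Suc m))"
    and \<alpha>_hom: "add_hom \<alpha>" and \<beta>_hom: "add_hom \<beta>" and inj_\<alpha>: "inj \<alpha>"
    and range_\<beta>: "range \<beta> = \<alpha> ` {a. \<beta> a = 0}"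
    and kernel_disjoint: "\<beta> a = 0 \<Longrightarrow> a \<in> \<alpha> ` {a. \<beta> a = 0} \<Longrightarrow> a = 0"
begin

definition G :: "(nat \<Rightarrow> 'a) \<Rightarrow> nat \<Rightarrow> 'a" where
  "G x m = \<alpha> (x m) + \<beta> (x (Suc m))"

abbreviation L :: "'a set" where
  "L \<equiv> \<alpha> ` {a. \<beta> a = 0}"

lemma subgrp_kernel: "subgrp {a. \<beta> a = 0}"
  using subgrp_vimage[OF \<beta>_hom subgrp_singleton] by (simp add: vimage_def)

lemma subgrp_L: "subgrp L"
  by (rule subgrp_image[OF \<alpha>_hom subgrp_kernel])

lemma bij_\<alpha>: "bij \<alpha>"
  using inj_\<alpha> by (simp add: bij_def finite_UNIV_inj_surj)

lemma p_gt_1: "p > 1"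
  using prime by (rule prime_gt_1_nat)

lemma card_kernel: "card {a. \<beta> a = 0} = p"
proof -
  have "CARD('a) = card (range \<beta>) * card {v. \<beta> v = 0}"
    using card_image_times_kernel[OF subgrp_UNIV finite, of \<beta>] add_hom_diff[OF \<beta>_hom] by simp
  also have "card (range \<beta>) = card {v. \<beta> v = 0}"
    unfolding range_\<beta> using inj_\<alpha> by (intro card_image) (auto simp: inj_on_def)
  finally have "p ^ 2 = card {v. \<beta> v = 0} ^ 2" by (simp add: card_alphabet power2_eq_square)
  then show ?thesis by simp
qed

lemma card_L: "card L = p"
  using card_image[of \<alpha> "{a. \<beta> a = 0}"] inj_\<alpha> card_kernel by (simp add: inj_on_def)

text \<open>Ker \<beta> and L meet in 0 and have p elements each, so their sums exhaust the p^2
  letters. The alphabet is therefore elementary Abelian; the cyclic group of order p^2 is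
  excluded.\<close>

lemma exponent: "nmult p (a :: 'a) = 0"
proof -
  let ?K = "{a. \<beta> a = 0}"
  let ?f = "\<lambda>(k, l). k + l"
  have inj: "inj_on ?f (?K \<times> L)"
  proof (intro inj_onI, clarify)
    fix a b k k' assume *: "\<beta> a = 0" "\<beta> b = 0" "\<beta> k = 0" "\<beta> k' = 0" "a + \<alpha> k = b + \<alpha> k'"
    have "a - b = \<alpha> k' - \<alpha> k" using *(5) by (simp add: algebra_simps)
    then have "a - b \<in> L" using subgrp_diff[OF subgrp_L, of "\<alpha> k'" "\<alpha> k"] * by simp
    moreover have "\<beta> (a - b) = 0" using * by (simp add: add_hom_diff[OF \<beta>_hom])
    ultimately have "a - b = 0" by (rule kernel_disjoint[rotated])
    then show "a = b \<and> \<alpha> k = \<alpha> k'" using *(5) by simp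
  qed
  have "card (?f ` (?K \<times> L)) = CARD('a)"
    using card_image[OF inj] by (simp add: card_cartesian_product card_L card_kernel card_alphabet power2_eq_square)
  then have "?f ` (?K \<times> L) = UNIV"
    using card_subset_eq[OF finite subset_UNIV] by simp
  then have "a \<in> ?f ` (?K \<times> L)" by simp
  then obtain w where w: "a = ?f w" "w \<in> ?K \<times> L" by (rule imageE)
  define k l where "k = fst w" and "l = snd w"
  have kl: "a = k + l" "k \<in> ?K" "l \<in> L"
    using w by (simp_all add: k_def l_def split_beta mem_Times_iff)
  have "nmult p k = 0" "nmult p l = 0"
    using nmult_card_eq_0[OF subgrp_kernel _ kl(2)] nmult_card_eq_0[OF subgrp_L _ kl(3)]
    by (simp_all add: card_kernel card_L)
  moreover have "nmult p (k + l) = nmult p k + nmult p l"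
    by (simp add: nmult_def sum.distrib)
  ultimately show ?thesis by (simp add: kl(1))
qed

definition N :: nat where
  "N = p * (p - 1) * (p ^ 2 - 1)"

lemma \<alpha>_pow_N: "\<alpha> ^^ N = id"
  unfolding N_def by (rule automorphism_power_eq_id[OF prime card_alphabet exponent \<alpha>_hom inj_\<alpha>])

lemma p_dvd_N: "p dvd N"
  by (simp add: N_def)

lemma N_pos: "N > 0"
  using p_gt_1 one_less_power[OF p_gt_1, of 2] by (simp add: N_def)

lemma G_hom: "add_hom G"
  by standard (simp add: G_def fun_eq_iff add_hom_add[OF \<alpha>_hom] add_hom_add[OF \<beta>_hom] algebra_simps)

lemma G_pow_hom: "add_hom (G ^^ n)"
  by (rule add_hom_funpow[OF G_hom])

lemma F_add: "F (x + d) = F x + G d"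
  by (simp add: F_rule G_def fun_eq_iff add_hom_add[OF \<alpha>_hom] add_hom_add[OF \<beta>_hom] algebra_simps)

lemma F_pow_add: "(F ^^ n) (x + d) = (F ^^ n) x + (G ^^ n) d"
  by (induction n) (simp, simp only: funpow.simps comp_apply F_add)

lemma F_pow_diff: "(F ^^ n) x - (F ^^ n) y = (G ^^ n) (x - y)"
  using F_pow_add[of n y "x - y"] by simp

lemma inj_G: "inj G"
proof (rule injI)
  fix x y assume "G x = G y"
  then have "F x = F y" using F_add[of 0 x] F_add[of 0 y] by simp
  then show "x = y" using bij_F by (simp add: bij_def inj_eq)
qed

lemma F_shift: "F (shift_map x) = shift_map (F x)"
  by (simp add: F_rule shift_map_def fun_eq_iff)

lemma G_shift: "G (shift_map x) = shift_map (G x)"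
  by (simp add: G_def shift_map_def fun_eq_iff)

lemma F_pow_shift_pow: "(F ^^ n) ((shift_map ^^ m) x) = (shift_map ^^ m) ((F ^^ n) x)"
proof -
  have "F ((shift_map ^^ m) x) = (shift_map ^^ m) (F x)" for x
    by (induction m) (simp_all add: F_shift)
  then show ?thesis by (induction n) simp_all
qed

lemma G_pow_shift_pow: "(G ^^ n) ((shift_map ^^ m) x) = (shift_map ^^ m) ((G ^^ n) x)"
proof -
  have "G ((shift_map ^^ m) x) = (shift_map ^^ m) (G x)" for x
    by (induction m) (simp_all add: G_shift)
  then show ?thesis by (induction n) simp_all
qed

lemma G_pow_supp: "d \<in> supp_below m \<Longrightarrow> (G ^^ n) d \<in> supp_below m"
  by (simp add: supp_below_iff_shift flip: G_pow_shift_pow) (simp add: add_hom_zero[OF G_pow_hom])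

text \<open>One more coordinate costs a factor p: if R is the identity on shorter sequences, then R
  d = d + e with e supported in cell 0 and fixed by R, so R^p d = d + p e = d.\<close>

lemma G_pow_periodic: "d \<in> supp_below (Suc m) \<Longrightarrow> (G ^^ (N * p ^ m)) d = d"
proof (induction m arbitrary: d)
  case 0
  \<comment> \<open>On sequences supported in cell 0 the \<beta>-term vanishes and G acts as
    \<alpha>.\<close>
  have *: "e \<in> supp_below (Suc 0) \<Longrightarrow> (G ^^ n) e 0 = (\<alpha> ^^ n) (e 0)" for n e
  proof (induction n)
    case (Suc n)
    have "(G ^^ n) e (Suc 0) = 0"
      using G_pow_supp[OF Suc.prems, of n] by (simp add: supp_below_def)
    then show ?case
      using Suc by (simp add: G_def[of "(G ^^ n) e" 0] add_hom_zero[OF \<beta>_hom])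
  qed simp
  show ?case
  proof
    fix i
    show "(G ^^ (N * p ^ 0)) d i = d i"
    proof (cases i)
      case 0
      then show ?thesis using *[OF "0.prems", of N] by (simp add: \<alpha>_pow_N)
    next
      case (Suc j)
      then show ?thesis using G_pow_supp[OF "0.prems"] "0.prems" by (simp add: supp_below_def)
    qed
  qed
next
  case (Suc m)
  define R where "R = G ^^ (N * p ^ m)"
  define e where "e = R d - d"
  have "shift_map d \<in> supp_below (Suc m)"
    using Suc.prems by (simp add: supp_below_def shift_map_def)
  then have "R (shift_map d) = shift_map d" unfolding R_def by (rule Suc.IH)
  then have "shift_map (R d) = shift_map d"
    using G_pow_shift_pow[of "N * p ^ m" 1 d] by (simp add: R_def)
  then have "R d (Suc i) = d (Suc i)" for i
    by (simp add: shift_map_def fun_eq_iff)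
  then have "e \<in> supp_below (Suc 0)"
    by (auto simp: supp_below_def e_def Suc_le_eq gr0_conv_Suc)
  then have "e \<in> supp_below (Suc m)"
    by (simp add: supp_below_def)
  then have Re: "R e = e" unfolding R_def by (rule Suc.IH)
  have Rpow: "(R ^^ k) d = d + nmult k e" for k
  proof (induction k)
    case (Suc k)
    have "R (d + nmult k e) = R d + nmult k (R e)"
      unfolding R_def by (simp add: add_hom_add[OF G_pow_hom] nmult_hom[OF G_pow_hom])
    moreover have "R d = d + e" by (simp add: e_def)
    ultimately show ?case by (simp only: funpow.simps comp_apply Suc Re nmult_Suc ac_simps)
  qed (simp add: nmult_0)
  have "nmult k e i = nmult k (e i)" for k i
    by (induction k) (simp_all add: nmult_0 nmult_Suc)
  then have "nmult p e = 0" by (simp add: fun_eq_iff exponent)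
  then have "(R ^^ p) d = d" by (simp add: Rpow)
  then show ?case by (simp add: R_def funpow_mult ac_simps)
qed

text \<open>Three consecutive zeros in column n force a zero in column n + 1 at the middle time.
  That entry is in Ker \<beta>, as seen from G (G e) at n, and in L, being the sum of \<alpha> of a
  kernel element and a value of \<beta>.\<close>

lemma column_determines:
  assumes "e n = 0" "G e n = 0" "G (G e) n = 0"
  shows "G e (Suc n) = 0"
proof (rule kernel_disjoint)
  have e: "\<beta> (e (Suc n)) = 0" using assms by (simp add: G_def add_hom_zero[OF \<alpha>_hom])
  have "G (G e) n = \<alpha> (G e n) + \<beta> (G e (Suc n))" by (simp only: G_def)
  then show "\<beta> (G e (Suc n)) = 0" using assms by (simp add: add_hom_zero[OF \<alpha>_hom])
  have "\<beta> (e (Suc (Suc n))) \<in> L" using range_\<beta> by auto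
  then show "G e (Suc n) \<in> L"
    unfolding G_def using e by (intro subgrp_add[OF subgrp_L]) auto
qed

text \<open>The inverse has radius 1, so cell m of a sequence depends on cells m and m + 1 of its
  image; this is compared for e and 0.\<close>

lemma G_back:
  assumes "G e m = 0" "G e (Suc m) = 0"
  shows "e m = 0"
proof -
  have inv: "inv F (F x) = x" for x using bij_F by (simp add: bij_is_inj)
  have "F e m = F 0 m" "F e (Suc m) = F 0 (Suc m)"
    using assms F_add[of 0 e] by (simp_all add: fun_eq_iff)
  then have "inv F (F e) m = inv F (F 0) m" by (simp add: inv_rule)
  then show ?thesis by (simp add: inv)
qed

text \<open>The n cells at time n - 1 form the base shared by two light cones whose tips lie in
  column 0, at times 0 and 2 n - 2. This is the exact exchange rate of two time steps per
  cell.\<close>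

lemma window_iff:
  assumes n: "n > 0"
  shows "(\<forall>i<2 * n - 1. (G ^^ i) e 0 = 0) \<longleftrightarrow> (\<forall>j<n. (G ^^ (n - 1)) e j = 0)"
proof
  assume *: "\<forall>i<2 * n - 1. (G ^^ i) e 0 = 0"
  \<comment> \<open>The zeros fill a triangle: each move to the next column loses one time step at
    either end.\<close>
  have "j \<le> i \<Longrightarrow> i + j \<le> 2 * n - 2 \<Longrightarrow> (G ^^ i) e j = 0" for i j
  proof (induction j arbitrary: i)
    case 0
    then show ?case using * n by auto
  next
    case (Suc j)
    obtain k where i: "i = Suc k" using Suc.prems by (cases i) auto
    have "(G ^^ k) e j = 0" "(G ^^ Suc k) e j = 0" "(G ^^ Suc (Suc k)) e j = 0"
      using Suc.prems by (intro Suc.IH; simp add: i)+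
    then show ?case using column_determines[of "(G ^^ k) e" j] by (simp add: i)
  qed
  then show "\<forall>j<n. (G ^^ (n - 1)) e j = 0" by simp
next
  assume *: "\<forall>j<n. (G ^^ (n - 1)) e j = 0"
  \<comment> \<open>One cell is lost per time step, forwards by the radius of F and backwards by
    that of its inverse.\<close>
  have fwd: "\<forall>j<n - k. (G ^^ (n - 1 + k)) e j = 0" for k
  proof (induction k)
    case (Suc k)
    then show ?case
      by (auto simp: G_def add_hom_zero[OF \<alpha>_hom] add_hom_zero[OF \<beta>_hom])
  qed (use * in simp)
  have bwd: "k < n \<Longrightarrow> \<forall>j<n - k. (G ^^ (n - 1 - k)) e j = 0" for k
  proof (induction k)
    case (Suc k)
    have "(G ^^ (n - 1 - k)) e = G ((G ^^ (n - 1 - Suc k)) e)"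
    proof -
      have "n - 1 - k = Suc (n - 1 - Suc k)" using Suc.prems by simp
      then show ?thesis by (simp only: funpow.simps comp_apply)
    qed
    moreover have "\<forall>j<n - k. (G ^^ (n - 1 - k)) e j = 0" using Suc by simp
    ultimately have step: "G ((G ^^ (n - 1 - Suc k)) e) j = 0" if "j < n - k" for j using that by (simp only:)
    have "(G ^^ (n - 1 - Suc k)) e j = 0" if "j < n - Suc k" for j
    proof (rule G_back)
      show "G ((G ^^ (n - 1 - Suc k)) e) j = 0" "G ((G ^^ (n - 1 - Suc k)) e) (Suc j) = 0"
        using that by (intro step; simp)+
    qed
    then show ?case by blast
  qed (use * in simp)
  show "\<forall>i<2 * n - 1. (G ^^ i) e 0 = 0"
  proof (intro allI impI)
    fix i assume i: "i < 2 * n - 1"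
    show "(G ^^ i) e 0 = 0"
    proof (cases "i \<ge> n - 1")
      case True
      then show ?thesis using fwd[of "i - (n - 1)"] i by auto
    next
      case False
      then show ?thesis using bwd[of "n - 1 - i"] i by auto
    qed
  qed
qed

text \<open>
  A \<open>G\<close>-stable group of finite sequences is a space of two-sided linear recurring sequences in
  the coordinate \<open>(G\<^sup>i v)\<^sub>0 mod L\<close>, hence is determined by, and arbitrary on, a window whose length
  is its dimension.
\<close>

lemma card_stable_window:
  assumes V: "subgrp V" "finite V" and GV: "G ` V \<subseteq> V" and large: "p ^ j \<le> card V"
  shows "card V = p ^ j * card {v\<in>V. \<forall>i<j. (G ^^ i) v 0 \<in> L}"
  using large
proof (induction j)
  case (Suc j)
  define W where "W j = {v\<in>V. \<forall>i<j. (G ^^ i) v 0 \<in> L}" for j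
  have "p ^ j \<le> p ^ Suc j" using p_gt_1 by simp
  then have "p ^ j \<le> card V" using Suc.prems by (rule order_trans)
  then have cardW: "card V = p ^ j * card (W j)" unfolding W_def by (rule Suc.IH)
  have "p ^ j * p \<le> p ^ j * card (W j)" using Suc.prems cardW by simp
  then have "p \<le> card (W j)" using p_gt_1 by simp
  have subW: "subgrp (W j)"
    using V(1) by (auto simp: W_def subgrp_def add_hom_zero[OF G_pow_hom] add_hom_diff[OF G_pow_hom]
      intro: subgrp_diff[OF subgrp_L] subgrp_zero[OF subgrp_L, unfolded subgrp_def])
  have finW: "finite (W j)" using V by (simp add: W_def)
  have hom_inv: "add_hom (inv \<alpha>)"
  proof
    show "inv \<alpha> (x + y) = inv \<alpha> x + inv \<alpha> y" for x y
      using bij_\<alpha> by (intro inv_f_eq inj_\<alpha>) (simp add: add_hom_add[OF \<alpha>_hom] bij_is_surj surj_f_inv_f)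
  qed
  \<comment> \<open>The class of (G^j v)_0 modulo L, with values in L:
    \<open>\<beta> \<circ> inv \<alpha>\<close> has kernel and image L. As L has prime order,
    \<theta> is zero on W j or maps it onto L.\<close>
  define \<theta> where "\<theta> v = \<beta> (inv \<alpha> ((G ^^ j) v 0))" for v
  have \<theta>_diff: "\<theta> (x - y) = \<theta> x - \<theta> y" for x y
    by (simp add: \<theta>_def add_hom_diff[OF G_pow_hom] add_hom_diff[OF hom_inv] add_hom_diff[OF \<beta>_hom])
  have kernel: "\<beta> (inv \<alpha> a) = 0 \<longleftrightarrow> a \<in> L" for a
  proof
    assume "\<beta> (inv \<alpha> a) = 0"
    moreover have "a = \<alpha> (inv \<alpha> a)" using bij_\<alpha> by (simp add: bij_is_surj surj_f_inv_f)
    ultimately show "a \<in> L" by (intro image_eqI[of _ _ "inv \<alpha> a"]) auto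
  next
    assume "a \<in> L"
    then show "\<beta> (inv \<alpha> a) = 0" by (auto simp: inj_\<alpha>)
  qed
  have count: "card (W j) = card (\<theta> ` W j) * card {v\<in>W j. \<theta> v = 0}"
    by (rule card_image_times_kernel[OF subW finW]) (rule \<theta>_diff)
  have W_Suc: "{v\<in>W j. \<theta> v = 0} = W (Suc j)"
    by (auto simp: W_def \<theta>_def kernel less_Suc_eq)
  have "\<theta> ` W j \<subseteq> L" using range_\<beta> by (auto simp: \<theta>_def)
  moreover have "subgrp (\<theta> ` W j)"
    unfolding subgrp_def
  proof (intro conjI ballI)
    show "0 \<in> \<theta> ` W j" using \<theta>_diff[of 0 0] subgrp_zero[OF subW] by (metis diff_self imageI)
    fix x y assume "x \<in> \<theta> ` W j" "y \<in> \<theta> ` W j"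
    then show "x - y \<in> \<theta> ` W j" using subgrp_diff[OF subW] by (force simp flip: \<theta>_diff)
  qed
  ultimately have "card (\<theta> ` W j) dvd p"
    using card_subgrp_dvd[OF subgrp_L, of "\<theta> ` W j"] by (simp add: card_L)
  \<comment> \<open>If one more condition changed nothing, G would map W j onto itself and all its
    columns at 0 would lie in L. Then v 0 and \<alpha> (v 0) lie in L, so v 0 = 0;
    \<open>column_determines\<close> spreads the zeros to every cell, and W j = {0} would be too
    small.\<close>
  moreover have "card (\<theta> ` W j) \<noteq> 1"
  proof
    assume "card (\<theta> ` W j) = 1"
    then have "card (W j) = card (W (Suc j))"
      using count by (simp add: W_Suc)
    then have eq: "W (Suc j) = W j"
      using finW by (intro card_subset_eq) (auto simp: W_def)
    have GW: "G v \<in> W j" if "v \<in> W j" for v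
    proof -
      have "v \<in> W (Suc j)" using that eq by simp
      then have "(G ^^ Suc i) v 0 \<in> L" if "i < j" for i using that by (auto simp: W_def)
      then show ?thesis using GV \<open>v \<in> W j\<close> by (auto simp: W_def funpow_swap1)
    qed
    have "G ` W j = W j"
      using GW inj_on_subset[OF inj_G subset_UNIV] by (intro endo_inj_surj finW) auto
    have zero0: "v 0 = 0" if v: "v \<in> W j" for v
    proof -
      have *: "u 0 \<in> L" if "u \<in> W j" for u
      proof -
        have "u \<in> W (Suc j)" using that eq by simp
        then have "(G ^^ 0) u 0 \<in> L" unfolding W_def by blast
        then show ?thesis by simp
      qed
      have "G v 0 \<in> L" using *[OF GW[OF v]] .
      moreover have "\<beta> (v 1) \<in> L" using range_\<beta> by auto
      ultimately have "\<alpha> (v 0) \<in> L" using subgrp_diff[OF subgrp_L, of "G v 0" "\<beta> (v 1)"] by (simp add: G_def)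
      then have "\<beta> (v 0) = 0" using inj_\<alpha> by (auto simp: inj_eq)
      then show ?thesis using *[OF v] kernel_disjoint by blast
    qed
    have "\<forall>v\<in>W j. v n = 0" for n
    proof (induction n)
      case (Suc n)
      show ?case
      proof
        fix v assume "v \<in> W j"
        then obtain y where "y \<in> W j" "v = G y" using \<open>G ` W j = W j\<close> by blast
        then show "v (Suc n) = 0" using Suc GW column_determines[of y n] by simp
      qed
    qed (use zero0 in simp)
    then have "W j \<subseteq> {0}" by (auto simp: fun_eq_iff)
    then have "card (W j) \<le> 1" using card_mono[of "{0}" "W j"] by simp
    then show False using \<open>p \<le> card (W j)\<close> p_gt_1 by simp
  qed
  ultimately have "card (\<theta> ` W j) = p" using prime by (metis prime_nat_iff)
  then have "card (W j) = p * card (W (Suc j))"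
    using count by (simp add: W_Suc)
  then show ?case using cardW by (simp add: W_def)
qed simp

text \<open>By \<open>window_iff\<close> the elements of V that vanish on the first k cells are the
  image under G^(k - 1) of those satisfying 2 k window conditions. The latter have index p^(2 k),
  the number of words of length k.\<close>

lemma stable_group_onto:
  assumes V: "subgrp V" "finite V" and GV: "G ` V \<subseteq> V" and large: "p ^ (2 * k) \<le> card V"
  shows "trunc k ` V = supp_below k"
proof (cases "k = 0")
  case True
  then show ?thesis using subgrp_zero[OF V(1)] by (auto simp: trunc_def supp_below_def fun_eq_iff image_iff)
next
  case False
  have GVeq: "G ` V = V"
    using GV inj_on_subset[OF inj_G subset_UNIV] by (intro endo_inj_surj V) auto
  have Gpow: "(G ^^ n) ` V = V" for n
    by (induction n) (simp, simp only: funpow.simps image_comp[symmetric] GVeq)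
  define W where "W = {v\<in>V. \<forall>i<2 * k. (G ^^ i) v 0 \<in> L}"
  \<comment> \<open>Two consecutive column entries in L make the first of them zero, so 2 k
    memberships yield 2 k - 1 zeros; conversely an entry that follows a zero is a value of \<beta>
    and lies in L automatically.\<close>
  have W_eq: "W = {v\<in>V. \<forall>i<2 * k - 1. (G ^^ i) v 0 = 0}"
  proof (intro equalityI subsetI)
    fix v assume v: "v \<in> W"
    have "(G ^^ i) v 0 = 0" if "i < 2 * k - 1" for i
    proof -
      have "\<forall>i<2 * k. (G ^^ i) v 0 \<in> L" using v by (simp add: W_def)
      then have *: "(G ^^ i) v 0 \<in> L" "(G ^^ Suc i) v 0 \<in> L" using that by (auto simp del: funpow.simps)
      have "\<beta> ((G ^^ i) v 1) \<in> L" using range_\<beta> by auto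
      then have "\<alpha> ((G ^^ i) v 0) \<in> L"
        using subgrp_diff[OF subgrp_L *(2), of "\<beta> ((G ^^ i) v 1)"] by (simp add: G_def)
      then have "\<beta> ((G ^^ i) v 0) = 0" using inj_\<alpha> by (auto simp: inj_eq)
      then show ?thesis using *(1) kernel_disjoint by blast
    qed
    then show "v \<in> {v\<in>V. \<forall>i<2 * k - 1. (G ^^ i) v 0 = 0}" using v by (simp add: W_def)
  next
    fix v assume v: "v \<in> {v\<in>V. \<forall>i<2 * k - 1. (G ^^ i) v 0 = 0}"
    have "(G ^^ i) v 0 \<in> L" if i: "i < 2 * k" for i
    proof (cases "i < 2 * k - 1")
      case True
      then show ?thesis using v subgrp_zero[OF subgrp_L] by simp
    next
      case False
      then obtain j where j: "i = Suc j" "j < 2 * k - 1" using i \<open>k \<noteq> 0\<close> by (cases i) auto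
      have "\<beta> ((G ^^ j) v 1) \<in> L" using range_\<beta> by auto
      then show ?thesis using v j by (simp add: G_def add_hom_zero[OF \<alpha>_hom])
    qed
    then show "v \<in> W" using v by (simp add: W_def)
  qed
  have "(G ^^ (k - 1)) ` W = {v\<in>V. trunc k v = 0}"
  proof -
    have tr: "trunc k v = 0 \<longleftrightarrow> (\<forall>j<k. v j = 0)" for v :: "nat \<Rightarrow> 'a"
      by (auto simp: trunc_def fun_eq_iff)
    have "W = {v\<in>V. trunc k ((G ^^ (k - 1)) v) = 0}"
      unfolding W_eq tr using window_iff[of k] \<open>k \<noteq> 0\<close> by simp
    moreover have "h ` {v\<in>V. trunc k (h v) = 0} = {v\<in>h ` V. trunc k v = 0}" for h :: "(nat \<Rightarrow> 'a) \<Rightarrow> nat \<Rightarrow> 'a"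
      by auto
    ultimately show ?thesis by (simp only: Gpow)
  qed
  then have "card {v\<in>V. trunc k v = 0} = card W"
    using card_image[OF inj_on_subset[OF inj_fn[OF inj_G] subset_UNIV], of "k - 1" W] by simp
  moreover have "card V = card (trunc k ` V) * card {v\<in>V. trunc k v = 0}"
    by (rule card_image_times_kernel[OF V]) (rule trunc_diff)
  ultimately have "card V = card (trunc k ` V) * card W" by simp
  moreover have "card V = p ^ (2 * k) * card W"
    using card_stable_window[OF V GV large] by (simp add: W_def)
  moreover have "card W \<noteq> 0"
  proof
    assume "card W = 0"
    then have "card V = 0" using calculation by simp
    then show False using V subgrp_zero[OF V(1)] by auto
  qed
  ultimately have "card (trunc k ` V) = p ^ (2 * k)" by simp
  also have "\<dots> = card (supp_below k :: (nat \<Rightarrow> 'a) set)"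
    by (simp add: card_supp_below card_alphabet power_mult)
  finally show ?thesis
    using trunc_supp by (intro card_subset_eq[OF finite_supp_below]) auto
qed

end

section \<open>Approximation by cylinders\<close>

locale seq_prob = full_prob_space M for M :: "(nat \<Rightarrow> 'a::{finite,discrete_topology,ab_group_add}) measure" +
  assumes sets_M: "sets M = sets borel" and preserves_shift: "preserves shift_map"
begin

lemma sets_PiM: "sets M = sets (\<Pi>\<^sub>M i\<in>UNIV. uniform_count_measure (UNIV :: 'a set))"
  using sets_uniform_bernoulli[where 'a = 'a] by (simp add: sets_M uniform_bernoulli_def)

lemma sets_coord: "{x. P (x i)} \<in> sets M"
proof -
  have "(\<lambda>x. x i) \<in> measurable M (uniform_count_measure (UNIV :: 'a set))"
    using measurable_component_singleton[of i UNIV "\<lambda>_. uniform_count_measure (UNIV :: 'a set)"]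
    by (simp add: measurable_cong_sets[OF sets_PiM refl])
  from measurable_sets[OF this, of "Collect P"] show ?thesis
    by (simp add: sets_uniform_count_measure vimage_def)
qed

lemma sets_trunc: "{x. P (trunc n x)} \<in> sets M"
proof -
  have cyl: "{x. trunc n x = d} \<in> sets M" if "d \<in> supp_below n" for d
  proof -
    have "trunc n x = d \<longleftrightarrow> (\<forall>i\<in>{..<n}. x i = d i)" for x
      using trunc_eq_iff[of n x d] trunc_id[OF that] by auto
    then have "{x. trunc n x = d} = {x \<in> space M. \<forall>i\<in>{..<n}. x i = d i}" by simp
    also have "\<dots> \<in> sets M"
      using sets_coord[of "\<lambda>v. v = d _"] by (intro sets.sets_Collect_finite_All) simp_all
    finally show ?thesis .
  qed
  have "{x. P (trunc n x)} = (\<Union>d\<in>{d \<in> supp_below n. P d}. {x. trunc n x = d})"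
    using trunc_supp[of n] by auto
  also have "\<dots> \<in> sets M"
    using finite_supp_below[of n] cyl by (intro sets.finite_UN) auto
  finally show ?thesis .
qed

lemma simple_trunc: "simple_function M (trunc n)"
  unfolding simple_function_def
proof (intro conjI ballI)
  show "finite (trunc n ` space M)"
    by (rule finite_subset[OF _ finite_supp_below[of n]]) (auto simp: trunc_supp)
  show "trunc n -` {d} \<inter> space M \<in> sets M" for d
    using sets_trunc[of "\<lambda>v. v = d" n] by (simp add: vimage_def)
qed

lemma simple_coord: "simple_function M (\<lambda>x. x i)"
  unfolding simple_function_def
  using sets_coord[of "\<lambda>v. v = _" i] by (auto simp: vimage_def)

abbreviation coord0 :: "(nat \<Rightarrow> 'a) \<Rightarrow> 'a" where
  "coord0 x \<equiv> x 0"

lemma itinerary_shift_eq_iff: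
  "itinerary shift_map coord0 n x = itinerary shift_map coord0 n y \<longleftrightarrow> trunc n x = trunc n y"
  by (simp add: itinerary_eq_iff trunc_eq_iff shift_pow)

definition approximable :: "(nat \<Rightarrow> 'a) set \<Rightarrow> bool" where
  "approximable A \<longleftrightarrow> A \<in> sets M \<and> (\<forall>\<epsilon>>0. \<exists>n C. prob {x. (x \<in> A) \<noteq> (trunc n x \<in> C)} < \<epsilon>)"

lemma sets_neq_trunc: "A \<in> sets M \<Longrightarrow> {x. (x \<in> A) \<noteq> P (trunc n x)} \<in> sets M"
proof -
  assume A: "A \<in> sets M"
  have "{x. (x \<in> A) \<noteq> P (trunc n x)} = (A - {x. P (trunc n x)}) \<union> ({x. P (trunc n x)} - A)" by auto
  also have "\<dots> \<in> sets M" using A sets_trunc[of P n] by auto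
  finally show ?thesis .
qed

lemma approximable_Un:
  assumes "approximable A" "approximable B"
  shows "approximable (A \<union> B)"
  unfolding approximable_def
proof (intro conjI allI impI)
  have AB: "A \<in> sets M" "B \<in> sets M" using assms by (auto simp: approximable_def)
  then show "A \<union> B \<in> sets M" by auto
  fix \<epsilon> :: real assume "0 < \<epsilon>"
  then obtain n m C D where C: "prob {x. (x \<in> A) \<noteq> (trunc n x \<in> C)} < \<epsilon> / 2"
    and D: "prob {x. (x \<in> B) \<noteq> (trunc m x \<in> D)} < \<epsilon> / 2"
    using assms unfolding approximable_def by (meson half_gt_zero)
  define E where "E = {d. trunc n d \<in> C \<or> trunc m d \<in> D}"
  have tt: "trunc n (trunc (max n m) x) = trunc n x" "trunc m (trunc (max n m) x) = trunc m x" for x :: "nat \<Rightarrow> 'a"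
    by (auto simp: trunc_def fun_eq_iff)
  have "prob {x. (x \<in> A \<union> B) \<noteq> (trunc (max n m) x \<in> E)} \<le>
      prob ({x. (x \<in> A) \<noteq> (trunc n x \<in> C)} \<union> {x. (x \<in> B) \<noteq> (trunc m x \<in> D)})"
    using sets_neq_trunc[OF AB(1), of "\<lambda>v. v \<in> C" n] sets_neq_trunc[OF AB(2), of "\<lambda>v. v \<in> D" m]
    by (intro finite_measure_mono) (auto simp: E_def tt)
  also have "\<dots> \<le> prob {x. (x \<in> A) \<noteq> (trunc n x \<in> C)} + prob {x. (x \<in> B) \<noteq> (trunc m x \<in> D)}"
    using sets_neq_trunc[OF AB(1), of "\<lambda>v. v \<in> C" n] sets_neq_trunc[OF AB(2), of "\<lambda>v. v \<in> D" m]
    by (intro measure_Un_le)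
  finally show "\<exists>n C. prob {x. (x \<in> A \<union> B) \<noteq> (trunc n x \<in> C)} < \<epsilon>"
    using C D by (intro exI[of _ "max n m"] exI[of _ E]) simp
qed

lemma approximable_trunc: "approximable {x. P (trunc n x)}"
  unfolding approximable_def
proof (intro conjI allI impI sets_trunc)
  fix \<epsilon> :: real assume "0 < \<epsilon>"
  then show "\<exists>m C. prob {x. (x \<in> {x. P (trunc n x)}) \<noteq> (trunc m x \<in> C)} < \<epsilon>"
    by (intro exI[of _ n] exI[of _ "Collect P"]) simp
qed

lemma approximable_UN:
  assumes "\<And>i :: nat. approximable (A i)"
  shows "approximable (\<Union>i. A i)"
  unfolding approximable_def
proof (intro conjI allI impI)
  have A: "A i \<in> sets M" for i using assms by (auto simp: approximable_def)
  then show U: "(\<Union>i. A i) \<in> sets M" by auto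
  have fin: "approximable (\<Union>i<k. A i)" for k
  proof (induction k)
    case 0
    then show ?case using approximable_trunc[of "\<lambda>_. False" 0] by simp
  next
    case (Suc k)
    then show ?case using approximable_Un[OF Suc assms[of k]] by (simp add: lessThan_Suc Un_commute)
  qed
  fix \<epsilon> :: real assume \<epsilon>: "0 < \<epsilon>"
  have "(\<lambda>k. prob (\<Union>i<k. A i)) \<longlonglongrightarrow> prob (\<Union>k. \<Union>i<k. A i)"
    using fin by (intro finite_Lim_measure_incseq) (auto simp: approximable_def incseq_def intro: less_le_trans)
  moreover have "(\<Union>k. \<Union>i<k. A i) = (\<Union>i. A i)" by auto
  ultimately have "(\<lambda>k. prob (\<Union>i<k. A i)) \<longlonglongrightarrow> prob (\<Union>i. A i)" by simp
  then have "eventually (\<lambda>k. prob (\<Union>i. A i) - \<epsilon> / 2 < prob (\<Union>i<k. A i)) sequentially"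
    using \<epsilon> by (intro order_tendstoD) auto
  then obtain k where k: "prob (\<Union>i. A i) - \<epsilon> / 2 < prob (\<Union>i<k. A i)"
    by (auto simp: eventually_sequentially)
  obtain n C where C: "prob {x. (x \<in> (\<Union>i<k. A i)) \<noteq> (trunc n x \<in> C)} < \<epsilon> / 2"
    using fin[of k] \<epsilon> unfolding approximable_def by (meson half_gt_zero)
  let ?D = "{x. (x \<in> (\<Union>i<k. A i)) \<noteq> (trunc n x \<in> C)}"
  have F: "(\<Union>i<k. A i) \<in> sets M" using fin[of k] by (simp add: approximable_def)
  have D: "?D \<in> sets M" by (rule sets_neq_trunc[OF F])
  have "prob {x. (x \<in> (\<Union>i. A i)) \<noteq> (trunc n x \<in> C)} \<le> prob (((\<Union>i. A i) - (\<Union>i<k. A i)) \<union> ?D)"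
    using U F D by (intro finite_measure_mono) auto
  also have "\<dots> \<le> prob ((\<Union>i. A i) - (\<Union>i<k. A i)) + prob ?D"
    using U F D by (intro measure_Un_le) auto
  also have "prob ((\<Union>i. A i) - (\<Union>i<k. A i)) = prob (\<Union>i. A i) - prob (\<Union>i<k. A i)"
    using U F by (intro finite_measure_Diff) auto
  finally show "\<exists>n C. prob {x. (x \<in> (\<Union>i. A i)) \<noteq> (trunc n x \<in> C)} < \<epsilon>"
    using k C by (intro exI[of _ n] exI[of _ C]) simp
qed

lemma sets_approximable:
  assumes "A \<in> sets M"
  shows "approximable A"
proof -
  let ?gen = "{{f \<in> UNIV \<rightarrow>\<^sub>E UNIV. f i \<in> B} |i (B :: 'a set). i \<in> (UNIV :: nat set) \<and> B \<in> UNIV}"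
  have "A \<in> sigma_sets (UNIV \<rightarrow>\<^sub>E UNIV) ?gen"
    using assms sets_PiM_single[of "UNIV :: nat set" "\<lambda>_. uniform_count_measure (UNIV :: 'a set)"]
    by (simp add: sets_PiM space_uniform_count_measure sets_uniform_count_measure)
  then show ?thesis
  proof induction
    case (Basic A)
    then obtain i B where "A = {f. f i \<in> B}" by auto
    then have "A = {f. trunc (Suc i) f i \<in> B}" by (simp add: trunc_def)
    then show ?case using approximable_trunc[of "\<lambda>v. v i \<in> B" "Suc i"] by simp
  next
    case Empty
    then show ?case using approximable_trunc[of "\<lambda>_. False" 0] by simp
  next
    case (Compl A)
    have "- A \<in> sets M" using Compl.IH sets.compl_sets[of A M] by (simp add: approximable_def Compl_eq_Diff_UNIV)
    moreover have "\<exists>n C. prob {x. (x \<in> - A) \<noteq> (trunc n x \<in> C)} < \<epsilon>" if pos: "\<epsilon> > 0" for \<epsilon>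
    proof -
      obtain n C where "prob {x. (x \<in> A) \<noteq> (trunc n x \<in> C)} < \<epsilon>"
        using Compl.IH pos unfolding approximable_def by blast
      then show ?thesis by (intro exI[of _ n] exI[of _ "- C"]) simp
    qed
    ultimately show ?case by (simp add: approximable_def Compl_eq_Diff_UNIV[symmetric])
  next
    case (Union A)
    then show ?case by (intro approximable_UN)
  qed
qed

lemma simple_approx:
  assumes X: "simple_function M X" and \<epsilon>: "0 < \<epsilon>"
  shows "\<exists>n g. (\<forall>d. g d \<in> range X) \<and> prob {x. g (trunc n x) \<noteq> X x} < \<epsilon>"
proof -
  define R where "R = range X"
  have fin: "finite R" using simple_functionD(1)[OF X] by (simp add: R_def)
  have ne: "R \<noteq> {}" by (simp add: R_def)
  have "\<exists>n C. prob {x. (X x = v) \<noteq> (trunc n x \<in> C)} < \<epsilon> / card R" for v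
    using sets_approximable[OF simple_atom_sets[OF X, of v]] fin ne \<epsilon>
    by (simp add: approximable_def card_gt_0_iff)
  then obtain n C where nC: "\<And>v. prob {x. (X x = v) \<noteq> (trunc (n v) x \<in> C v)} < \<epsilon> / card R" by metis
  define m where "m = Max (n ` R)"
  have nm: "n v \<le> m" if "v \<in> R" for v using fin that by (auto simp: m_def)
  \<comment> \<open>If every event \<open>X x = v\<close> is predicted correctly, then v = X x alone
    passes the test. Otherwise any element of R will do: \<open>cond_ent_approx\<close> asks for
    values in the range of X.\<close>
  define g where "g d = (if \<exists>v\<in>R. trunc (n v) d \<in> C v then SOME v. v \<in> R \<and> trunc (n v) d \<in> C v else (SOME v. v \<in> R))" for d
  have gR: "g d \<in> range X" for d
  proof (cases "\<exists>v\<in>R. trunc (n v) d \<in> C v")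
    case True
    then have "\<exists>v. v \<in> R \<and> trunc (n v) d \<in> C v" by blast
    from someI_ex[OF this] show ?thesis using True by (simp add: g_def R_def)
  next
    case False
    then show ?thesis using someI_ex[of "\<lambda>v. v \<in> R"] ne by (auto simp: g_def R_def)
  qed
  let ?D = "\<lambda>v. {x. (X x = v) \<noteq> (trunc (n v) x \<in> C v)}"
  have D: "?D v \<in> sets M" for v
    using sets_neq_trunc[OF simple_atom_sets[OF X, of v], of "\<lambda>d. d \<in> C v"] by simp
  have sub: "{x. g (trunc m x) \<noteq> X x} \<subseteq> (\<Union>v\<in>R. ?D v)"
  proof
    fix x assume x: "x \<in> {x. g (trunc m x) \<noteq> X x}"
    show "x \<in> (\<Union>v\<in>R. ?D v)"
    proof (rule ccontr)
      assume "x \<notin> (\<Union>v\<in>R. ?D v)"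
      then have *: "v \<in> R \<Longrightarrow> trunc (n v) x \<in> C v \<longleftrightarrow> v = X x" for v by auto
      have tr: "v \<in> R \<Longrightarrow> trunc (n v) (trunc m x) = trunc (n v) x" for v
        using nm[of v] by (auto simp: trunc_def fun_eq_iff)
      have XR: "X x \<in> R" by (simp add: R_def)
      have eq: "(v \<in> R \<and> trunc (n v) (trunc m x) \<in> C v) \<longleftrightarrow> v = X x" for v
        using * tr XR by auto
      have ex: "\<exists>v\<in>R. trunc (n v) (trunc m x) \<in> C v" using eq[of "X x"] by auto
      have "g (trunc m x) = (SOME v. v = X x)"
        unfolding g_def if_P[OF ex] eq ..
      then show False using x by simp
    qed
  qed
  have "prob {x. g (trunc m x) \<noteq> X x} \<le> prob (\<Union>v\<in>R. ?D v)"
    by (rule finite_measure_mono[OF sub]) (use fin D in auto)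
  also have "\<dots> \<le> (\<Sum>v\<in>R. prob (?D v))"
    using fin D by (intro finite_measure_subadditive_finite) auto
  also have "\<dots> < (\<Sum>v\<in>R. \<epsilon> / card R)"
    using fin ne nC by (intro sum_strict_mono) auto
  also have "\<dots> = \<epsilon>" using fin ne by simp
  finally show ?thesis using gR by (intro exI[of _ m] exI[of _ g]) auto
qed

text \<open>The coordinates generate the Borel sets: X agrees off a small set with a function of
  finitely many coordinates, and conditioning on the coordinates themselves is finer still.\<close>

lemma cond_ent_trunc_small:
  assumes X: "simple_function M X" and \<epsilon>: "0 < \<epsilon>"
  obtains n where "ent (\<lambda>x. (X x, trunc n x)) - ent (trunc n) < \<epsilon>"
proof -
  have "\<exists>n g. (\<forall>d. g d \<in> range X) \<and> prob {x. g (trunc n x) \<noteq> X x} < 1 / Suc l" for l :: nat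
    by (rule simple_approx[OF X]) simp
  then have "\<forall>l. \<exists>n g. (\<forall>d. g d \<in> range X) \<and> prob {x. g (trunc n x) \<noteq> X x} < 1 / Suc l"
    by blast
  from choice[OF this] obtain n where
    "\<forall>l. \<exists>g. (\<forall>d. g d \<in> range X) \<and> prob {x. g (trunc (n l) x) \<noteq> X x} < 1 / Suc l" by blast
  from choice[OF this] obtain g where
    g: "\<And>l d. g l d \<in> range X" "\<And>l. prob {x. g l (trunc (n l) x) \<noteq> X x} < 1 / Suc l" by blast
  have simp_g: "simple_function M (\<lambda>x. g l (trunc (n l) x))" for l
    by (rule simple_function_compose1[OF simple_trunc])
  have "(\<lambda>l. ent (\<lambda>x. (X x, g l (trunc (n l) x))) - ent (\<lambda>x. g l (trunc (n l) x))) \<longlonglongrightarrow> 0"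
  proof (rule cond_ent_approx[OF X simp_g])
    show "(\<lambda>l. prob {\<omega>. g l (trunc (n l) \<omega>) \<noteq> X \<omega>}) \<longlonglongrightarrow> 0"
      by (rule tendsto_sandwich[OF _ _ tendsto_const LIMSEQ_inverse_real_of_nat])
         (use g(2) in \<open>auto intro!: eventuallyI less_imp_le simp: inverse_eq_divide\<close>)
  qed (rule g)
  then obtain l where l: "ent (\<lambda>x. (X x, g l (trunc (n l) x))) - ent (\<lambda>x. g l (trunc (n l) x)) < \<epsilon>"
    using \<epsilon> order_tendstoD(2)[of _ 0 sequentially \<epsilon>] by (auto simp: eventually_sequentially)
  have "ent (\<lambda>x. (X x, trunc (n l) x)) - ent (trunc (n l)) \<le> ent (\<lambda>x. (X x, g l (trunc (n l) x))) - ent (\<lambda>x. g l (trunc (n l) x))"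
    by (rule ent_cond_mono[OF X simple_trunc simp_g]) simp
  then show ?thesis using l by (intro that[of "n l"]) simp
qed

lemma ent_trunc: "ent (itinerary shift_map coord0 n) = ent (trunc n)"
  by (rule ent_cong_fibres) (rule itinerary_shift_eq_iff)

text \<open>Errors below 2^-k are summable, so by Borel-Cantelli almost every x is eventually
  classified correctly, and the limit superior of the approximating sets serves as C.\<close>

lemma vimage_closed:
  assumes B: "B \<in> sets M" and T: "preserves T"
    and approx: "\<And>\<epsilon>. 0 < \<epsilon> \<Longrightarrow> \<exists>C\<in>sets M. prob {x. (x \<in> B) \<noteq> (T x \<in> C)} < \<epsilon>"
  obtains C where "C \<in> sets M" "AE x in M. x \<in> B \<longleftrightarrow> T x \<in> C"
proof -
  have "\<exists>C\<in>sets M. prob {x. (x \<in> B) \<noteq> (T x \<in> C)} < (1 / 2) ^ k" for k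
    by (rule approx) simp
  then have "\<forall>k. \<exists>C. C \<in> sets M \<and> prob {x. (x \<in> B) \<noteq> (T x \<in> C)} < (1 / 2) ^ k" by blast
  from choice[OF this] obtain C where
    C: "\<And>k. C k \<in> sets M" "\<And>k. prob {x. (x \<in> B) \<noteq> (T x \<in> C k)} < (1 / 2) ^ k" by blast
  let ?D = "\<lambda>k. {x. (x \<in> B) \<noteq> (T x \<in> C k)}"
  have D: "?D k \<in> sets M" for k
  proof -
    have "?D k = (B - T -` C k) \<union> (T -` C k - B)" by auto
    then show ?thesis using B preserves_vimage_sets[OF T C(1)[of k]] by auto
  qed
  have "summable (\<lambda>k. prob (?D k))"
    by (rule summable_comparison_test'[of "\<lambda>k. (1 / 2) ^ k" 0]) (use C(2) in \<open>auto simp: less_imp_le\<close>)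
  then have "AE x in M. eventually (\<lambda>k. x \<in> space M - ?D k) sequentially"
    using D by (intro borel_cantelli_AE1) (auto simp: emeasure_eq_measure)
  then have "AE x in M. x \<in> B \<longleftrightarrow> T x \<in> (\<Inter>i. \<Union>k\<in>{i..}. C k)"
  proof eventually_elim
    case (elim x)
    then obtain i where i: "\<And>k. k \<ge> i \<Longrightarrow> (x \<in> B) = (T x \<in> C k)"
      by (auto simp: eventually_sequentially)
    show ?case
    proof
      assume "x \<in> B"
      then have "T x \<in> C (max i j)" for j using i[of "max i j"] by simp
      then have "T x \<in> (\<Union>k\<in>{j..}. C k)" for j
        by (intro UN_I[of "max i j"]) auto
      then show "T x \<in> (\<Inter>i. \<Union>k\<in>{i..}. C k)" by blast
    next
      assume "T x \<in> (\<Inter>i. \<Union>k\<in>{i..}. C k)"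
      then show "x \<in> B" using i by auto
    qed
  qed
  moreover have "(\<Inter>i. \<Union>k\<in>{i..}. C k) \<in> sets M"
    using C(1) sets.top[of M] by (intro sets.countable_INT'' sets.countable_UN') auto
  ultimately show ?thesis by (rule that[rotated])
qed

text \<open>The generator argument at rate 0: a partition grows at most at the rate of the
  coordinate blocks plus its conditional entropy given l coordinates, which is small for suitable
  l.\<close>

lemma KS_entropy_nonpos:
  assumes sub: "\<And>\<epsilon>. 0 < \<epsilon> \<Longrightarrow> \<exists>C. \<forall>n. ent (trunc n) \<le> C + real n * \<epsilon>"
  shows "KS_entropy M shift_map \<le> 0"
  unfolding KS_entropy_def
proof (rule SUP_least)
  fix P assume "P \<in> {P. finite_partition M P}"
  then have P: "finite P" "P \<subseteq> sets M" "partition_on UNIV P"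
    by (auto simp: finite_partition_def)
  define Q where "Q x = (THE A. A \<in> P \<and> x \<in> A)" for x
  have Q: "Q x \<in> P \<and> x \<in> Q x" for x
    unfolding Q_def
  proof (rule theI')
    show "\<exists>!A. A \<in> P \<and> x \<in> A"
      using P(3) by (auto simp: partition_on_def disjoint_def)
  qed
  have Q_iff: "x \<in> A \<longleftrightarrow> Q x = A" if "A \<in> P" for A x
    using Q[of x] P(3) that by (auto simp: partition_on_def disjoint_def)
  have sQ: "simple_function M Q"
    unfolding simple_function_def
  proof (intro conjI ballI)
    show "finite (Q ` space M)" by (rule finite_subset[OF _ P(1)]) (use Q in auto)
    fix A assume "A \<in> Q ` space M"
    then have "A \<in> P" using Q by auto
    then have "Q -` {A} \<inter> space M = A" using Q_iff by auto
    then show "Q -` {A} \<inter> space M \<in> sets M" using \<open>A \<in> P\<close> P(2) by auto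
  qed
  let ?I = "itinerary shift_map Q"
  have pe: "partition_entropy M (iterated_join M shift_map P n) = ent (?I n)" for n
  proof -
    let ?J = "iterated_join M shift_map P n"
    let ?c = "\<lambda>v. {x. ?I n x = v}"
    have cell: "{x \<in> space M. \<forall>i<n. (shift_map ^^ i) x \<in> A i} = ?c A" if "A \<in> {..<n} \<rightarrow>\<^sub>E P" for A
    proof -
      have "(\<forall>i<n. (shift_map ^^ i) x \<in> A i) \<longleftrightarrow> ?I n x = A" for x
        using that Q_iff by (auto simp: itinerary_def fun_eq_iff PiE_iff extensional_def)
      then show ?thesis by simp
    qed
    have rng: "range (?I n) \<subseteq> {..<n} \<rightarrow>\<^sub>E P"
      using Q by (auto simp: itinerary_def PiE_iff extensional_def split: if_splits)
    have J: "?J = ?c ` ({..<n} \<rightarrow>\<^sub>E P)"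
      unfolding iterated_join_def by (rule image_cong[OF refl cell])
    have "(\<Sum>A\<in>?J. prob A * ln (prob A)) = (\<Sum>A\<in>?c ` range (?I n). prob A * ln (prob A))"
    proof (rule sum.mono_neutral_right)
      show "finite ?J" unfolding J using P(1) by (intro finite_imageI finite_PiE) auto
      show "?c ` range (?I n) \<subseteq> ?J" unfolding J using rng by (rule image_mono)
      show "\<forall>A\<in>?J - ?c ` range (?I n). prob A * ln (prob A) = 0"
      proof
        fix A assume "A \<in> ?J - ?c ` range (?I n)"
        then obtain v where "A = ?c v" "v \<notin> range (?I n)" unfolding J by blast
        then have "A = {}" by auto
        then show "prob A * ln (prob A) = 0" by simp
      qed
    qed
    also have "\<dots> = (\<Sum>v\<in>range (?I n). prob (?c v) * ln (prob (?c v)))"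
      by (subst sum.reindex) (auto simp: inj_on_def o_def)
    finally show ?thesis
      by (simp add: partition_entropy_def ent_sum[OF simple_itinerary[OF sQ preserves_shift]])
  qed
  \<comment> \<open>The entropy of a partition is a \<open>lim\<close>, so convergence itself has to
    be shown. Half of the slope r / 2 comes from the coordinate blocks, half from Q given l
    coordinates.\<close>
  have "(\<lambda>n. ent (?I n) / real n) \<longlonglongrightarrow> 0"
  proof (rule LIMSEQ_I)
    fix r :: real assume r: "0 < r"
    obtain l where l: "ent (\<lambda>x. (Q x, trunc l x)) - ent (trunc l) < r / 4"
      using cond_ent_trunc_small[OF sQ, of "r / 4"] r by auto
    obtain C where C: "\<And>n. ent (trunc n) \<le> C + real n * (r / 4)"
      using sub[of "r / 4"] r by auto
    have e: "ent (\<lambda>x. (Q x, itinerary shift_map coord0 l x)) = ent (\<lambda>x. (Q x, trunc l x))"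
      by (rule ent_cong_fibres) (simp add: itinerary_shift_eq_iff)
    have bound: "ent (?I n) \<le> \<bar>C\<bar> + real l * r + real n * (r / 2)" for n
    proof -
      have "ent (?I n) \<le> ent (\<lambda>x. (?I n x, itinerary shift_map coord0 (n + l) x))"
        by (rule ent_mono) (auto intro!: simple_function_Pair simple_itinerary sQ preserves_shift simple_coord)
      also have "\<dots> \<le> ent (trunc (n + l)) + real n * (ent (\<lambda>x. (Q x, trunc l x)) - ent (trunc l))"
        using itinerary_upper_bound[OF simple_coord preserves_shift sQ, of n 0 l] by (simp add: e ent_trunc)
      also have "\<dots> \<le> (C + real (n + l) * (r / 4)) + real n * (r / 4)"
        using l C[of "n + l"] by (intro add_mono mult_left_mono) auto
      also have "\<dots> \<le> \<bar>C\<bar> + real l * r + real n * (r / 2)"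
      proof -
        have "0 \<le> r * real l" using r by simp
        then have "C + r * real l / 4 \<le> \<bar>C\<bar> + r * real l" using abs_ge_self[of C] by linarith
        then show ?thesis by (simp add: algebra_simps add_divide_distrib)
      qed
      finally show ?thesis .
    qed
    have nn: "0 \<le> ent (?I n)" for n
      using ent_mono[OF simple_function_const[of M "()"] simple_itinerary[OF sQ preserves_shift], of n]
      by (simp add: ent_const)
    obtain m :: nat where m: "\<bar>C\<bar> + real l * r < real m * (r / 2)"
      using reals_Archimedean3[OF half_gt_zero[OF r]] by blast
    show "\<exists>no. \<forall>n\<ge>no. norm (ent (?I n) / real n - 0) < r"
    proof (intro exI allI impI)
      fix n assume n: "Suc m \<le> n"
      have "real m * (r / 2) \<le> real n * (r / 2)" using n r by (intro mult_right_mono) auto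
      then have "ent (?I n) < real n * r" using bound[of n] m by linarith
      then show "norm (ent (?I n) / real n - 0) < r"
        using n nn[of n] by (simp add: divide_simps mult.commute)
    qed
  qed
  then have "KS_entropy_partition M shift_map P = 0"
    unfolding KS_entropy_partition_def pe by (rule limI)
  then show "ereal (KS_entropy_partition M shift_map P) \<le> 0" by simp
qed

text \<open>Let P y be the set of first letters that y permits, almost surely a single one. By
  stationarity the increment of the block entropies is H(P | the first n coordinates), which becomes
  arbitrarily small.\<close>

lemma KS_entropy_nonpos_if_determined:
  assumes C: "\<And>d. d \<in> supp_below 1 \<Longrightarrow> C d \<in> sets M"
    and det: "\<And>d. d \<in> supp_below 1 \<Longrightarrow> AE x in M. trunc 1 x = d \<longleftrightarrow> shift_map x \<in> C d"
  shows "KS_entropy M shift_map \<le> 0"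
proof (rule KS_entropy_nonpos)
  define P where "P y = {d \<in> supp_below 1. y \<in> C d}" for y
  have sP: "simple_function M P"
    unfolding simple_function_def
  proof (intro conjI ballI)
    show "finite (P ` space M)"
      by (rule finite_subset[of _ "Pow (supp_below 1)"]) (auto simp: P_def finite_supp_below)
    fix V assume "V \<in> P ` space M"
    then have V: "V \<subseteq> supp_below 1" by (auto simp: P_def)
    have "P y = V \<longleftrightarrow> (\<forall>d\<in>supp_below 1. y \<in> C d \<longleftrightarrow> d \<in> V)" for y
      using V unfolding P_def by blast
    then have "P -` {V} \<inter> space M = {y \<in> space M. \<forall>d\<in>supp_below 1. y \<in> C d \<longleftrightarrow> d \<in> V}"
      by auto
    also have "\<dots> \<in> sets M"
    proof (intro sets.sets_Collect_finite_All finite_supp_below)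
      fix d :: "nat \<Rightarrow> 'a" assume "d \<in> supp_below 1"
      then show "{y \<in> space M. y \<in> C d \<longleftrightarrow> d \<in> V} \<in> sets M"
        using C[of d] sets.compl_sets[of "C d" M] by (cases "d \<in> V") (simp_all add: Collect_neg_eq Compl_eq_Diff_UNIV)
    qed
    finally show "P -` {V} \<inter> space M \<in> sets M" .
  qed
  have "AE x in M. \<forall>d\<in>supp_below 1. trunc 1 x = d \<longleftrightarrow> shift_map x \<in> C d"
    using det by (intro AE_finite_allI finite_supp_below) auto
  then have P: "AE x in M. P (shift_map x) = {trunc 1 x}"
    by eventually_elim (use trunc_supp in \<open>fastforce simp: P_def\<close>)
  obtain h where h: "\<And>n. h \<le> ent (itinerary shift_map coord0 (Suc n)) - ent (itinerary shift_map coord0 n)"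
    "\<And>\<epsilon>. 0 < \<epsilon> \<Longrightarrow> \<exists>C. \<forall>n. ent (itinerary shift_map coord0 n) \<le> C + real n * (h + \<epsilon>)"
    by (rule itinerary_growth[OF simple_coord[of 0] preserves_shift]) blast
  have "h < \<epsilon>" if "0 < \<epsilon>" for \<epsilon>
  proof -
    obtain n where n: "ent (\<lambda>x. (P x, trunc n x)) - ent (trunc n) < \<epsilon>"
      using cond_ent_trunc_small[OF sP \<open>0 < \<epsilon>\<close>] .
    have PT: "simple_function M (\<lambda>x. (P x, trunc n x))"
      by (rule simple_function_Pair[OF sP simple_trunc])
    have "ent (itinerary shift_map coord0 (Suc n)) = ent (\<lambda>x. ({trunc 1 x}, trunc n (shift_map x)))"
      by (rule ent_cong_fibres) (simp add: itinerary_Suc_eq_iff itinerary_shift_eq_iff trunc_eq_iff)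
    also have "\<dots> = ent (\<lambda>x. (P (shift_map x), trunc n (shift_map x)))"
      by (rule ent_cong_AE)
         (use P in \<open>auto intro!: simple_function_Pair simple_function_preserves[OF _ preserves_shift] simple_trunc sP
            simple_function_compose1[OF simple_trunc, of "\<lambda>d. {d}"]\<close>)
    also have "\<dots> = ent (\<lambda>x. (P x, trunc n x))"
      using ent_comp[OF PT preserves_shift] by simp
    finally show ?thesis using h(1)[of n] n by (simp add: ent_trunc)
  qed
  then have "h \<le> 0" by (meson less_irrefl not_less)
  fix \<epsilon> :: real assume "0 < \<epsilon>"
  then obtain C where C: "\<And>n. ent (trunc n) \<le> C + real n * (h + \<epsilon>)"
    using h(2) by (auto simp: ent_trunc)
  have "ent (trunc n) \<le> C + real n * \<epsilon>" for n
    using C[of n] mult_left_mono[of "h + \<epsilon>" \<epsilon> "real n"] \<open>h \<le> 0\<close> by simp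
  then show "\<exists>C. \<forall>n. ent (trunc n) \<le> C + real n * \<epsilon>" by blast
qed

end

section \<open>Sets invariant under the cellular automaton\<close>

locale CA_measure = group_CA p F \<alpha> \<beta> c f' + seq_prob M
  for p :: nat and F :: "(nat \<Rightarrow> 'a::{finite,discrete_topology,ab_group_add}) \<Rightarrow> nat \<Rightarrow> 'a"
    and \<alpha> \<beta> c f' and M :: "(nat \<Rightarrow> 'a) measure" +
  assumes preserves_F: "preserves F"
begin

lemma AE_invariant_pow:
  assumes "preserves T" "AE x in M. Y (T x) = Y x"
  shows "AE x in M. Y ((T ^^ k) x) = Y x"
proof (induction k)
  case (Suc k)
  have "AE x in M. Y (T ((T ^^ k) x)) = Y ((T ^^ k) x)"
    by (rule preserves_AE[OF preserves_funpow[OF assms(1)] assms(2)])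
  then show ?case using Suc by eventually_elim simp
qed simp

text \<open>F is affine, so the difference of two orbits evolves under G and
  \<open>window_iff\<close> applies to it.\<close>

lemma itinerary_F_eq_iff:
  assumes "n > 0"
  shows "itinerary F coord0 (2 * n - 1) x = itinerary F coord0 (2 * n - 1) y \<longleftrightarrow>
    trunc n ((F ^^ (n - 1)) x) = trunc n ((F ^^ (n - 1)) y)"
proof -
  have "(F ^^ i) x j = (F ^^ i) y j \<longleftrightarrow> (G ^^ i) (x - y) j = 0" for i j
    by (simp flip: F_pow_diff)
  then show ?thesis
    unfolding itinerary_eq_iff trunc_eq_iff using window_iff[OF assms, of "x - y"] by simp
qed

text \<open>The 2 n - 1 column entries amount to n cells at time n - 1; stationarity moves these to
  time 0, and Y does not notice because it is F-invariant.\<close>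

lemma ent_window:
  assumes Y: "simple_function M Y" and inv: "AE x in M. Y (F x) = Y x" and n: "n > 0"
  shows "ent (\<lambda>x. (itinerary F coord0 (2 * n - 1) x, Y x)) = ent (\<lambda>x. (trunc n x, Y x))"
proof -
  note Fn = preserves_funpow[OF preserves_F, of "n - 1"]
  note tY = simple_function_Pair[OF simple_trunc[of n] Y]
  note tF = simple_function_preserves[OF simple_trunc[of n] Fn]
  have "ent (\<lambda>x. (trunc n x, Y x)) = ent (\<lambda>x. (trunc n ((F ^^ (n - 1)) x), Y ((F ^^ (n - 1)) x)))"
    using ent_comp[OF tY Fn] by simp
  also have "\<dots> = ent (\<lambda>x. (trunc n ((F ^^ (n - 1)) x), Y x))"
  proof (rule ent_cong_AE)
    show "AE x in M. (trunc n ((F ^^ (n - 1)) x), Y ((F ^^ (n - 1)) x)) = (trunc n ((F ^^ (n - 1)) x), Y x)"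
      using AE_invariant_pow[OF preserves_F inv, of "n - 1"] by simp
  qed (intro simple_function_Pair tF simple_function_preserves[OF Y Fn] Y)+
  also have "\<dots> = ent (\<lambda>x. (itinerary F coord0 (2 * n - 1) x, Y x))"
    by (rule ent_cong_fibres) (simp only: prod.inject itinerary_F_eq_iff[OF n])
  finally show ?thesis by simp
qed

text \<open>
  The \<open>\<sigma>\<close>-itinerary of an \<open>F\<close>-invariant set has zero entropy: the first \<open>n\<close> coordinates carry the
  same information as \<open>2 n - 1\<close> steps of the column, so their entropy already grows at the rate
  which the column has conditionally on the itinerary.
\<close>

lemma invariant_set_shift_measurable:
  assumes B: "B \<in> sets M" and inv: "AE x in M. F x \<in> B \<longleftrightarrow> x \<in> B"
  obtains C where "C \<in> sets M" "AE x in M. x \<in> B \<longleftrightarrow> shift_map x \<in> C"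
proof (rule vimage_closed[OF B preserves_shift])
  fix \<epsilon> :: real assume \<epsilon>: "0 < \<epsilon>"
  define \<zeta> where "\<zeta> x = (x \<in> B)" for x
  have s\<zeta>: "simple_function M \<zeta>"
    unfolding simple_function_def
  proof (intro conjI ballI)
    show "\<zeta> -` {v} \<inter> space M \<in> sets M" for v
      using B sets.compl_sets[OF B] by (cases v) (auto simp: \<zeta>_def vimage_def Collect_neg_eq Compl_eq_Diff_UNIV)
  qed simp
  let ?Y = "\<lambda>n. itinerary shift_map \<zeta> n"
  note sY = simple_itinerary[OF s\<zeta> preserves_shift]
  have inv_Y: "AE x in M. ?Y n (F x) = ?Y n x" for n
  proof -
    have "AE x in M. \<zeta> (F ((shift_map ^^ i) x)) = \<zeta> ((shift_map ^^ i) x)" for i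
      using preserves_AE[OF preserves_funpow[OF preserves_shift] inv] by (simp add: \<zeta>_def)
    then have "AE x in M. \<forall>i. \<zeta> (F ((shift_map ^^ i) x)) = \<zeta> ((shift_map ^^ i) x)"
      by (simp add: AE_all_countable)
    then show ?thesis
      by eventually_elim (simp add: itinerary_eq_iff F_pow_shift_pow[of 1, simplified])
  qed
  obtain h where h: "\<And>n. real n * h \<le> ent (itinerary F coord0 n)"
    "\<And>\<epsilon>. 0 < \<epsilon> \<Longrightarrow> \<exists>C. \<forall>n. ent (itinerary F coord0 n) \<le> C + real n * (h + \<epsilon>)"
    by (rule itinerary_growth[OF simple_coord[of 0] preserves_F]) blast
  \<comment> \<open>The entropy of \<open>?Y n\<close> will grow with slope at most 3 \<delta>: 2
    \<delta> from the rate of F over 2 n steps, \<delta> from \<zeta> given l coordinates. Hence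
    some increment is below 8 \<delta> = \<epsilon> ln 2, which \<open>guess_from_cond_ent\<close>
    turns into an error below \<epsilon>.\<close>
  define \<delta> where "\<delta> = \<epsilon> * ln 2 / 8"
  have \<delta>: "\<delta> > 0" using \<epsilon> by (simp add: \<delta>_def)
  obtain C where C: "\<And>n. ent (itinerary F coord0 n) \<le> C + real n * (h + \<delta>)"
    using h(2)[OF \<delta>] by blast
  obtain l where l: "ent (\<lambda>x. (\<zeta> x, trunc l x)) - ent (trunc l) < \<delta>"
    using cond_ent_trunc_small[OF s\<zeta> \<delta>] .
  have e: "ent (\<lambda>x. (\<zeta> x, itinerary shift_map coord0 l x)) = ent (\<lambda>x. (\<zeta> x, trunc l x))"
    by (rule ent_cong_fibres) (simp add: itinerary_shift_eq_iff)
  have bound: "ent (?Y n) \<le> C + 2 * real l * (h + \<delta>) + real n * (3 * \<delta>)" if n: "n > 0" for n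
  proof -
    have "ent (?Y n) + real (2 * n - 1) * h \<le> ent (\<lambda>x. (itinerary F coord0 (2 * n - 1) x, ?Y n x))"
      by (rule itinerary_invariant_lower_bound[OF simple_coord preserves_F sY inv_Y h(1)])
    also have "\<dots> = ent (\<lambda>x. (trunc n x, ?Y n x))"
      by (rule ent_window[OF sY inv_Y n])
    also have "\<dots> \<le> ent (\<lambda>x. (?Y n x, itinerary shift_map coord0 (n + l) x))"
      by (rule ent_mono)
         (auto intro!: simple_function_Pair simple_trunc sY simple_itinerary simple_coord preserves_shift
           simp: itinerary_shift_eq_iff trunc_eq_iff)
    also have "\<dots> \<le> ent (trunc (n + l)) + real n * (ent (\<lambda>x. (\<zeta> x, trunc l x)) - ent (trunc l))"
      using itinerary_upper_bound[OF simple_coord preserves_shift s\<zeta>, of n 0 l] by (simp add: e ent_trunc)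
    also have "\<dots> \<le> ent (trunc (n + l)) + real n * \<delta>"
      using l by (intro add_left_mono mult_left_mono) auto
    also have "ent (trunc (n + l)) = ent (itinerary F coord0 (2 * (n + l) - 1))"
      using ent_window[OF simple_function_const[of M "()"], of "n + l"] n by (simp add: ent_pair_const)
    also have "\<dots> \<le> C + real (2 * (n + l) - 1) * (h + \<delta>)" by (rule C)
    finally have "ent (?Y n) + (2 * real n - 1) * h \<le> C + (2 * real n + 2 * real l - 1) * (h + \<delta>) + real n * \<delta>"
      using n by (simp add: of_nat_diff)
    then show ?thesis using \<delta> by (simp add: algebra_simps)
  qed
  have "\<exists>n. ent (?Y (Suc n)) - ent (?Y n) < \<epsilon> * ln 2"
  proof (rule ccontr)
    assume "\<not> ?thesis"
    then have step: "ent (?Y n) + 8 * \<delta> \<le> ent (?Y (Suc n))" for n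
      by (simp add: \<delta>_def not_less) (smt (verit))
    have "real n * (8 * \<delta>) \<le> ent (?Y n)" for n
    proof (induction n)
      case (Suc n)
      then show ?case using step[of n] by (simp add: algebra_simps)
    qed (simp add: itinerary_ent_0)
    then have "real n * (5 * \<delta>) \<le> C + 2 * real l * (h + \<delta>)" if "n > 0" for n
      using bound[OF that] by (smt (verit) distrib_left)
    moreover obtain m :: nat where m: "C + 2 * real l * (h + \<delta>) < real m * (5 * \<delta>)"
      using reals_Archimedean3[of "5 * \<delta>"] \<delta> by auto
    moreover have "real m * (5 * \<delta>) \<le> real (Suc m) * (5 * \<delta>)" using \<delta> by (intro mult_right_mono) auto
    ultimately show False by (metis less_le_trans not_less zero_less_Suc)
  qed
  then obtain n where n: "ent (?Y (Suc n)) - ent (?Y n) < \<epsilon> * ln 2" by blast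
  note sYS = simple_function_preserves[OF sY preserves_shift]
  have eq: "ent (?Y (Suc n)) - ent (?Y n) = ent (\<lambda>x. (\<zeta> x, ?Y n (shift_map x))) - ent (\<lambda>x. ?Y n (shift_map x))"
  proof -
    have "ent (?Y (Suc n)) = ent (\<lambda>x. (\<zeta> x, ?Y n (shift_map x)))"
      by (rule ent_cong_fibres) (simp add: itinerary_Suc_eq_iff)
    then show ?thesis using ent_comp[OF sY preserves_shift] by simp
  qed
  obtain R where R: "ln 2 * prob {x. \<zeta> x \<noteq> (?Y n (shift_map x) \<in> R)} \<le> ent (\<lambda>x. (\<zeta> x, ?Y n (shift_map x))) - ent (\<lambda>x. ?Y n (shift_map x))"
    by (rule guess_from_cond_ent[OF s\<zeta> sYS])
  then have "ln 2 * prob {x. \<zeta> x \<noteq> (?Y n (shift_map x) \<in> R)} < ln 2 * \<epsilon>"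
    using n eq mult.commute[of \<epsilon> "ln 2"] by linarith
  then have "prob {x. \<zeta> x \<noteq> (?Y n (shift_map x) \<in> R)} < \<epsilon>" by simp
  then show "\<exists>C\<in>sets M. prob {x. (x \<in> B) \<noteq> (shift_map x \<in> C)} < \<epsilon>"
    using simple_pred_sets[OF sY, of "\<lambda>v. v \<in> R" n]
    by (intro bexI[of _ "{x. ?Y n x \<in> R}"]) (simp_all add: \<zeta>_def)
qed (rule that)

text \<open>The previous lemma can be iterated because the new set is again F-invariant: F commutes
  with \<sigma>, and a property of \<sigma> x for almost every x holds almost everywhere, as
  \<sigma> preserves M.\<close>

lemma invariant_set_shift_pow_measurable:
  assumes B: "B \<in> sets M" and inv: "AE x in M. F x \<in> B \<longleftrightarrow> x \<in> B"
  shows "\<exists>C\<in>sets M. (AE x in M. F x \<in> C \<longleftrightarrow> x \<in> C) \<and> (AE x in M. x \<in> B \<longleftrightarrow> (shift_map ^^ m) x \<in> C)"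
proof (induction m)
  case 0
  then show ?case using B inv by auto
next
  case (Suc m)
  then obtain C where C: "C \<in> sets M" "AE x in M. F x \<in> C \<longleftrightarrow> x \<in> C"
    "AE x in M. x \<in> B \<longleftrightarrow> (shift_map ^^ m) x \<in> C" by blast
  obtain D where D: "D \<in> sets M" "AE x in M. x \<in> C \<longleftrightarrow> shift_map x \<in> D"
    by (rule invariant_set_shift_measurable[OF C(1,2)])
  have "AE x in M. F (shift_map x) \<in> D \<longleftrightarrow> shift_map x \<in> D"
    using preserves_AE[OF preserves_F D(2)] D(2) C(2)
    by eventually_elim (simp add: F_shift)
  then have "AE x in distr M M shift_map. F x \<in> D \<longleftrightarrow> x \<in> D"
  proof (subst AE_distr_iff)
    show "shift_map \<in> measurable M M" using preserves_shift by (simp add: preserves_def)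
    have "{x. F x \<in> D \<longleftrightarrow> x \<in> D} = (F -` D \<inter> D) \<union> (UNIV - (F -` D \<union> D))" by auto
    also have "\<dots> \<in> sets M"
      using D(1) preserves_vimage_sets[OF preserves_F D(1)] sets.compl_sets[of "F -` D \<union> D" M] by auto
    finally show "{x \<in> space M. F x \<in> D \<longleftrightarrow> x \<in> D} \<in> sets M" by simp
  qed
  then have "AE x in M. F x \<in> D \<longleftrightarrow> x \<in> D"
    using preserves_shift unfolding preserves_def by metis
  moreover have "AE x in M. x \<in> B \<longleftrightarrow> (shift_map ^^ Suc m) x \<in> D"
    using C(3) preserves_AE[OF preserves_funpow[OF preserves_shift, of m] D(2)]
    by eventually_elim simp
  ultimately show ?case using D(1) by blast
qed

end

section \<open>Conditional measures on the fibres of the shift\<close>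

context full_prob_space
begin

text \<open>
  If \<open>p\<close> divides \<open>m\<close> then an eigenvalue of order \<open>q dvd m p\<close> with \<open>\<not> q dvd m\<close> would have \<open>p dvd q\<close>,
  and its \<open>p\<close>-th power would be a nontrivial eigenvalue of order dividing \<open>m\<close>. On itineraries: if
  a periodic word is moved by the shift inside its orbit under the \<open>p\<close>-fold shift, then its period
  divides \<open>m\<close>.
\<close>

lemma invariant_sets_power_step:
  assumes T: "preserves T" and p: "p dvd m" "m > 0" "p > 0"
    and hyp: "\<And>B. B \<in> sets M \<Longrightarrow> AE x in M. (T ^^ m) x \<in> B \<longleftrightarrow> x \<in> B \<Longrightarrow> AE x in M. T x \<in> B \<longleftrightarrow> x \<in> B"
    and B: "B \<in> sets M" and inv: "AE x in M. (T ^^ (m * p)) x \<in> B \<longleftrightarrow> x \<in> B"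
  shows "AE x in M. T x \<in> B \<longleftrightarrow> x \<in> B"
proof (rule hyp[OF B])
  define s where "s x i = ((T ^^ i) x \<in> B)" for x i
  have s_pow: "s ((T ^^ j) x) i = s x (i + j)" for x i j
    by (simp add: s_def funpow_add)
  have s_sets: "{x. s x i = b} \<in> sets M" for i b
    using preserves_vimage_sets[OF preserves_funpow[OF T, of i] B]
      sets.compl_sets[of "(T ^^ i) -` B" M]
    by (cases b) (auto simp: s_def vimage_def Collect_neg_eq Compl_eq_Diff_UNIV)
  have "AE x in M. s x (i + m * p) = s x i" for i
    using preserves_AE[OF preserves_funpow[OF T, of i] inv]
    by (simp add: s_def funpow_app_add add.commute)
  then have good: "AE x in M. \<forall>i. s x (i + m * p) = s x i"
    by (simp add: AE_all_countable)
  define Per where "Per = {w :: nat \<Rightarrow> bool. \<forall>i. w (i + m * p) = w i}"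
  have per_mult: "w (i + j * (m * p)) = w i" if "w \<in> Per" for w i j
  proof (induction j)
    case (Suc j)
    have "w (i + j * (m * p) + m * p) = w (i + j * (m * p))" using that by (simp add: Per_def)
    then show ?case using Suc by (simp add: algebra_simps)
  qed simp
  have "Per \<subseteq> (\<lambda>A i. i mod (m * p) \<in> A) ` Pow {..<m * p}"
  proof
    fix w assume w: "w \<in> Per"
    have "w i = w (i mod (m * p))" for i
      using per_mult[OF w, of "i mod (m * p)" "i div (m * p)"] by (simp only: mod_div_mult_eq)
    then have "w = (\<lambda>i. i mod (m * p) \<in> {i\<in>{..<m * p}. w i})"
      using p by (auto simp: fun_eq_iff)
    then show "w \<in> (\<lambda>A i. i mod (m * p) \<in> A) ` Pow {..<m * p}" by blast
  qed
  then have finPer: "finite Per" by (rule finite_subset) simp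
  \<comment> \<open>Points whose itinerary is w moved by a multiple of p. As p divides m, T^m merely
    changes j, so the hypothesis on T^m applies to Q w.\<close>
  define Q where "Q w = {x. \<exists>j. \<forall>i. s x i = w (i + p * j)}" for w
  have Q_sets: "Q w \<in> sets M" for w
  proof -
    have "Q w = (\<Union>j. \<Inter>i. {x. s x i = w (i + p * j)})" by (auto simp: Q_def)
    then show ?thesis using s_sets by auto
  qed
  have Q_inv: "AE x in M. T x \<in> Q w \<longleftrightarrow> x \<in> Q w" for w
  proof (rule hyp[OF Q_sets])
    obtain m' where m': "m = p * m'" using p by blast
    \<comment> \<open>Modulo the period m p, going back m steps is a forward shift by p e; the
      exponents j are natural numbers.\<close>
    obtain e where e: "m * p = p * e + m"
    proof
      show "m * p = p * (m - m') + m"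
        using p by (cases p) (simp_all add: m' algebra_simps)
    qed
    show "AE x in M. (T ^^ m) x \<in> Q w \<longleftrightarrow> x \<in> Q w"
      using good
    proof eventually_elim
      case (elim x)
      show ?case
      proof
        assume "(T ^^ m) x \<in> Q w"
        then obtain j where j: "\<And>i. s x (i + m) = w (i + p * j)" by (auto simp: Q_def s_pow)
        have "s x i = w (i + p * (e + j))" for i
        proof -
          have "s x i = s x (i + p * e + m)" using elim e by (simp add: add.assoc)
          also have "\<dots> = w (i + p * e + p * j)" by (rule j)
          finally show ?thesis by (simp add: algebra_simps)
        qed
        then show "x \<in> Q w" by (auto simp: Q_def)
      next
        assume "x \<in> Q w"
        then obtain j where j: "\<And>i. s x i = w (i + p * j)" by (auto simp: Q_def)
        have "s x (i + m) = w (i + p * (m' + j))" for i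
          by (simp add: j m' algebra_simps)
        then show "(T ^^ m) x \<in> Q w" by (auto simp: Q_def s_pow)
      qed
    qed
  qed
  have "AE x in M. \<forall>w\<in>Per. T x \<in> Q w \<longleftrightarrow> x \<in> Q w"
    using Q_inv by (intro AE_finite_allI finPer) auto
  then show "AE x in M. (T ^^ m) x \<in> B \<longleftrightarrow> x \<in> B"
    using good
  proof eventually_elim
    case (elim x)
    have w: "s x \<in> Per" using elim by (simp add: Per_def)
    have "x \<in> Q (s x)" unfolding Q_def by (auto intro: exI[of _ 0])
    then have "T x \<in> Q (s x)" using elim w by blast
    then obtain j where j: "\<And>i. s x (Suc i) = s x (i + p * j)"
      using s_pow[of 1 x] by (auto simp: Q_def)
    \<comment> \<open>One step acts on the word as a shift by p j, so m steps act as a shift by j m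
      p, a multiple of its period.\<close>
    have "s x (i + k) = s x (i + k * (p * j))" for i k
    proof (induction k arbitrary: i)
      case (Suc k)
      have "s x (i + Suc k) = s x (Suc i + k * (p * j))" using Suc[of "Suc i"] by simp
      also have "\<dots> = s x (i + k * (p * j) + p * j)" using j[of "i + k * (p * j)"] by simp
      finally show ?case by (simp add: algebra_simps)
    qed simp
    from this[of 0 m] have "s x m = s x (j * (m * p))" by (simp add: ac_simps)
    also have "\<dots> = s x 0" using per_mult[OF w, of 0 j] by simp
    finally show ?case by (simp add: s_def)
  qed
qed

lemma invariant_sets_power:
  assumes T: "preserves T" and p: "p dvd n" "n > 0" "p > 0"
    and hyp: "\<And>B. B \<in> sets M \<Longrightarrow> AE x in M. (T ^^ n) x \<in> B \<longleftrightarrow> x \<in> B \<Longrightarrow> AE x in M. T x \<in> B \<longleftrightarrow> x \<in> B"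
  shows "B \<in> sets M \<Longrightarrow> AE x in M. (T ^^ (n * p ^ j)) x \<in> B \<longleftrightarrow> x \<in> B \<Longrightarrow> AE x in M. T x \<in> B \<longleftrightarrow> x \<in> B"
proof (induction j arbitrary: B)
  case 0
  then show ?case using hyp by simp
next
  case (Suc j)
  show ?case
  proof (rule invariant_sets_power_step[OF T, of p "n * p ^ j"])
    show "AE x in M. (T ^^ (n * p ^ j * p)) x \<in> B \<longleftrightarrow> x \<in> B" using Suc.prems by (simp add: ac_simps)
  qed (use p Suc in auto)
qed

end

text \<open>Inverse of the splitting of x into its first m coordinates and \<sigma>^m x; it labels
  each fibre of \<sigma>^m by words.\<close>

definition glue :: "nat \<Rightarrow> (nat \<Rightarrow> 'a) \<Rightarrow> (nat \<Rightarrow> 'a) \<Rightarrow> nat \<Rightarrow> 'a" where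
  "glue m w y i = (if i < m then w i else y (i - m))"

lemma shift_glue: "(shift_map ^^ m) (glue m w y) = y"
  by (simp add: shift_pow glue_def fun_eq_iff)

lemma trunc_glue: "w \<in> supp_below m \<Longrightarrow> trunc m (glue m w y) = w"
  by (auto simp: trunc_def glue_def supp_below_def fun_eq_iff)

lemma glue_trunc: "glue m (trunc m x) ((shift_map ^^ m) x) = x"
  by (simp add: shift_pow glue_def trunc_def fun_eq_iff)

lemma shift_add_supp:
  fixes d :: "nat \<Rightarrow> 'a::ab_group_add"
  assumes "d \<in> supp_below m"
  shows "(shift_map ^^ m) (x + d) = (shift_map ^^ m) x"
  using assms by (simp add: shift_pow supp_below_def fun_eq_iff)

lemma trunc_add_supp:
  fixes d :: "nat \<Rightarrow> 'a::ab_group_add"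
  assumes "d \<in> supp_below m"
  shows "trunc m (x + d) = trunc m x + d"
  using trunc_add[of m x d] trunc_id[OF assms] by simp

lemma glue_add:
  fixes d :: "nat \<Rightarrow> 'a::ab_group_add"
  assumes "d \<in> supp_below m"
  shows "glue m (trunc m x + d) ((shift_map ^^ m) x) = x + d"
  using glue_trunc[of m "x + d"] by (simp only: shift_add_supp[OF assms] trunc_add_supp[OF assms])

section \<open>Conditional probabilities of words given the shifted sequence\<close>

context seq_prob
begin

lemma measurable_seqI:
  assumes "\<And>i. \<exists>n g. \<forall>x. T x i = g (trunc n x)"
  shows "T \<in> measurable M M"
proof -
  have "T \<in> measurable M (\<Pi>\<^sub>M i\<in>UNIV. uniform_count_measure (UNIV :: 'a set))"
  proof (rule measurable_PiM_single')
    fix i :: nat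
    obtain n g where T: "\<And>x. T x i = g (trunc n x)" using assms by blast
    show "(\<lambda>x. T x i) \<in> measurable M (uniform_count_measure UNIV)"
    proof (rule measurableI)
      fix A :: "'a set"
      show "(\<lambda>x. T x i) -` A \<inter> space M \<in> sets M"
        using sets_trunc[of "\<lambda>v. g v \<in> A" n] by (simp add: T vimage_def)
    qed (simp add: space_uniform_count_measure)
  qed (simp add: space_uniform_count_measure PiE_def extensional_def)
  then show ?thesis by (simp add: measurable_cong_sets[OF refl sets_PiM])
qed

lemma measurable_glue: "glue m w \<in> measurable M M"
proof (rule measurable_seqI)
  fix i
  show "\<exists>n g. \<forall>x. glue m w x i = g (trunc n x)"
    by (intro exI[of _ "Suc i"] exI[of _ "\<lambda>v. if i < m then w i else v (i - m)"])
       (auto simp: glue_def trunc_def)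
qed

lemma shift_pow_sets: "C \<in> sets M \<Longrightarrow> {x. (shift_map ^^ m) x \<in> C} \<in> sets M"
  using preserves_vimage_sets[OF preserves_funpow[OF preserves_shift]] by (simp add: vimage_def)

lemma cylinder_sets: "C \<in> sets M \<Longrightarrow> {x. trunc m x = w \<and> (shift_map ^^ m) x \<in> C} \<in> sets M"
  using sets.Int[OF sets_trunc[of "\<lambda>v. v = w" m] shift_pow_sets[of C m]] by (simp add: Collect_conj_eq)

text \<open>A Radon-Nikodym density of the \<sigma>^m-image of M restricted to the cylinder of w.
  The fibres of \<sigma>^m are finite, so one density per word replaces a disintegration.\<close>

definition is_cond_prob :: "nat \<Rightarrow> (nat \<Rightarrow> 'a) \<Rightarrow> ((nat \<Rightarrow> 'a) \<Rightarrow> ennreal) \<Rightarrow> bool" where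
  "is_cond_prob m w r \<longleftrightarrow> r \<in> borel_measurable M \<and>
     (\<forall>C\<in>sets M. emeasure M {x. trunc m x = w \<and> (shift_map ^^ m) x \<in> C} = (\<integral>\<^sup>+y. r y * indicator C y \<partial>M))"

lemma ex_cond_prob: "\<exists>r. is_cond_prob m w r"
proof -
  let ?A = "{x. trunc m x = w}"
  define L where "L = distr (density M (indicator ?A)) M (shift_map ^^ m)"
  have A: "?A \<in> sets M" by (rule sets_trunc)
  have S: "shift_map ^^ m \<in> measurable M M"
    using preserves_funpow[OF preserves_shift] by (simp add: preserves_def)
  have L: "emeasure L C = emeasure M {x. trunc m x = w \<and> (shift_map ^^ m) x \<in> C}" if C: "C \<in> sets M" for C
  proof -
    have "emeasure L C = emeasure (density M (indicator ?A)) {x. (shift_map ^^ m) x \<in> C}"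
      using C S by (simp add: L_def emeasure_distr vimage_def)
    also have "\<dots> = (\<integral>\<^sup>+x. indicator ?A x * indicator {x. (shift_map ^^ m) x \<in> C} x \<partial>M)"
      using A shift_pow_sets[OF C] by (intro emeasure_density) auto
    also have "\<dots> = (\<integral>\<^sup>+x. indicator {x. trunc m x = w \<and> (shift_map ^^ m) x \<in> C} x \<partial>M)"
      by (intro nn_integral_cong) (auto simp: indicator_def)
    also have "\<dots> = emeasure M {x. trunc m x = w \<and> (shift_map ^^ m) x \<in> C}"
      using cylinder_sets[OF C] by (rule nn_integral_indicator)
    finally show ?thesis .
  qed
  have "absolutely_continuous M L"
    unfolding absolutely_continuous_def
  proof
    fix C assume C: "C \<in> null_sets M"
    then have Cs: "C \<in> sets M" by auto
    have "(shift_map ^^ m) -` C \<inter> space M \<in> null_sets M"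
    proof (rule null_setsI)
      show "emeasure M ((shift_map ^^ m) -` C \<inter> space M) = 0"
        using C preserves_prob[OF preserves_funpow[OF preserves_shift, of m] Cs]
        by (simp add: emeasure_eq_measure null_sets_def)
      show "(shift_map ^^ m) -` C \<inter> space M \<in> sets M"
        using shift_pow_sets[OF Cs] by (simp add: vimage_def)
    qed
    then have "emeasure M ((shift_map ^^ m) -` C) = 0" by auto
    then have Z: "emeasure M {x. (shift_map ^^ m) x \<in> C} = 0" by (simp add: vimage_def)
    have "emeasure M {x. trunc m x = w \<and> (shift_map ^^ m) x \<in> C} = 0"
      by (rule emeasure_eq_0[OF shift_pow_sets[OF Cs] Z]) auto
    then have "emeasure L C = 0" by (simp only: L[OF Cs])
    then show "C \<in> null_sets L" using Cs by (auto simp: L_def)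
  qed
  moreover have "sets L = sets M" by (simp add: L_def)
  ultimately obtain r where r: "r \<in> borel_measurable M" "density M r = L"
    using Radon_Nikodym[of L] by blast
  have "is_cond_prob m w r"
    unfolding is_cond_prob_def
  proof (intro conjI ballI r(1))
    fix C assume C: "C \<in> sets M"
    show "emeasure M {x. trunc m x = w \<and> (shift_map ^^ m) x \<in> C} = (\<integral>\<^sup>+y. r y * indicator C y \<partial>M)"
      using L[OF C] emeasure_density[OF r(1) C] by (simp only: r(2))
  qed
  then show ?thesis by (intro exI[of _ r])
qed

text \<open>The conditional probability of the word \<open>w\<close> on the coordinates below \<open>m\<close> given \<open>\<sigma>\<^sup>m x = y\<close>.\<close>

definition rn :: "nat \<Rightarrow> (nat \<Rightarrow> 'a) \<Rightarrow> (nat \<Rightarrow> 'a) \<Rightarrow> ennreal" where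
  "rn m w = (SOME r. is_cond_prob m w r)"

lemma is_cond_prob_rn: "is_cond_prob m w (rn m w)"
  unfolding rn_def by (rule someI_ex[OF ex_cond_prob])

lemma measurable_rn [measurable]: "rn m w \<in> borel_measurable M"
  using is_cond_prob_rn by (simp add: is_cond_prob_def)

lemma emeasure_cylinder:
  "C \<in> sets M \<Longrightarrow> emeasure M {x. trunc m x = w \<and> (shift_map ^^ m) x \<in> C} = (\<integral>\<^sup>+y. rn m w y * indicator C y \<partial>M)"
  using is_cond_prob_rn by (simp add: is_cond_prob_def)

lemma rn_sets: "{y. P (rn m w y)} \<in> sets M" if "Measurable.pred borel P"
  using measurable_sets[OF measurable_rn, of "Collect P" m w] that
  by (simp add: vimage_def pred_def)

text \<open>The conditional probability of the point \<open>x + d\<close> in the fibre of \<open>\<sigma>\<^sup>m\<close> through \<open>x\<close>.\<close>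

definition \<phi> :: "nat \<Rightarrow> (nat \<Rightarrow> 'a) \<Rightarrow> (nat \<Rightarrow> 'a) \<Rightarrow> ennreal" where
  "\<phi> m d x = rn m (trunc m x + d) ((shift_map ^^ m) x)"

lemma \<phi>_add: "d \<in> supp_below m \<Longrightarrow> \<phi> m d' (x + d) = \<phi> m (d + d') x"
  by (simp only: \<phi>_def shift_add_supp trunc_add_supp add.assoc)

lemma \<phi>_sets:
  assumes "\<And>w. {y. P (rn m w y)} \<in> sets M"
  shows "{x. P (\<phi> m d x)} \<in> sets M"
proof -
  have "{x. P (\<phi> m d x)} = (\<Union>w\<in>supp_below m. {x. trunc m x = w \<and> (shift_map ^^ m) x \<in> {y. P (rn m (w + d) y)}})"
    by (auto simp: \<phi>_def trunc_supp)
  also have "\<dots> \<in> sets M"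
    using assms by (intro sets.finite_UN finite_supp_below cylinder_sets) auto
  finally show ?thesis .
qed

lemma \<phi>_gt_sets: "{x. q < \<phi> m d x} \<in> sets M"
  by (rule \<phi>_sets) (rule rn_sets, measurable)

lemma \<phi>_0_pos: "AE x in M. 0 < \<phi> m 0 x"
proof -
  have "AE x in M. \<forall>w\<in>supp_below m. \<not> (trunc m x = w \<and> (shift_map ^^ m) x \<in> {y. rn m w y = 0})"
  proof (intro AE_finite_allI finite_supp_below)
    fix w :: "nat \<Rightarrow> 'a"
    have Z: "{y. rn m w y = 0} \<in> sets M" by (rule rn_sets) measurable
    have "emeasure M {x. trunc m x = w \<and> (shift_map ^^ m) x \<in> {y. rn m w y = 0}} = (\<integral>\<^sup>+y. 0 \<partial>M)"
      unfolding emeasure_cylinder[OF Z] by (intro nn_integral_cong) (auto simp: indicator_def)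
    then show "AE x in M. \<not> (trunc m x = w \<and> (shift_map ^^ m) x \<in> {y. rn m w y = 0})"
      using cylinder_sets[OF Z, of m w] by (subst AE_iff_measurable[OF _ refl]) auto
  qed
  then show ?thesis
  proof eventually_elim
    case (elim x)
    then have "rn m (trunc m x) ((shift_map ^^ m) x) \<noteq> 0"
      using trunc_supp[of m x] by blast
    then show ?case by (simp add: \<phi>_def zero_less_iff_neq_zero)
  qed
qed

text \<open>The set of y whose extension by w falls into a null set Z gives zero integral of
  \<open>rn m w\<close>, so \<open>rn m w\<close> vanishes almost everywhere on it. Almost sure
  facts thus transfer to the other points of the fibre that carry mass.\<close>

lemma AE_fibre:
  assumes P: "AE x in M. P x"
  shows "AE x in M. \<forall>d\<in>supp_below m. 0 < \<phi> m d x \<longrightarrow> P (x + d)"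
proof -
  obtain Z where Z: "{x \<in> space M. \<not> P x} \<subseteq> Z" "Z \<in> sets M" "emeasure M Z = 0"
    by (rule AE_E[OF P])
  have "AE y in M. \<forall>w\<in>supp_below m. 0 < rn m w y \<longrightarrow> glue m w y \<notin> Z"
  proof (intro AE_finite_allI finite_supp_below)
    fix w :: "nat \<Rightarrow> 'a" assume w: "w \<in> supp_below m"
    let ?C = "{y. glue m w y \<in> Z}"
    have C: "?C \<in> sets M" using measurable_sets[OF measurable_glue Z(2), of m w] by (simp add: vimage_def)
    have "{x. trunc m x = w \<and> (shift_map ^^ m) x \<in> ?C} \<subseteq> Z"
    proof
      fix x assume "x \<in> {x. trunc m x = w \<and> (shift_map ^^ m) x \<in> ?C}"
      then show "x \<in> Z" using glue_trunc[of m x] by simp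
    qed
    then have "emeasure M {x. trunc m x = w \<and> (shift_map ^^ m) x \<in> ?C} = 0"
      by (rule emeasure_eq_0[OF Z(2,3)])
    then have "(\<integral>\<^sup>+y. rn m w y * indicator ?C y \<partial>M) = 0" by (simp only: emeasure_cylinder[OF C])
    then have "AE y in M. rn m w y * indicator ?C y = 0"
      using C by (subst (asm) nn_integral_0_iff_AE) auto
    then show "AE y in M. 0 < rn m w y \<longrightarrow> glue m w y \<notin> Z"
      by eventually_elim (auto simp: indicator_def split: if_splits)
  qed
  then have "AE x in M. \<forall>w\<in>supp_below m. 0 < rn m w ((shift_map ^^ m) x) \<longrightarrow> glue m w ((shift_map ^^ m) x) \<notin> Z"
    by (rule preserves_AE[OF preserves_funpow[OF preserves_shift]])
  then show ?thesis
  proof eventually_elim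
    case (elim x)
    show ?case
    proof (intro ballI impI)
      fix d assume d: "d \<in> supp_below m" "0 < \<phi> m d x"
      then have "trunc m x + d \<in> supp_below m"
        using subgrp_add[OF subgrp_supp_below trunc_supp] by blast
      then have "glue m (trunc m x + d) ((shift_map ^^ m) x) \<notin> Z"
        using elim d(2) unfolding \<phi>_def by blast
      then have "x + d \<notin> Z" by (simp only: glue_add[OF d(1)] not_False_eq_True)
      then show "P (x + d)" using Z(1) by auto
    qed
  qed
qed

end

section \<open>Transport of conditional probabilities by the automaton\<close>

context CA_measure
begin

lemma inv_F_F: "inv F (F x) = x" and F_inv_F: "F (inv F x) = x"
  using bij_F by (simp_all add: bij_is_inj bij_is_surj surj_f_inv_f)

lemma preserves_inv_F: "preserves (inv F)"
proof (rule preservesI)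
  show meas: "inv F \<in> measurable M M"
  proof (rule measurable_seqI)
    fix i
    show "\<exists>n g. \<forall>x. inv F x i = g (trunc n x)"
      by (intro exI[of _ "Suc (Suc i)"] exI[of _ "\<lambda>v. f' (v i) (v (Suc i))"])
         (simp add: inv_rule trunc_def)
  qed
  fix B assume B: "B \<in> sets M"
  have "inv F -` B \<in> sets M" using measurable_sets[OF meas B] by simp
  then have "prob (F -` (inv F -` B)) = prob (inv F -` B)" by (rule preserves_prob[OF preserves_F])
  then show "prob (inv F -` B) = prob B" by (simp add: vimage_def inv_F_F)
qed

end

locale rigid_CA = CA_measure +
  assumes invariant_N: "\<And>B. B \<in> sets M \<Longrightarrow> AE x in M. (F ^^ N) x \<in> B \<longleftrightarrow> x \<in> B \<Longrightarrow> AE x in M. F x \<in> B \<longleftrightarrow> x \<in> B"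
    and ergodic: "\<And>B. B \<in> sets M \<Longrightarrow> AE x in M. F x \<in> B \<longleftrightarrow> x \<in> B \<Longrightarrow>
      AE x in M. shift_map x \<in> B \<longleftrightarrow> x \<in> B \<Longrightarrow> prob B = 0 \<or> prob B = 1"
    and entropy_pos: "KS_entropy M shift_map > 0"
begin

text \<open>F preserves M and maps the fibre over y bijectively onto the fibre over F y. The image
  word depends on w and also on y, whence the premise; the two densities are compared on the set Q
  of those y where it holds.\<close>

lemma rn_F:
  assumes w: "w \<in> supp_below m"
  shows "AE y in M. trunc m (F (glue m w y)) = v \<longrightarrow> rn m v (F y) = rn m w y"
proof -
  define Q where "Q = {y. trunc m (F (glue m w y)) = v}"
  have F_meas: "F \<in> measurable M M" using preserves_F by (simp add: preserves_def)
  have Q: "Q \<in> sets M"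
    using measurable_sets[OF measurable_comp[OF measurable_glue F_meas] sets_trunc[of "\<lambda>u. u = v" m], of m w]
    by (simp add: Q_def vimage_def)
  have shift_F: "(shift_map ^^ m) (F x) = F ((shift_map ^^ m) x)" for x
    using F_pow_shift_pow[of 1 m x] by simp
  have word: "trunc m (F x) = v \<longleftrightarrow> trunc m x = w" if "(shift_map ^^ m) x \<in> Q" for x
  proof
    assume *: "trunc m (F x) = v"
    let ?x' = "glue m w ((shift_map ^^ m) x)"
    have a: "(shift_map ^^ m) (F ?x') = (shift_map ^^ m) (F x)"
      by (simp only: shift_F shift_glue)
    have b: "trunc m (F ?x') = trunc m (F x)" using that * by (simp add: Q_def)
    have "glue m (trunc m (F ?x')) ((shift_map ^^ m) (F ?x')) = glue m (trunc m (F x)) ((shift_map ^^ m) (F x))"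
      by (simp only: a b)
    then have "F ?x' = F x" by (simp only: glue_trunc)
    then have "?x' = x" using inv_F_F[of ?x'] inv_F_F[of x] by simp
    then show "trunc m x = w" using trunc_glue[OF w, of "(shift_map ^^ m) x"] by simp
  next
    assume "trunc m x = w"
    then have "glue m w ((shift_map ^^ m) x) = x" using glue_trunc[of m x] by simp
    then show "trunc m (F x) = v" using that by (simp add: Q_def)
  qed
  have [measurable]: "(\<lambda>y. rn m v (F y)) \<in> borel_measurable M"
    using measurable_comp[OF F_meas measurable_rn] by (simp add: comp_def)
  have "density M (\<lambda>y. rn m v (F y) * indicator Q y) = density M (\<lambda>y. rn m w y * indicator Q y)"
  proof (rule measure_eqI)
    fix C assume "C \<in> sets (density M (\<lambda>y. rn m v (F y) * indicator Q y))"
    then have C: "C \<in> sets M" by simp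
    let ?D = "Q \<inter> C"
    let ?D' = "inv F -` ?D"
    have D: "?D \<in> sets M" using Q C by auto
    have D': "?D' \<in> sets M" by (rule preserves_vimage_sets[OF preserves_inv_F D])
    have "emeasure (density M (\<lambda>y. rn m v (F y) * indicator Q y)) C = (\<integral>\<^sup>+y. rn m v (F y) * indicator Q y * indicator C y \<partial>M)"
      using Q C by (intro emeasure_density) auto
    also have "\<dots> = (\<integral>\<^sup>+y. rn m v (F y) * indicator ?D' (F y) \<partial>M)"
      by (intro nn_integral_cong) (auto simp: indicator_def inv_F_F)
    also have "\<dots> = (\<integral>\<^sup>+y. rn m v y * indicator ?D' y \<partial>(distr M M F))"
      using D' F_meas by (subst nn_integral_distr) auto
    also have "\<dots> = emeasure M {x. trunc m x = v \<and> (shift_map ^^ m) x \<in> ?D'}"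
      using preserves_F by (simp only: preserves_def emeasure_cylinder[OF D'])
    also have "\<dots> = emeasure M (F -` {x. trunc m x = v \<and> (shift_map ^^ m) x \<in> ?D'})"
      using preserves_prob[OF preserves_F cylinder_sets[OF D']] by (simp add: emeasure_eq_measure)
    also have "F -` {x. trunc m x = v \<and> (shift_map ^^ m) x \<in> ?D'} = {x. trunc m x = w \<and> (shift_map ^^ m) x \<in> ?D}"
      using word by (auto simp: shift_F inv_F_F)
    also have "emeasure M \<dots> = (\<integral>\<^sup>+y. rn m w y * indicator ?D y \<partial>M)"
      by (rule emeasure_cylinder[OF D])
    also have "\<dots> = (\<integral>\<^sup>+y. rn m w y * indicator Q y * indicator C y \<partial>M)"
      by (intro nn_integral_cong) (auto simp: indicator_def)
    also have "\<dots> = emeasure (density M (\<lambda>y. rn m w y * indicator Q y)) C"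
      using Q C by (intro emeasure_density[symmetric]) auto
    finally show "emeasure (density M (\<lambda>y. rn m v (F y) * indicator Q y)) C = emeasure (density M (\<lambda>y. rn m w y * indicator Q y)) C" .
  qed simp
  then have "AE y in M. rn m v (F y) * indicator Q y = rn m w y * indicator Q y"
    using Q by (subst (asm) density_unique_iff) auto
  then show ?thesis
    by eventually_elim (auto simp: Q_def)
qed

lemma \<phi>_F: "AE x in M. \<forall>d\<in>supp_below m. \<phi> m (G d) (F x) = \<phi> m d x"
proof -
  have "AE y in M. \<forall>w\<in>supp_below m. \<forall>v\<in>supp_below m. trunc m (F (glue m w y)) = v \<longrightarrow> rn m v (F y) = rn m w y"
    by (intro AE_finite_allI finite_supp_below rn_F)
  then have "AE x in M. \<forall>w\<in>supp_below m. \<forall>v\<in>supp_below m.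
      trunc m (F (glue m w ((shift_map ^^ m) x))) = v \<longrightarrow> rn m v (F ((shift_map ^^ m) x)) = rn m w ((shift_map ^^ m) x)"
    by (rule preserves_AE[OF preserves_funpow[OF preserves_shift]])
  then show ?thesis
  proof eventually_elim
    case (elim x)
    show ?case
    proof
      fix d :: "nat \<Rightarrow> 'a" assume d: "d \<in> supp_below m"
      then have Gd: "G d \<in> supp_below m" using G_pow_supp[of d m 1] by simp
      have w: "trunc m x + d \<in> supp_below m"
        using subgrp_add[OF subgrp_supp_below trunc_supp d] .
      have "trunc m (F (glue m (trunc m x + d) ((shift_map ^^ m) x))) = trunc m (F x) + G d"
        by (simp only: glue_add[OF d] F_add trunc_add_supp[OF Gd])
      moreover have "trunc m (F x) + G d \<in> supp_below m"
        using subgrp_add[OF subgrp_supp_below trunc_supp Gd] .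
      ultimately have "rn m (trunc m (F x) + G d) (F ((shift_map ^^ m) x)) = rn m (trunc m x + d) ((shift_map ^^ m) x)"
        using elim w by blast
      then show "\<phi> m (G d) (F x) = \<phi> m d x"
        using F_pow_shift_pow[of 1 m x] by (simp add: \<phi>_def)
    qed
  qed
qed

lemma \<phi>_F_pow: "AE x in M. \<forall>d\<in>supp_below m. \<phi> m ((G ^^ k) d) ((F ^^ k) x) = \<phi> m d x"
proof (induction k)
  case (Suc k)
  have "AE x in M. \<forall>d\<in>supp_below m. \<phi> m (G d) (F ((F ^^ k) x)) = \<phi> m d ((F ^^ k) x)"
    by (rule preserves_AE[OF preserves_funpow[OF preserves_F] \<phi>_F])
  then show ?case using Suc
    by eventually_elim (simp add: G_pow_supp)
qed simp

text \<open>G^(N p^m) fixes d, so \<open>\<phi>\<close> at d is invariant under the same power of F,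
  and hypothesis 2, extended to N p^m, lowers the power to 1. Level sets appear because that
  hypothesis concerns sets.\<close>

lemma \<phi>_level_invariant:
  assumes d: "d \<in> supp_below m"
  shows "AE x in M. q < \<phi> m d (F x) \<longleftrightarrow> q < \<phi> m d x"
proof -
  have supp: "d \<in> supp_below (Suc m)" using d by (simp add: supp_below_def)
  have "AE x in M. (F ^^ (N * p ^ m)) x \<in> {x. q < \<phi> m d x} \<longleftrightarrow> x \<in> {x. q < \<phi> m d x}"
    using \<phi>_F_pow[of m "N * p ^ m"]
  proof eventually_elim
    case (elim x)
    then have "\<phi> m d ((F ^^ (N * p ^ m)) x) = \<phi> m d x"
      using d G_pow_periodic[OF supp] by metis
    then show ?case by simp
  qed
  then have "AE x in M. F x \<in> {x. q < \<phi> m d x} \<longleftrightarrow> x \<in> {x. q < \<phi> m d x}"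
    using p_gt_1 by (intro invariant_sets_power[OF preserves_F p_dvd_N N_pos _ invariant_N \<phi>_gt_sets]) auto
  then show ?thesis by simp
qed

lemma eq_if_rat_levels:
  fixes a b :: ennreal
  assumes "\<And>q :: rat. ennreal (of_rat q) < a \<longleftrightarrow> ennreal (of_rat q) < b"
  shows "a = b"
proof (rule ccontr)
  assume "a \<noteq> b"
  then have "a < b \<or> b < a" by auto
  then show False using ennreal_rat_dense assms by (metis order_less_asym)
qed

lemma \<phi>_invariant: "AE x in M. \<forall>d\<in>supp_below m. \<phi> m d (F x) = \<phi> m d x"
proof (intro AE_finite_allI finite_supp_below)
  fix d :: "nat \<Rightarrow> 'a" assume d: "d \<in> supp_below m"
  have "AE x in M. \<forall>q :: rat. ennreal (of_rat q) < \<phi> m d (F x) \<longleftrightarrow> ennreal (of_rat q) < \<phi> m d x"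
    unfolding AE_all_countable using \<phi>_level_invariant[OF d] by blast
  then show "AE x in M. \<phi> m d (F x) = \<phi> m d x"
    by eventually_elim (blast intro: eq_if_rat_levels)
qed

text \<open>Rational level sets of \<open>\<phi>\<close> are preimages under \<sigma>^m off a null
  set. \<open>AE_fibre\<close> makes x + d avoid that null set as well, and \<sigma>^m agrees at x
  and x + d.\<close>

lemma \<phi>_fibre_constant:
  "AE x in M. \<forall>d\<in>supp_below m. 0 < \<phi> m d x \<longrightarrow> (\<forall>d'\<in>supp_below m. \<phi> m (d + d') x = \<phi> m d' x)"
proof -
  have "\<exists>C\<in>sets M. AE x in M. q < \<phi> m d x \<longleftrightarrow> (shift_map ^^ m) x \<in> C" if d: "d \<in> supp_below m" for d q
    using invariant_set_shift_pow_measurable[OF \<phi>_gt_sets[of q m d], of m] \<phi>_level_invariant[OF d] by auto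
  then have "\<forall>z. \<exists>C. fst z \<in> supp_below m \<longrightarrow> (AE x in M. snd z < \<phi> m (fst z) x \<longleftrightarrow> (shift_map ^^ m) x \<in> C)"
    by blast
  from choice[OF this] obtain C0 where C0:
    "\<And>z. fst z \<in> supp_below m \<Longrightarrow> AE x in M. snd z < \<phi> m (fst z) x \<longleftrightarrow> (shift_map ^^ m) x \<in> C0 z"
    by blast
  define C where "C d q = C0 (d, q)" for d q
  have C: "AE x in M. q < \<phi> m d x \<longleftrightarrow> (shift_map ^^ m) x \<in> C d q" if "d \<in> supp_below m" for d q
    using C0[of "(d, q)"] that by (simp add: C_def)
  define P where "P x = (\<forall>d\<in>supp_below m. \<forall>q :: rat. ennreal (of_rat q) < \<phi> m d x \<longleftrightarrow> (shift_map ^^ m) x \<in> C d (ennreal (of_rat q)))" for x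
  have P: "AE x in M. P x"
    unfolding P_def
  proof (intro AE_finite_allI finite_supp_below)
    fix d :: "nat \<Rightarrow> 'a" assume "d \<in> supp_below m"
    then show "AE x in M. \<forall>q :: rat. ennreal (of_rat q) < \<phi> m d x \<longleftrightarrow> (shift_map ^^ m) x \<in> C d (ennreal (of_rat q))"
      unfolding AE_all_countable using C by blast
  qed
  show ?thesis
    using P AE_fibre[OF P, of m]
  proof eventually_elim
    case (elim x)
    show ?case
    proof (intro ballI impI)
      fix d d' :: "nat \<Rightarrow> 'a" assume d: "d \<in> supp_below m" "0 < \<phi> m d x" and d': "d' \<in> supp_below m"
      then have "P (x + d)" using elim by blast
      then have "\<phi> m d' (x + d) = \<phi> m d' x"
        using elim(1) d' shift_add_supp[OF d(1), of x] unfolding P_def by (intro eq_if_rat_levels) metis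
      then show "\<phi> m (d + d') x = \<phi> m d' x" by (simp only: \<phi>_add[OF d(1)])
    qed
  qed
qed

section \<open>The support group of a conditional measure\<close>

definition V :: "nat \<Rightarrow> (nat \<Rightarrow> 'a) \<Rightarrow> (nat \<Rightarrow> 'a) set" where
  "V m x = {d \<in> supp_below m. 0 < \<phi> m d x}"

lemma finite_V: "finite (V m x)"
  by (rule finite_subset[OF _ finite_supp_below]) (auto simp: V_def)

text \<open>Fibre constancy gives \<phi>(d + d') = \<phi>(d') for d in the support: closure under
  addition, and uniformity by taking d' = 0. Stability under G combines the transport \<phi>(G d) at
  F x = \<phi>(d) at x with F-invariance of \<phi>(G d).\<close>

lemma V_properties:
  "AE x in M. subgrp (V m x) \<and> G ` V m x \<subseteq> V m x \<and> (\<forall>d\<in>V m x. \<phi> m d x = \<phi> m 0 x)"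
  using \<phi>_fibre_constant[of m] \<phi>_0_pos[of m] \<phi>_invariant[of m] \<phi>_F[of m]
proof eventually_elim
  case (elim x)
  have zero: "(0 :: nat \<Rightarrow> 'a) \<in> supp_below m" by (rule subgrp_zero[OF subgrp_supp_below])
  have "subgrp (V m x)"
  proof (rule subgrp_finiteI[OF finite_V])
    show "0 \<in> V m x" using elim(2) zero by (simp add: V_def)
    fix d d' assume "d \<in> V m x" "d' \<in> V m x"
    then show "d + d' \<in> V m x"
      using elim(1) subgrp_add[OF subgrp_supp_below, of d m d'] by (simp add: V_def)
  qed
  moreover have "G d \<in> V m x" if "d \<in> V m x" for d
  proof -
    have d: "d \<in> supp_below m" "0 < \<phi> m d x" using that by (auto simp: V_def)
    then have "G d \<in> supp_below m" using G_pow_supp[of d m 1] by simp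
    moreover have "\<phi> m (G d) x = \<phi> m d x" using elim(3,4) d calculation by metis
    ultimately show ?thesis using d by (simp add: V_def)
  qed
  moreover have "\<phi> m d x = \<phi> m 0 x" if "d \<in> V m x" for d
  proof -
    have "d \<in> supp_below m" "0 < \<phi> m d x" using that by (auto simp: V_def)
    then have "\<phi> m (d + 0) x = \<phi> m 0 x" using elim(1) zero by blast
    then show ?thesis by (simp only: add_0_right)
  qed
  ultimately show ?case by blast
qed

text \<open>The y given which, as the value of \<sigma>^m x, all initial words of length k are
  equally likely.\<close>

definition balanced :: "nat \<Rightarrow> nat \<Rightarrow> (nat \<Rightarrow> 'a) set" where
  "balanced k m = {y. \<forall>u\<in>supp_below k. \<forall>u'\<in>supp_below k.
     (\<Sum>w\<in>{w \<in> supp_below m. trunc k w = u}. rn m w y) = (\<Sum>w\<in>{w \<in> supp_below m. trunc k w = u'}. rn m w y)}"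

lemma balanced_sets: "balanced k m \<in> sets M"
proof -
  have "{y \<in> space M. (\<Sum>w\<in>A. rn m w y) = (\<Sum>w\<in>B. rn m w y)} \<in> sets M" for A B
    by measurable
  then have "{y \<in> space M. \<forall>u\<in>supp_below k. \<forall>u'\<in>supp_below k.
     (\<Sum>w\<in>{w \<in> supp_below m. trunc k w = u}. rn m w y) = (\<Sum>w\<in>{w \<in> supp_below m. trunc k w = u'}. rn m w y)} \<in> sets M"
    by (intro sets.sets_Collect_finite_All finite_supp_below)
  then show ?thesis by (simp add: balanced_def)
qed

text \<open>V projects onto all words of length k, so the points of x + V over any such word form
  one coset of the same kernel: equally many points, all of equal probability.\<close>

lemma balanced_if_large:
  assumes V: "subgrp (V m x)" "G ` V m x \<subseteq> V m x" "\<And>d. d \<in> V m x \<Longrightarrow> \<phi> m d x = \<phi> m 0 x"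
    and large: "p ^ (2 * k) \<le> card (V m x)" and km: "k \<le> m"
  shows "(shift_map ^^ m) x \<in> balanced k m"
proof -
  have onto: "trunc k ` V m x = supp_below k"
    by (rule stable_group_onto[OF V(1) finite_V V(2) large])
  have tt: "trunc k (trunc m z) = trunc k z" for z :: "nat \<Rightarrow> 'a"
    using km by (auto simp: trunc_def fun_eq_iff)
  have "(\<Sum>w\<in>{w \<in> supp_below m. trunc k w = u}. rn m w ((shift_map ^^ m) x)) = of_nat (card {d \<in> V m x. trunc k d = 0}) * \<phi> m 0 x"
    if u: "u \<in> supp_below k" for u
  proof -
    let ?D = "{d \<in> supp_below m. trunc k (x + d) = u}"
    have "bij_betw (\<lambda>d. trunc m x + d) ?D {w \<in> supp_below m. trunc k w = u}"
    proof (rule bij_betw_byWitness[where f' = "\<lambda>w. w - trunc m x"])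
      show "(\<lambda>d. trunc m x + d) ` ?D \<subseteq> {w \<in> supp_below m. trunc k w = u}"
        using subgrp_add[OF subgrp_supp_below trunc_supp[of m x]] by (auto simp del: plus_fun_apply simp: trunc_add tt)
      show "(\<lambda>w. w - trunc m x) ` {w \<in> supp_below m. trunc k w = u} \<subseteq> ?D"
        using subgrp_diff[OF subgrp_supp_below _ trunc_supp[of m x]] by (auto simp: trunc_add trunc_diff tt)
    qed auto
    then have "(\<Sum>w\<in>{w \<in> supp_below m. trunc k w = u}. rn m w ((shift_map ^^ m) x)) = (\<Sum>d\<in>?D. \<phi> m d x)"
      unfolding \<phi>_def by (rule sum.reindex_bij_betw[symmetric])
    also have "\<dots> = (\<Sum>d\<in>{d \<in> V m x. trunc k (x + d) = u}. \<phi> m d x)"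
      using finite_supp_below[where 'a = 'a and m = m] by (intro sum.mono_neutral_right) (auto simp: V_def zero_less_iff_neq_zero)
    also have "\<dots> = (\<Sum>d\<in>{d \<in> V m x. trunc k (x + d) = u}. \<phi> m 0 x)"
      using V(3) by (intro sum.cong) auto
    also have "\<dots> = of_nat (card {d \<in> V m x. trunc k (x + d) = u}) * \<phi> m 0 x" by simp
    also have "card {d \<in> V m x. trunc k (x + d) = u} = card {d \<in> V m x. trunc k d = 0}"
    proof -
      have "u - trunc k x \<in> trunc k ` V m x"
        unfolding onto using subgrp_diff[OF subgrp_supp_below u trunc_supp] .
      then obtain e where e: "e \<in> V m x" "trunc k e = u - trunc k x" by (metis imageE)
      have "bij_betw (\<lambda>d. e + d) {d \<in> V m x. trunc k d = 0} {d \<in> V m x. trunc k (x + d) = u}"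
      proof (rule bij_betw_byWitness[where f' = "\<lambda>d. d - e"])
        show "(\<lambda>d. e + d) ` {d \<in> V m x. trunc k d = 0} \<subseteq> {d \<in> V m x. trunc k (x + d) = u}"
          using subgrp_add[OF V(1) e(1)] by (auto simp: trunc_add e(2))
        show "(\<lambda>d. d - e) ` {d \<in> V m x. trunc k (x + d) = u} \<subseteq> {d \<in> V m x. trunc k d = 0}"
          using subgrp_diff[OF V(1) _ e(1)] by (auto simp: trunc_add trunc_diff e(2))
      qed auto
      then show ?thesis by (rule bij_betw_same_card[symmetric])
    qed
    finally show ?thesis .
  qed
  then show ?thesis by (simp add: balanced_def)
qed

lemma prob_balanced:
  assumes u: "u \<in> supp_below k" "u' \<in> supp_below k" and km: "k \<le> m"
  shows "emeasure M {x. trunc k x = u \<and> (shift_map ^^ m) x \<in> balanced k m} =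
    emeasure M {x. trunc k x = u' \<and> (shift_map ^^ m) x \<in> balanced k m}"
proof -
  note E = balanced_sets[of k m]
  have eq: "emeasure M {x. trunc k x = v \<and> (shift_map ^^ m) x \<in> balanced k m} =
      (\<integral>\<^sup>+y. (\<Sum>w\<in>{w \<in> supp_below m. trunc k w = v}. rn m w y) * indicator (balanced k m) y \<partial>M)" for v
  proof -
    let ?W = "{w \<in> supp_below m. trunc k w = v}"
    have fin: "finite ?W" using finite_supp_below[where 'a = 'a and m = m] by simp
    have tt: "trunc k (trunc m z) = trunc k z" for z :: "nat \<Rightarrow> 'a"
      using km by (auto simp: trunc_def fun_eq_iff)
    have split: "{x. trunc k x = v \<and> (shift_map ^^ m) x \<in> balanced k m} =
        (\<Union>w\<in>?W. {x. trunc m x = w \<and> (shift_map ^^ m) x \<in> balanced k m})"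
      using trunc_supp[of m] tt by auto
    have "emeasure M {x. trunc k x = v \<and> (shift_map ^^ m) x \<in> balanced k m} =
        emeasure M (\<Union>w\<in>?W. {x. trunc m x = w \<and> (shift_map ^^ m) x \<in> balanced k m})"
      by (simp only: split)
    also have "\<dots> = (\<Sum>w\<in>?W. emeasure M {x. trunc m x = w \<and> (shift_map ^^ m) x \<in> balanced k m})"
      using fin cylinder_sets[OF E, of m] by (intro sum_emeasure[symmetric]) (auto simp: disjoint_family_on_def)
    also have "\<dots> = (\<Sum>w\<in>?W. \<integral>\<^sup>+y. rn m w y * indicator (balanced k m) y \<partial>M)"
      by (rule sum.cong[OF refl]) (rule emeasure_cylinder[OF E])
    also have "\<dots> = (\<integral>\<^sup>+y. (\<Sum>w\<in>?W. rn m w y * indicator (balanced k m) y) \<partial>M)"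
      by (rule nn_integral_sum[symmetric]) (intro borel_measurable_times_ennreal measurable_rn borel_measurable_indicator E)
    finally show ?thesis by (simp only: sum_distrib_right)
  qed
  show ?thesis unfolding eq
  proof (rule nn_integral_cong)
    fix y
    show "(\<Sum>w\<in>{w \<in> supp_below m. trunc k w = u}. rn m w y) * indicator (balanced k m) y =
        (\<Sum>w\<in>{w \<in> supp_below m. trunc k w = u'}. rn m w y) * indicator (balanced k m) y"
    proof (cases "y \<in> balanced k m")
      case True
      then have "(\<Sum>w\<in>{w \<in> supp_below m. trunc k w = u}. rn m w y) =
          (\<Sum>w\<in>{w \<in> supp_below m. trunc k w = u'}. rn m w y)"
        unfolding balanced_def using u by blast
      then show ?thesis by (simp only:)
    qed simp
  qed
qed

section \<open>Growth of the support group\<close>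

definition branching :: "(nat \<Rightarrow> 'a) set" where
  "branching = {x. \<exists>d\<in>supp_below 1. d \<noteq> 0 \<and> 0 < \<phi> 1 d x}"

lemma branching_sets: "branching \<in> sets M"
proof -
  have "branching = (\<Union>d\<in>{d \<in> supp_below 1. d \<noteq> 0}. {x. 0 < \<phi> 1 d x})"
    by (auto simp: branching_def)
  then show ?thesis using finite_supp_below[where 'a = 'a and m = 1] \<phi>_gt_sets by (auto intro!: sets.finite_UN)
qed

text \<open>Without branching the first letter is almost surely a function of \<sigma> x, which
  forces entropy zero.\<close>

lemma branching_pos: "0 < prob branching"
proof (rule ccontr)
  assume "\<not> 0 < prob branching"
  then have "prob branching = 0" using measure_nonneg[of M branching] by linarith
  then have null: "AE x in M. x \<notin> branching"
    using prob_eq_0[OF branching_sets] by simp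
  have "KS_entropy M shift_map \<le> 0"
  proof (rule KS_entropy_nonpos_if_determined)
    fix w :: "nat \<Rightarrow> 'a" assume w: "w \<in> supp_below 1"
    show "{y. 0 < rn 1 w y} \<in> sets M" by (rule rn_sets) measurable
    show "AE x in M. trunc 1 x = w \<longleftrightarrow> shift_map x \<in> {y. 0 < rn 1 w y}"
      using null \<phi>_0_pos[of 1]
    proof eventually_elim
      case (elim x)
      show ?case
      proof
        assume "trunc 1 x = w"
        then show "shift_map x \<in> {y. 0 < rn 1 w y}" using elim(2) by (simp add: \<phi>_def)
      next
        assume "shift_map x \<in> {y. 0 < rn 1 w y}"
        moreover have "trunc 1 x + (w - trunc 1 x) = w" by simp
        ultimately have "0 < \<phi> 1 (w - trunc 1 x) x" by (simp only: \<phi>_def) simp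
        moreover have "w - trunc 1 x \<in> supp_below 1"
          using subgrp_diff[OF subgrp_supp_below w trunc_supp] .
        ultimately have "w - trunc 1 x = 0" using elim(1) by (auto simp only: branching_def)
        then show "trunc 1 x = w" by simp
      qed
    qed
  qed
  then show False using entropy_pos by simp
qed

text \<open>The limit superior of the visiting events has at least the measure of
  \<open>branching\<close>. It is F-invariant because \<open>\<phi>\<close> is, and
  \<sigma>-invariant because it ignores finitely many times, so joint ergodicity gives it full
  measure.\<close>

lemma infinitely_often_branching: "AE x in M. \<exists>\<^sub>\<infinity>i. (shift_map ^^ i) x \<in> branching"
proof -
  define A where "A n = (\<Union>i\<in>{n..}. {x. (shift_map ^^ i) x \<in> branching})" for n
  have A: "A n \<in> sets M" for n
    using shift_pow_sets[OF branching_sets] by (auto simp: A_def)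
  define W where "W = (\<Inter>n. A n)"
  have W: "W \<in> sets M" using A by (auto simp: W_def)
  have W_iff: "x \<in> W \<longleftrightarrow> (\<exists>\<^sub>\<infinity>i. (shift_map ^^ i) x \<in> branching)" for x
    by (auto simp: W_def A_def INFM_nat_le)
  have "decseq A"
    unfolding decseq_def A_def by (intro allI impI UN_mono) auto
  then have "(\<lambda>n. prob (A n)) \<longlonglongrightarrow> prob (\<Inter>n. A n)"
    using A by (intro finite_Lim_measure_decseq) auto
  moreover have "prob branching \<le> prob (A n)" for n
  proof -
    have "prob branching = prob {x. (shift_map ^^ n) x \<in> branching}"
      using preserves_prob[OF preserves_funpow[OF preserves_shift, of n] branching_sets] by (simp add: vimage_def)
    also have "\<dots> \<le> prob (A n)" using A by (intro finite_measure_mono) (auto simp: A_def)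
    finally show ?thesis .
  qed
  ultimately have "prob branching \<le> prob W"
    unfolding W_def by (intro LIMSEQ_le_const) auto
  then have "prob W \<noteq> 0" using branching_pos by simp
  moreover have "prob W = 0 \<or> prob W = 1"
  proof (rule ergodic[OF W])
    have F: "AE x in M. F x \<in> branching \<longleftrightarrow> x \<in> branching"
      using \<phi>_invariant[of 1] by eventually_elim (auto simp: branching_def)
    have "AE x in M. \<forall>i. F ((shift_map ^^ i) x) \<in> branching \<longleftrightarrow> (shift_map ^^ i) x \<in> branching"
      unfolding AE_all_countable using preserves_AE[OF preserves_funpow[OF preserves_shift] F] by blast
    then show "AE x in M. F x \<in> W \<longleftrightarrow> x \<in> W"
      by eventually_elim (simp add: W_iff F_pow_shift_pow[of 1, simplified])
    have "shift_map x \<in> W \<longleftrightarrow> x \<in> W" for x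
    proof -
      have "(\<exists>\<^sub>\<infinity>i. (shift_map ^^ Suc i) x \<in> branching) \<longleftrightarrow> (\<exists>\<^sub>\<infinity>i. (shift_map ^^ i) x \<in> branching)"
      proof
        assume *: "\<exists>\<^sub>\<infinity>i. (shift_map ^^ Suc i) x \<in> branching"
        show "\<exists>\<^sub>\<infinity>i. (shift_map ^^ i) x \<in> branching"
          unfolding INFM_nat_le
        proof
          fix n
          obtain i where "i \<ge> n" "(shift_map ^^ Suc i) x \<in> branching" using * unfolding INFM_nat_le by blast
          then show "\<exists>i\<ge>n. (shift_map ^^ i) x \<in> branching" by (intro exI[of _ "Suc i"]) simp
        qed
      next
        assume *: "\<exists>\<^sub>\<infinity>i. (shift_map ^^ i) x \<in> branching"
        show "\<exists>\<^sub>\<infinity>i. (shift_map ^^ Suc i) x \<in> branching"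
          unfolding INFM_nat_le
        proof
          fix n
          obtain i where "i \<ge> Suc n" "(shift_map ^^ i) x \<in> branching" using * unfolding INFM_nat_le by blast
          then show "\<exists>i\<ge>n. (shift_map ^^ Suc i) x \<in> branching" by (cases i) auto
        qed
      qed
      then show ?thesis unfolding W_iff by (simp add: funpow_swap1)
    qed
    then show "AE x in M. shift_map x \<in> W \<longleftrightarrow> x \<in> W" by simp
  qed
  ultimately have "prob W = 1" by blast
  then have "AE x in M. x \<in> W" using W by (simp add: prob_eq_1)
  then show ?thesis by (simp add: W_iff)
qed

text \<open>By \<open>AE_fibre\<close> the point x + d is typical for \<sigma>^(m + 1) too, so its
  own conditional probability there is positive; seen from x this is the probability of d.\<close>

lemma V_mono: "AE x in M. V m x \<subseteq> V (Suc m) x"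
  using AE_fibre[OF \<phi>_0_pos[of "Suc m"], of m]
proof eventually_elim
  case (elim x)
  show ?case
  proof
    fix d assume "d \<in> V m x"
    then have d: "d \<in> supp_below m" "0 < \<phi> (Suc m) 0 (x + d)" using elim by (auto simp: V_def)
    then have "d \<in> supp_below (Suc m)" by (simp add: supp_below_def)
    then show "d \<in> V (Suc m) x" using d(2) \<phi>_add[of d "Suc m" 0 x] by (simp add: V_def)
  qed
qed

lemma V_branching: "AE x in M. (shift_map ^^ m) x \<in> branching \<longrightarrow> (\<exists>d\<in>V (Suc m) x. d \<notin> supp_below m)"
proof -
  \<comment> \<open>The y above which some word of length m gives positive conditional mass at level
    m + 1. Almost every y is of this kind, so \<open>AE_fibre\<close> covers \<sigma>^m x + e as
    well.\<close>
  define Good where "Good = {y. \<exists>w\<in>supp_below m. 0 < \<phi> (Suc m) 0 (glue m w y)}"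
  have "Good = (\<Union>w\<in>supp_below m. glue m w -` {x. 0 < \<phi> (Suc m) 0 x} \<inter> space M)"
    by (auto simp: Good_def)
  then have Good: "Good \<in> sets M"
    using measurable_sets[OF measurable_glue \<phi>_gt_sets] finite_supp_below[where 'a = 'a and m = m] by auto
  have "AE x in M. (shift_map ^^ m) x \<in> Good"
    using \<phi>_0_pos[of "Suc m"]
  proof eventually_elim
    case (elim x)
    then have "0 < \<phi> (Suc m) 0 (glue m (trunc m x) ((shift_map ^^ m) x))" by (simp only: glue_trunc)
    then show ?case using trunc_supp[of m x] by (auto simp: Good_def)
  qed
  then have "AE y in distr M M (shift_map ^^ m). y \<in> Good"
    using Good preserves_funpow[OF preserves_shift, of m] by (subst AE_distr_iff) (auto simp: preserves_def)
  then have "AE y in M. y \<in> Good"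
    using preserves_funpow[OF preserves_shift, of m] unfolding preserves_def by metis
  from preserves_AE[OF preserves_funpow[OF preserves_shift, of m] AE_fibre[OF this, of 1]]
  show ?thesis
  proof eventually_elim
    case (elim x)
    show ?case
    proof
      assume "(shift_map ^^ m) x \<in> branching"
      then obtain e where e: "e \<in> supp_below 1" "e \<noteq> 0" "0 < \<phi> 1 e ((shift_map ^^ m) x)"
        by (auto simp: branching_def)
      then obtain w where w: "w \<in> supp_below m" "0 < \<phi> (Suc m) 0 (glue m w ((shift_map ^^ m) x + e))"
        using elim unfolding Good_def by blast
      \<comment> \<open>The difference between x and a sequence with changed tail \<sigma>^m x + e:
        its entry at m is e 0, which is nonzero.\<close>
      define d where "d = glue m w ((shift_map ^^ m) x + e) - x"
      have shift_d: "(shift_map ^^ m) d = e"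
        by (auto simp: d_def shift_pow glue_def fun_eq_iff)
      then have "d \<notin> supp_below m" using e(2) by (simp add: supp_below_iff_shift)
      moreover have d: "d \<in> supp_below (Suc m)"
      proof -
        have "d i = 0" if "i \<ge> Suc m" for i
        proof -
          have "d i = (shift_map ^^ m) d (i - m)" using that by (simp add: shift_pow)
          then show ?thesis using e(1) that by (simp add: shift_d supp_below_def)
        qed
        then show ?thesis by (simp add: supp_below_def)
      qed
      moreover have "0 < \<phi> (Suc m) d x"
        using \<phi>_add[OF d, of 0 x] w(2) by (simp add: d_def)
      ultimately show "\<exists>d\<in>V (Suc m) x. d \<notin> supp_below m" by (auto simp: V_def)
    qed
  qed
qed

text \<open>Each visit to \<open>branching\<close> at time i makes V (Suc i) x strictly larger than
  V i x, and nothing is lost in between.\<close>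

lemma card_V_unbounded: "AE x in M. \<exists>m0. \<forall>m\<ge>m0. K \<le> card (V m x)"
proof -
  have "AE x in M. \<forall>m. V m x \<subseteq> V (Suc m) x" "AE x in M. \<forall>m. subgrp (V m x)"
    "AE x in M. \<forall>m. (shift_map ^^ m) x \<in> branching \<longrightarrow> (\<exists>d\<in>V (Suc m) x. d \<notin> supp_below m)"
    unfolding AE_all_countable using V_mono V_branching V_properties by (auto elim: AE_mp)
  then show ?thesis
    using infinitely_often_branching
  proof eventually_elim
    case (elim x)
    have mono: "V m x \<subseteq> V n x" if "m \<le> n" for m n
      using that by (induction n rule: dec_induct) (use elim(1) in auto)
    have card_mono: "card (V m x) \<le> card (V n x)" if "m \<le> n" for m n
      by (rule card_mono[OF finite_V mono[OF that]])
    have "\<exists>m. K \<le> card (V m x)"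
    proof (induction K)
      case (Suc K)
      then obtain m where m: "K \<le> card (V m x)" by blast
      obtain i where i: "i \<ge> m" "(shift_map ^^ i) x \<in> branching"
        using elim(4) by (auto simp: INFM_nat_le)
      then obtain d where d: "d \<in> V (Suc i) x" "d \<notin> supp_below i" using elim(3) by blast
      have "V i x \<subset> V (Suc i) x" using mono[of i "Suc i"] d by (auto simp: V_def)
      then have "card (V i x) < card (V (Suc i) x)" by (rule psubset_card_mono[OF finite_V])
      then show ?case using m card_mono[OF i(1)] by (intro exI[of _ "Suc i"]) linarith
    qed simp
    then show ?case using card_mono by (meson order_trans)
  qed
qed

section \<open>Cylinder probabilities and the uniform measure\<close>

lemma prob_cylinder_eq:
  assumes u: "u \<in> supp_below k" "u' \<in> supp_below k"
  shows "prob {x. trunc k x = u} = prob {x. trunc k x = u'}"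
proof -
  define A where "A m = {x. (shift_map ^^ m) x \<notin> balanced k m}" for m
  have A: "A m \<in> sets M" for m
  proof -
    have "A m = space M - {x. (shift_map ^^ m) x \<in> balanced k m}" by (auto simp: A_def)
    then show ?thesis using sets.compl_sets[OF shift_pow_sets[OF balanced_sets[of k m], of m]] by simp
  qed
  have "AE x in M. \<forall>m. subgrp (V m x) \<and> G ` V m x \<subseteq> V m x \<and> (\<forall>d\<in>V m x. \<phi> m d x = \<phi> m 0 x)"
    unfolding AE_all_countable using V_properties by blast
  then have ev: "AE x in M. \<exists>m0. \<forall>m\<ge>m0. x \<notin> A m"
    using card_V_unbounded[of "p ^ (2 * k)"]
  proof eventually_elim
    case (elim x)
    then obtain m0 where m0: "\<And>m. m \<ge> m0 \<Longrightarrow> p ^ (2 * k) \<le> card (V m x)" by blast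
    have "x \<notin> A m" if "m \<ge> max m0 k" for m
      using balanced_if_large[of m x k] elim(1) m0[of m] that by (simp add: A_def)
    then show ?case by blast
  qed
  \<comment> \<open>The sets A m need not decrease in m; their tail unions do, and their
    intersection is null because almost every x is eventually outside A m.\<close>
  define U where "U n = (\<Union>m\<in>{n..}. A m)" for n
  have U: "U n \<in> sets M" for n using A by (auto simp: U_def)
  have "decseq U"
    unfolding decseq_def U_def by (intro allI impI UN_mono) auto
  then have "(\<lambda>n. prob (U n)) \<longlonglongrightarrow> prob (\<Inter>n. U n)"
    using U by (intro finite_Lim_measure_decseq) auto
  moreover have "prob (\<Inter>n. U n) = 0"
  proof (subst prob_eq_0)
    show "(\<Inter>n. U n) \<in> sets M" using U by auto
    show "AE x in M. x \<notin> (\<Inter>n. U n)" using ev by eventually_elim (auto simp: U_def)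
  qed
  ultimately have U0: "(\<lambda>n. prob (U n)) \<longlonglongrightarrow> 0" by simp
  have bound: "\<bar>prob {x. trunc k x = u} - prob {x. trunc k x = u'}\<bar> \<le> prob (U m)" if km: "k \<le> m" for m
  proof -
    let ?E = "\<lambda>v. {x. trunc k x = v \<and> (shift_map ^^ m) x \<in> balanced k m}"
    have E: "?E v \<in> sets M" for v
      using sets.Int[OF sets_trunc[of "\<lambda>w. w = v" k] shift_pow_sets[OF balanced_sets[of k m], of m]]
      by (simp add: Collect_conj_eq)
    have same: "prob (?E u) = prob (?E u')"
      using prob_balanced[OF u km] by (simp add: emeasure_eq_measure)
    have lower: "prob (?E v) \<le> prob {x. trunc k x = v}" for v
      by (intro finite_measure_mono sets_trunc) auto
    have upper: "prob {x. trunc k x = v} \<le> prob (?E v) + prob (U m)" for v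
    proof -
      have "prob {x. trunc k x = v} \<le> prob (?E v \<union> U m)"
        using E U by (intro finite_measure_mono) (auto simp: U_def A_def)
      also have "\<dots> \<le> prob (?E v) + prob (U m)" using E U by (intro measure_Un_le)
      finally show ?thesis .
    qed
    show ?thesis
      using same lower[of u] lower[of u'] upper[of u] upper[of u'] by (intro abs_leI) linarith+
  qed
  have "\<bar>prob {x. trunc k x = u} - prob {x. trunc k x = u'}\<bar> \<le> 0"
    using U0 by (rule LIMSEQ_le_const) (use bound in blast)
  then show ?thesis by simp
qed

lemma prob_cylinder:
  assumes u: "u \<in> supp_below k"
  shows "prob {x. trunc k x = u} = (1 / CARD('a)) ^ k"
proof -
  have "1 = prob (\<Union>v\<in>supp_below k. {x. trunc k x = v})"
  proof -
    have "(\<Union>v\<in>supp_below k. {x. trunc k x = v}) = space M" using trunc_supp[of k] by auto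
    then show ?thesis by (simp only: prob_space)
  qed
  also have "\<dots> = (\<Sum>v\<in>supp_below k. prob {x. trunc k x = v})"
    using sets_trunc by (intro finite_measure_finite_Union finite_supp_below) (auto simp: disjoint_family_on_def)
  also have "\<dots> = (\<Sum>v\<in>(supp_below k :: (nat \<Rightarrow> 'a) set). prob {x. trunc k x = u})"
    by (intro sum.cong refl prob_cylinder_eq u)
  also have "\<dots> = CARD('a) ^ k * prob {x. trunc k x = u}"
    by (simp add: card_supp_below)
  finally show ?thesis by (simp add: field_simps power_one_over)
qed

lemma eq_uniform_bernoulli: "M = uniform_bernoulli"
proof (rule measure_eqI_PiM_infinite[where M = "\<lambda>_. uniform_count_measure UNIV" and I = UNIV])
  show "sets M = sets (\<Pi>\<^sub>M i\<in>UNIV. uniform_count_measure (UNIV :: 'a set))" by (rule sets_PiM)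
  show "sets uniform_bernoulli = sets (\<Pi>\<^sub>M i\<in>UNIV. uniform_count_measure (UNIV :: 'a set))"
    by (simp add: uniform_bernoulli_def)
  show "finite_measure M" by (rule finite_measure_axioms)
  fix A :: "nat \<Rightarrow> 'a set" and J :: "nat set"
  assume J: "finite J"
  obtain k where k: "J \<subseteq> {..<k}"
    using finite_nat_set_iff_bounded[of J] J by blast
  define D where "D = {d \<in> supp_below k. \<forall>j\<in>J. d j \<in> A j}"
  have fin: "finite D" using finite_supp_below[where 'a = 'a and m = k] by (simp add: D_def)
  have eq: "prod_emb UNIV (\<lambda>_. uniform_count_measure UNIV) J (Pi\<^sub>E J A) = (\<Union>d\<in>D. {x. trunc k x = d})"
  proof -
    have "x \<in> prod_emb UNIV (\<lambda>_. uniform_count_measure UNIV) J (Pi\<^sub>E J A) \<longleftrightarrow> (\<forall>j\<in>J. x j \<in> A j)" for x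
      by (auto simp: prod_emb_def PiE_iff space_uniform_count_measure restrict_def extensional_def)
    moreover have "(\<forall>j\<in>J. x j \<in> A j) \<longleftrightarrow> trunc k x \<in> D" for x
      using k trunc_supp[of k x] by (auto simp: D_def trunc_apply subset_iff)
    ultimately show ?thesis by auto
  qed
  have cyl: "emeasure M {x. trunc k x = d} = emeasure uniform_bernoulli {x. trunc k x = d}" if "d \<in> D" for d
  proof -
    have "d \<in> supp_below k" using that by (simp add: D_def)
    moreover have "{x. trunc k x = d} = {x. \<forall>i\<in>{..<k}. x i = d i}"
      using trunc_eq_iff[of k _ d] trunc_id[OF calculation] by auto
    ultimately show ?thesis
      using emeasure_uniform_bernoulli_cylinder[of "{..<k}" d] prob_cylinder[of d k]
      by (simp add: emeasure_eq_measure)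
  qed
  have dis: "disjoint_family_on (\<lambda>d. {x. trunc k x = d}) D" by (auto simp: disjoint_family_on_def)
  have setsU: "sets (uniform_bernoulli :: (nat \<Rightarrow> 'a) measure) = sets M"
    by (simp add: sets_M sets_uniform_bernoulli)
  have cs: "(\<lambda>d. {x. trunc k x = d}) ` D \<subseteq> sets M" by (rule image_subsetI) (rule sets_trunc)
  have "emeasure M (\<Union>d\<in>D. {x. trunc k x = d}) = (\<Sum>d\<in>D. emeasure M {x. trunc k x = d})"
    by (rule sum_emeasure[OF cs dis fin, symmetric])
  moreover have "emeasure uniform_bernoulli (\<Union>d\<in>D. {x. trunc k x = d}) = (\<Sum>d\<in>D. emeasure uniform_bernoulli {x. trunc k x = d})"
    by (rule sum_emeasure[OF _ dis fin, symmetric]) (simp only: setsU cs)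
  moreover have "(\<Sum>d\<in>D. emeasure M {x. trunc k x = d}) = (\<Sum>d\<in>D. emeasure uniform_bernoulli {x. trunc k x = d})"
    by (rule sum.cong[OF refl cyl])
  ultimately show "emeasure M (prod_emb UNIV (\<lambda>_. uniform_count_measure UNIV) J (Pi\<^sub>E J A)) =
      emeasure uniform_bernoulli (prod_emb UNIV (\<lambda>_. uniform_count_measure UNIV) J (Pi\<^sub>E J A))"
    by (simp only: eq)
qed

end

section \<open>From the hypotheses of the theorem to the locale assumptions\<close>

lemma (in full_prob_space) invariant_sets_iff:
  assumes T: "preserves T" and B: "B \<in> sets M"
  shows "B \<in> invariant_sets M T \<longleftrightarrow> (AE x in M. T x \<in> B \<longleftrightarrow> x \<in> B)"
proof -
  have "sym_diff (T -` B) B \<in> sets M"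
    using preserves_vimage_sets[OF T B] B by auto
  moreover have "sym_diff (T -` B) B = {x \<in> space M. \<not> (T x \<in> B \<longleftrightarrow> x \<in> B)}" by auto
  ultimately show ?thesis
    using B by (simp add: invariant_sets_def AE_iff_measurable[OF _ refl])
qed

lemma (in full_prob_space) preserves_if_invariant_measure:
  assumes "T \<in> measurable M M" "invariant_measure M T"
  shows "preserves T"
proof (rule preservesI[OF assms(1)])
  fix B assume "B \<in> sets M"
  then show "prob (T -` B) = prob B"
    using assms(2) by (simp add: invariant_measure_def measure_def)
qed

text \<open>Invariance under the two generators suffices: F^-1 preserves M, so invariance under F
  passes to negative powers, and then to compositions with powers of \<sigma>.\<close>

lemma (in CA_measure) ZN_action_invariant_sets:
  assumes B: "B \<in> sets M" and F: "AE x in M. F x \<in> B \<longleftrightarrow> x \<in> B"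
    and S: "AE x in M. shift_map x \<in> B \<longleftrightarrow> x \<in> B"
  shows "B \<in> invariant_sets M (ZN_action F shift_map i)"
proof -
  obtain k n where i: "i = (k, n)" by (cases i)
  have "AE x in M. F (inv F x) \<in> B \<longleftrightarrow> inv F x \<in> B"
    by (rule preserves_AE[OF preserves_inv_F F])
  then have I: "AE x in M. inv F x \<in> B \<longleftrightarrow> x \<in> B"
    by eventually_elim (simp add: F_inv_F)
  have k: "preserves (int_iter F k)" "AE x in M. int_iter F k x \<in> B \<longleftrightarrow> x \<in> B"
    using AE_invariant_pow[OF preserves_F F, of "nat k"] AE_invariant_pow[OF preserves_inv_F I, of "nat (- k)"]
    by (auto simp: int_iter_def intro: preserves_funpow preserves_F preserves_inv_F)
  note Sn = preserves_funpow[OF preserves_shift, of n]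
  have "AE x in M. int_iter F k ((shift_map ^^ n) x) \<in> B \<longleftrightarrow> x \<in> B"
    using preserves_AE[OF Sn k(2)] AE_invariant_pow[OF preserves_shift S, of n]
    by eventually_elim simp
  then show ?thesis
    using invariant_sets_iff[OF preserves_comp[OF k(1) Sn] B] by (simp add: i ZN_action_def)
qed

text \<open>For affine rules, class (A) says that \<open>Im \<beta> = \<alpha> (Ker \<beta>)\<close> is a complement of \<open>Ker \<beta>\<close>.\<close>

lemma affine_class_A_rule:
  fixes F :: "(nat \<Rightarrow> 'a::{finite,discrete_topology,ab_group_add}) \<Rightarrow> nat \<Rightarrow> 'a"
  assumes prime: "prime p" and card: "CARD('a) = p ^ 2" and aff: "affine_CA F" and A: "class_A F"
  obtains \<alpha> \<beta> c f' where "group_CA p F \<alpha> \<beta> c f'"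
proof -
  obtain H c where H: "\<And>x y. H (x + y) = H x + H y" and F: "\<And>x. F x = H x + c"
    using aff unfolding affine_CA_def by blast
  obtain f f' where f: "\<And>x m. F x m = f (x m) (x (Suc m))" and f': "\<And>x m. inv F x m = f' (x m) (x (Suc m))"
    and bij: "bij F"
    and A1: "\<And>C C'. C \<in> rule_partition f \<Longrightarrow> C' \<in> rule_partition f \<Longrightarrow> card (C \<inter> rule_pi f ` C') \<le> 1"
    and A2: "\<And>a. range (f a) = rule_pi f ` rule_class f a"
    using A unfolding class_A_def invertible_CA_def has_radius_1_def is_local_rule_def by blast
  \<comment> \<open>The local rule reads two cells, so the sequences a b b b ... suffice to recover
    it.\<close>
  define pt :: "'a \<Rightarrow> 'a \<Rightarrow> nat \<Rightarrow> 'a" where "pt a b i = (if i = 0 then a else b)" for a b i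
  define g where "g a b = H (pt a b) 0" for a b
  have pt_add: "pt (a + a') (b + b') = pt a b + pt a' b'" for a a' b b'
    by (simp add: pt_def fun_eq_iff)
  have g_add: "g (a + a') (b + b') = g a b + g a' b'" for a a' b b'
    unfolding g_def pt_add H by simp
  have fg: "f a b = g a b + c 0" for a b
    using f[of "pt a b" 0] F[of "pt a b"] by (simp add: g_def pt_def)
  define \<alpha> \<beta> where "\<alpha> a = g a 0" and "\<beta> b = g 0 b" for a b
  have \<alpha>_hom: "add_hom \<alpha>"
    by standard (use g_add[of _ _ 0 0] in \<open>simp add: \<alpha>_def\<close>)
  have \<beta>_hom: "add_hom \<beta>"
    by standard (use g_add[of 0 0] in \<open>simp add: \<beta>_def\<close>)
  have f_eq: "f a b = \<alpha> a + \<beta> b + c 0" for a b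
    using g_add[of a 0 0 b] by (simp add: fg \<alpha>_def \<beta>_def)
  have inj: "inj \<alpha>"
  proof (rule injI)
    fix a b assume "\<alpha> a = \<alpha> b"
    \<comment> \<open>Cell 0 of the image depends on a through \<alpha> a, and all later cells see
      only zeros.\<close>
    then have "F (pt a 0) m = F (pt b 0) m" for m
      by (cases m) (simp_all add: f f_eq pt_def)
    then have "F (pt a 0) = F (pt b 0)" by (rule ext)
    then have "pt a 0 = pt b 0" using bij by (simp add: bij_def inj_eq)
    then have "pt a 0 0 = pt b 0 0" by (rule fun_cong)
    then show "a = b" by (simp add: pt_def)
  qed
  have class_eq: "rule_class f a = {b. \<beta> b = \<beta> a}" for a
    by (auto simp: rule_class_def rule_rel_def f_eq fun_eq_iff)
  have part: "rule_class f a \<in> rule_partition f" for a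
    by (simp add: rule_class_def rule_partition_def quotientI)
  let ?K = "{a. \<beta> a = 0}"
  have \<alpha>0: "\<alpha> 0 = 0" and \<beta>0: "\<beta> 0 = 0"
    by (rule add_hom_zero[OF \<alpha>_hom], rule add_hom_zero[OF \<beta>_hom])
  have pi_K: "rule_pi f ` ?K = (\<lambda>a. a + c 0) ` \<alpha> ` ?K"
    by (auto simp: rule_pi_def f_eq image_image intro!: image_cong)
  \<comment> \<open>Condition (2) at the letter 0, both sides being translated by c 0.\<close>
  have "(\<lambda>a. a + c 0) ` range \<beta> = (\<lambda>a. a + c 0) ` \<alpha> ` ?K"
    using A2[of 0] pi_K by (simp add: class_eq \<alpha>0 \<beta>0 f_eq image_image)
  then have range: "range \<beta> = \<alpha> ` ?K"
    by (subst (asm) inj_image_eq_iff) (auto intro: injI)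
  have disjoint: "a = 0" if a: "\<beta> a = 0" "a \<in> \<alpha> ` ?K" for a
  proof -
    \<comment> \<open>Condition (1) for the classes of c 0 and of 0: both c 0 and a + c 0 lie in the
      intersection, so they coincide.\<close>
    let ?I = "rule_class f (c 0) \<inter> rule_pi f ` rule_class f 0"
    have "0 \<in> \<alpha> ` ?K" using \<alpha>0 \<beta>0 by (metis (mono_tags, lifting) image_eqI mem_Collect_eq)
    then have "{c 0, a + c 0} \<subseteq> ?I"
      using a pi_K add_hom_add[OF \<beta>_hom] by (auto simp: class_eq \<beta>0)
    then have "card {c 0, a + c 0} \<le> card ?I" by (intro card_mono) auto
    also have "\<dots> \<le> 1" by (rule A1[OF part part])
    finally show ?thesis by (cases "a = 0") auto
  qed
  have "group_CA p F \<alpha> \<beta> (c 0) f'"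
    by (rule group_CA.intro) (use prime card f f_eq bij f' \<alpha>_hom \<beta>_hom inj range disjoint in auto)
  then show ?thesis by (rule that)
qed

theorem proposition6p5:
  fixes p :: nat
    and F :: "(nat \<Rightarrow> 'a::{finite,discrete_topology,ab_group_add}) \<Rightarrow> (nat \<Rightarrow> 'a)"
    and \<mu> :: "(nat \<Rightarrow> 'a) measure"
  assumes "prime p"
    and "CARD('a) = p ^ 2"
    and "affine_CA F"
    and "class_A F"
    and "prob_space \<mu>"
    and "sets \<mu> = sets borel"
    and "invariant_measure \<mu> F"
    and "invariant_measure \<mu> shift_map"
    and "ergodic_action \<mu> (ZN_action F shift_map)"
    and "invariant_sets \<mu> F = invariant_sets \<mu> (F ^^ (p * (p - 1) * (p ^ 2 - 1)))"
    and "KS_entropy \<mu> shift_map > 0"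
  shows "\<mu> = uniform_bernoulli"
proof -
  have space: "space \<mu> = UNIV"
    using sets_eq_imp_space_eq[OF assms(6)] by simp
  interpret full_prob_space \<mu>
    by (intro full_prob_space.intro full_prob_space_axioms.intro assms(5) space)
  have meas: "T \<in> measurable \<mu> \<mu>" if "continuous_on UNIV T" for T
    using borel_measurable_continuous_onI[OF that] by (simp add: measurable_cong_sets[OF assms(6) assms(6)])
  have "continuous_on UNIV (shift_map :: (nat \<Rightarrow> 'a) \<Rightarrow> nat \<Rightarrow> 'a)"
    unfolding shift_map_def
    by (intro continuous_on_coordinatewise_then_product continuous_on_product_coordinates)
  then have shift: "preserves shift_map"
    by (rule preserves_if_invariant_measure[OF meas assms(8)])
  have "continuous_on UNIV F"
    using assms(4) by (simp add: class_A_def invertible_CA_def one_sided_CA_def)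
  then have F: "preserves F"
    by (rule preserves_if_invariant_measure[OF meas assms(7)])
  obtain \<alpha> \<beta> c f' where "group_CA p F \<alpha> \<beta> c f'"
    by (rule affine_class_A_rule[OF assms(1-4)])
  then interpret CA_measure p F \<alpha> \<beta> c f' \<mu>
    by (intro CA_measure.intro CA_measure_axioms.intro seq_prob.intro seq_prob_axioms.intro
        full_prob_space_axioms assms(6) shift F)
  interpret rigid_CA p F \<alpha> \<beta> c f' \<mu>
  proof
    fix B assume B: "B \<in> sets \<mu>"
    show "AE x in \<mu>. F x \<in> B \<longleftrightarrow> x \<in> B" if "AE x in \<mu>. (F ^^ N) x \<in> B \<longleftrightarrow> x \<in> B"
      using that invariant_sets_iff[OF preserves_funpow[OF F] B] invariant_sets_iff[OF F B] assms(10)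
      by (simp add: N_def)
    show "prob B = 0 \<or> prob B = 1"
      if "AE x in \<mu>. F x \<in> B \<longleftrightarrow> x \<in> B" "AE x in \<mu>. shift_map x \<in> B \<longleftrightarrow> x \<in> B"
      using assms(9) ZN_action_invariant_sets[OF B that]
      by (auto simp: ergodic_action_def emeasure_eq_measure)
  qed (rule assms(11))
  show ?thesis by (rule eq_uniform_bernoulli)
qed

end
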